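(* Let $\alpha\in(0,1)$ and $q>\alpha$. Let $Z\sim\kappa_q(1,\cdot)$ be a random continuous nonnegative path on $[0,1]$ with $Z(0)=Z(1)=0$. Suppose that $Z$ is $\gamma$-Hölder continuous for some $\gamma\in(0,q)$, that $D_\gamma:=\sup_{0\le r<s\le 1}\frac{|Z(s)-Z(r)|}{|s-r|^\gamma}$ has moments of all orders, and that $c:=(1+\alpha)(\Gamma(1-\alpha))^{-1}\mathbb{E}((Z(U))^{\alpha/q})>0$, where $U$ is uniform on $[0,1]$ and independent of $Z$. Let $X$ be a $\kappa_q$-marked spectrally positive stable Lévy process with Laplace exponent $\psi(\eta)=\eta^{1+\alpha}$ and marks $Z_t$. Let $T>0$ and assume $\gamma<q-\alpha$. Then the set $\{t\in[0,T]:\Delta X_t>0\}$ of jump times may a.s. be partitioned into sequences $\{J^k_j,\ j\ge 1\}$, $k\ge 1$, in such a way that (1) the jump intervals $[X(J^k_j-),X(J^k_j)]$, $j\ge 1$, are disjoint for each $k\ge 1$; (2) the Hölder constants $$D_{[0,T]}^{k}=\sup_{j\ge 1}\ \sup_{0\le x<y\le\Delta X(J^k_j)}\frac{|Z_{J^k_j}(y)-Z_{J^k_j}(x)|}{|y-x|^\gamma}$$ are summable in $k\ge 1$.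
   Context: $X=(X_t,t\ge 0)$ is a Lévy process with $X_0=0$, no negative jumps, and $\mathbb{E}(e^{-\eta X_t})=e^{t\psi(\eta)}$, $\eta\ge 0$. Write $X(t)=X_t$, $X(t-)=X_{t-}$ and $\Delta X(t)=\Delta X_t=X_t-X_{t-}$. $\kappa_q$-marking: for $x>0$, $\kappa_q(x,\cdot)$ is the distribution of $(x^qZ(s/x),0\le s\le x)$, where $Z\sim\kappa_q(1,\cdot)$. Given $X$, each jump $(t,\Delta X_t)$ with $\Delta X_t>0$ is marked, independently over the jumps, by a random path $Z_t=(Z_t(s),0\le s\le\Delta X_t)$ with distribution $\kappa_q(\Delta X_t,\cdot)$. A random variable $V$ has moments of all orders if $\mathbb{E}(|V|^p)<\infty$ for all $p>0$. *)

theory Defs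
  imports "HOL-Probability.Probability"
begin

text \<open>Cadlag paths on the time axis \<open>[0, \<infinity>)\<close>; values at negative times are irrelevant.\<close>

definition cadlag :: "(real \<Rightarrow> real) \<Rightarrow> bool" where
  "cadlag x \<longleftrightarrow>
     (\<forall>t\<ge>0. (x \<longlongrightarrow> x t) (at_right t)) \<and>
     (\<forall>t>0. \<exists>l. (x \<longlongrightarrow> l) (at_left t))"

text \<open>Convention \<open>x(0-) = x(0)\<close>, so that there is no jump at time 0.\<close>

definition left_lim :: "(real \<Rightarrow> real) \<Rightarrow> real \<Rightarrow> real" where
  "left_lim x t = (if t \<le> 0 then x 0 else Lim (at_left t) x)"

definition jump :: "(real \<Rightarrow> real) \<Rightarrow> real \<Rightarrow> real" where
  "jump x t = x t - left_lim x t"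

definition levy_process :: "'a measure \<Rightarrow> (real \<Rightarrow> 'a \<Rightarrow> real) \<Rightarrow> bool" where
  "levy_process M X \<longleftrightarrow>
     prob_space M \<and>
     (\<forall>t\<ge>0. X t \<in> borel_measurable M) \<and>
     (\<forall>\<omega>\<in>space M. cadlag (\<lambda>t. X t \<omega>)) \<and>
     (AE \<omega> in M. X 0 \<omega> = 0) \<and>
     (\<forall>s\<ge>0. \<forall>h\<ge>0. distr M borel (\<lambda>\<omega>. X (s + h) \<omega> - X s \<omega>) = distr M borel (X h)) \<and>
     (\<forall>(n::nat) (t::nat \<Rightarrow> real). 0 \<le> t 0 \<and> (\<forall>i<n. t i < t (Suc i)) \<longrightarrow>
        prob_space.indep_vars M (\<lambda>_. borel) (\<lambda>i \<omega>. X (t (Suc i)) \<omega> - X (t i) \<omega>) {..<n})"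

definition no_negative_jumps :: "'a measure \<Rightarrow> (real \<Rightarrow> 'a \<Rightarrow> real) \<Rightarrow> bool" where
  "no_negative_jumps M X \<longleftrightarrow> (AE \<omega> in M. \<forall>t\<ge>0. jump (\<lambda>u. X u \<omega>) t \<ge> 0)"

definition has_laplace_exponent ::
  "'a measure \<Rightarrow> (real \<Rightarrow> 'a \<Rightarrow> real) \<Rightarrow> (real \<Rightarrow> real) \<Rightarrow> bool" where
  "has_laplace_exponent M X \<psi> \<longleftrightarrow>
     (\<forall>\<eta>\<ge>0. \<forall>t\<ge>0. has_bochner_integral M (\<lambda>\<omega>. exp (- \<eta> * X t \<omega>)) (exp (t * \<psi> \<eta>)))"

definition spectrally_positive_stable ::
  "'a measure \<Rightarrow> (real \<Rightarrow> 'a \<Rightarrow> real) \<Rightarrow> real \<Rightarrow> bool" where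
  "spectrally_positive_stable M X \<alpha> \<longleftrightarrow>
     levy_process M X \<and> no_negative_jumps M X \<and>
     has_laplace_exponent M X (\<lambda>\<eta>. \<eta> powr (1 + \<alpha>))"

text \<open>All marks vanish at both ends of their interval \<open>[0, x]\<close>. They are represented by their
  extensions by 0 to the real line, which are continuous; this gives one path space for all
  durations \<open>x\<close>. The sigma-algebra is generated by the evaluation maps.\<close>

definition path_space :: "(real \<Rightarrow> real) measure" where
  "path_space = restrict_space (\<Pi>\<^sub>M s\<in>UNIV. borel) {f. continuous_on UNIV f}"

definition random_excursion :: "'b measure \<Rightarrow> ('b \<Rightarrow> real \<Rightarrow> real) \<Rightarrow> bool" where
  "random_excursion N Z \<longleftrightarrow>
     prob_space N \<and> Z \<in> N \<rightarrow>\<^sub>M path_space \<and>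
     (\<forall>\<omega>\<in>space N. (\<forall>s\<in>{0..1}. Z \<omega> s \<ge> 0) \<and> Z \<omega> 0 = 0 \<and> Z \<omega> 1 = 0 \<and>
        (\<forall>s. s \<notin> {0..1} \<longrightarrow> Z \<omega> s = 0))"

text \<open>The kernel \<open>\<kappa>\<^sub>q(x, \<cdot>)\<close>, where \<open>Z\<close> (defined on \<open>N\<close>) has law \<open>\<kappa>\<^sub>q(1, \<cdot>)\<close>.\<close>

definition kappa ::
  "'b measure \<Rightarrow> ('b \<Rightarrow> real \<Rightarrow> real) \<Rightarrow> real \<Rightarrow> real \<Rightarrow> (real \<Rightarrow> real) measure" where
  "kappa N Z q x = distr N path_space (\<lambda>\<omega> s. x powr q * Z \<omega> (s / x))"

text \<open>The uniform variable \<open>U\<close>, independent of \<open>Z\<close>, is the second coordinate of the product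
  space.\<close>

definition mark_const :: "'b measure \<Rightarrow> ('b \<Rightarrow> real \<Rightarrow> real) \<Rightarrow> real \<Rightarrow> real \<Rightarrow> real" where
  "mark_const N Z \<alpha> q = (1 + \<alpha>) * inverse (Gamma (1 - \<alpha>)) *
     (LINT (\<omega>, u)|(N \<Otimes>\<^sub>M uniform_measure lborel {0..1}). Z \<omega> u powr (\<alpha> / q))"

definition holder_const :: "real \<Rightarrow> real \<Rightarrow> (real \<Rightarrow> real) \<Rightarrow> ennreal" where
  "holder_const \<gamma> x f =
     (SUP (r, s)\<in>{(r, s). 0 \<le> r \<and> r < s \<and> s \<le> x}. ennreal (\<bar>f s - f r\<bar> / \<bar>s - r\<bar> powr \<gamma>))"

definition moments_of_all_orders :: "'b measure \<Rightarrow> ('b \<Rightarrow> real) \<Rightarrow> bool" where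
  "moments_of_all_orders N V \<longleftrightarrow> (\<forall>p>0. integrable N (\<lambda>\<omega>. \<bar>V \<omega>\<bar> powr p))"

definition sigma_process :: "'a measure \<Rightarrow> (real \<Rightarrow> 'a \<Rightarrow> real) \<Rightarrow> 'a measure" where
  "sigma_process M X =
     vimage_algebra (space M) (\<lambda>\<omega>. \<lambda>t\<in>{0..}. X t \<omega>) (\<Pi>\<^sub>M t\<in>{0..}. borel)"

text \<open>Given \<open>X\<close>, the marks \<open>mark t\<close> of the jumps \<open>(t, \<Delta>X t)\<close> are independent with
  laws \<open>\<kappa> (\<Delta>X t)\<close>. Since the jump times are random, this is expressed along finitely many
  \<open>X\<close>-measurable random times \<open>\<tau> i\<close>: on any event \<open>A\<close> determined by \<open>X\<close> on which these are
  distinct jump times, the conditional joint law of their marks given \<open>X\<close> is the product of the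
  laws \<open>\<kappa> (\<Delta>X (\<tau> i))\<close> (in the integrated form of the definition of conditional probability).
  The values of \<open>mark\<close> at times that are not jump times play no role.\<close>

definition independently_marked ::
  "'a measure \<Rightarrow> (real \<Rightarrow> 'a \<Rightarrow> real) \<Rightarrow> (real \<Rightarrow> 'a \<Rightarrow> real \<Rightarrow> real) \<Rightarrow>
   (real \<Rightarrow> (real \<Rightarrow> real) measure) \<Rightarrow> bool" where
  "independently_marked M X mark \<kappa> \<longleftrightarrow>
     (\<forall>\<omega>\<in>space M. \<forall>t\<ge>0. jump (\<lambda>u. X u \<omega>) t > 0 \<longrightarrow> mark t \<omega> \<in> space path_space) \<and>
     (\<forall>(n::nat) (\<tau>::nat \<Rightarrow> 'a \<Rightarrow> real) A B.
        (\<forall>i<n. \<tau> i \<in> borel_measurable (sigma_process M X)) \<and>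
        A \<in> sets (sigma_process M X) \<and>
        (\<forall>\<omega>\<in>A. (\<forall>i<n. \<tau> i \<omega> \<ge> 0 \<and> jump (\<lambda>u. X u \<omega>) (\<tau> i \<omega>) > 0) \<and>
                inj_on (\<lambda>i. \<tau> i \<omega>) {..<n}) \<and>
        (\<forall>i<n. B i \<in> sets path_space) \<longrightarrow>
          {\<omega>\<in>A. \<forall>i<n. mark (\<tau> i \<omega>) \<omega> \<in> B i} \<in> sets M \<and>
          emeasure M {\<omega>\<in>A. \<forall>i<n. mark (\<tau> i \<omega>) \<omega> \<in> B i} =
            (\<integral>\<^sup>+\<omega>\<in>A. (\<Prod>i<n. emeasure (\<kappa> (jump (\<lambda>u. X u \<omega>) (\<tau> i \<omega>))) (B i)) \<partial>M))"

end

theory Submission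
  imports Defs "HOL-Complex_Analysis.Complex_Analysis" "HOL-Real_Asymp.Real_Asymp"
begin

text \<open>Fix a dyadic scale \<open>l = 2 ^ -n\<close> and look at the jumps up to time \<open>T\<close> whose size lies in
  \<open>(l/2, l]\<close>. Two almost sure bounds hold for all large \<open>n\<close>.

  First, no level belongs to more than about \<open>2 ^ (n (\<alpha> + \<epsilon>))\<close> of the jump intervals of this
  scale (\<open>eventually_not_crowded\<close>, \<open>clique_size\<close>). Colouring intervals greedily by their left
  endpoints therefore splits the scale into that many classes of disjoint intervals
  (\<open>interval_colouring\<close>). Second, the Hoelder constants of the marks of this scale are at most
  \<open>2 ^ (- n (q - \<gamma> - \<epsilon>))\<close> (\<open>eventually_smooth_marks\<close>): scaling multiplies the constant \<open>D\<close> of a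
  standard mark by \<open>x powr (q - \<gamma>)\<close>, there are only about \<open>2 ^ (n (1 + \<alpha>))\<close> such jumps, and \<open>D\<close>
  has moments of all orders. The product of the two bounds is summable over \<open>n\<close> exactly because
  \<open>\<alpha> < q - \<gamma>\<close> leaves room for a small \<open>\<epsilon>\<close>. The remaining jumps are finite in number, and each
  gets a class of its own.

  These classes are finite, whereas infinite sequences are wanted. Almost surely no jump takes
  the path to its maximum over the remaining time up to \<open>T\<close> (\<open>jump_is_overtaken\<close>). So for every
  finite set of jumps there is a time at which the path is above all their intervals; jumps
  accumulate right after that time (\<open>jump_in_every_interval\<close>), their intervals miss the given
  ones, and their Hoelder constants tend to 0. Every class can thus be padded to an infinite one
  at arbitrarily small cost (\<open>pad_classes\<close>).

  With \<open>\<beta> = 1 + \<alpha>\<close>, the Laplace exponent enters through three bounds on an increment \<open>Y\<close> over a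
  time span \<open>h\<close>: the tail \<open>P(\<bar>Y\<bar> \<ge> x) \<le> C h x powr -\<beta>\<close>, a matching lower bound for \<open>P(Y > x)\<close>
  when \<open>h x powr -\<beta>\<close> is small, and the concentration bound \<open>P(\<bar>Y - x\<bar> \<le> l) \<le> C l h powr (-1/\<beta>)\<close>.
  The first two test the law of \<open>Y\<close> with polynomials in \<open>exp (- \<eta> Y)\<close>; the third needs the
  characteristic function, which is reached by analytic continuation. Together they show that
  the walk \<open>X (j T / m)\<close> makes on average at most \<open>C l powr -\<alpha>\<close> large steps from near a given
  level, uniformly in the starting point and in all large \<open>m\<close>, and then a supermartingale gives
  exponential tails for the number of these steps (\<open>exponential_visits\<close>). Statements about the
  jumps of the path follow from statements about such walks as \<open>m\<close> tends to infinity
  (\<open>eventually_event_superset\<close>).\<close>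

section \<open>Tails and concentration from the Laplace transform\<close>

definition tail_const :: real where "tail_const = 4 * exp 4 / (1 - exp (-1))\<^sup>2"

lemma tail_const_ge_1: "tail_const \<ge> 1"
proof -
  have "(0::real) < 1 - exp (-1)" "1 - exp (-1::real) \<le> 1" by auto
  then have "0 < (1 - exp (-1::real))\<^sup>2" "(1 - exp (-1::real))\<^sup>2 \<le> 1"
    using power_le_one[of "1 - exp (-1::real)" 2] by auto
  moreover have "(1::real) \<le> 4 * exp 4" using exp_ge_add_one_self[of "4::real"] by linarith
  ultimately show ?thesis unfolding tail_const_def by (subst le_divide_eq) auto
qed

text \<open>The function \<open>(1 - exp (- \<eta> y))\<^sup>2\<close> is bounded away from 0 for \<open>\<bar>y\<bar> \<ge> 1 / \<eta>\<close> on both sides,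
  and its expectation combines the values of the Laplace transform at \<open>0\<close>, \<open>\<eta>\<close> and \<open>2 \<eta>\<close> to
  something of order \<open>h \<eta> powr \<beta>\<close>.\<close>
lemma (in prob_space) laplace_tail:
  fixes Y :: "'a \<Rightarrow> real"
  assumes [measurable]: "Y \<in> borel_measurable M"
    and L: "\<And>\<eta>. \<eta> \<ge> 0 \<Longrightarrow> has_bochner_integral M (\<lambda>\<omega>. exp (- \<eta> * Y \<omega>)) (exp (h * \<eta> powr \<beta>))"
    and h: "h \<ge> 0" and b: "1 < \<beta>" "\<beta> < 2" and x: "x > 0"
  shows "prob {\<omega>\<in>space M. \<bar>Y \<omega>\<bar> \<ge> x} \<le> tail_const * (h * x powr (-\<beta>))"
proof (cases "h * x powr (-\<beta>) \<le> 1")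
  case False
  have "prob {\<omega>\<in>space M. \<bar>Y \<omega>\<bar> \<ge> x} \<le> 1" by simp
  also have "1 \<le> tail_const * (h * x powr (-\<beta>))" using False tail_const_ge_1
    by (smt (verit) mult_less_cancel_right1 mult_le_cancel_right1)
  finally show ?thesis .
next
  case True
  define w where "w = h * x powr (-\<beta>)"
  have w: "0 \<le> w" "w \<le> 1" using True h by (auto simp: w_def)
  define \<eta> where "\<eta> = 1 / x"
  have \<eta>: "\<eta> > 0" "h * \<eta> powr \<beta> = w" "h * (2 * \<eta>) powr \<beta> = 2 powr \<beta> * w"
    using x by (auto simp: \<eta>_def w_def powr_divide powr_minus field_simps powr_mult)
  have I: "has_bochner_integral M (\<lambda>\<omega>. 1 - 2 * exp (- \<eta> * Y \<omega>) + exp (- (2 * \<eta>) * Y \<omega>))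
      (1 - 2 * exp w + exp (2 powr \<beta> * w))"
    using L[of \<eta>] L[of "2 * \<eta>"] \<eta>
    by (intro has_bochner_integral_add has_bochner_integral_diff has_bochner_integral_mult_right)
       (auto simp: has_bochner_integral_iff prob_space)
  have sq: "1 - 2 * exp (- \<eta> * Y \<omega>) + exp (- (2 * \<eta>) * Y \<omega>) = (1 - exp (- \<eta> * Y \<omega>))\<^sup>2" for \<omega>
    by (simp add: power2_diff exp_double[symmetric] mult.assoc)
  have pt: "(1 - exp (-1))\<^sup>2 * indicator {\<omega>\<in>space M. \<bar>Y \<omega>\<bar> \<ge> x} \<omega> \<le> 1 - 2 * exp (- \<eta> * Y \<omega>)
    + exp (- (2 * \<eta>) * Y \<omega>)" for \<omega>
  proof (cases "\<bar>Y \<omega>\<bar> \<ge> x")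
    case True
    have "\<bar>1 - exp (-1)\<bar> \<le> \<bar>1 - exp (- \<eta> * Y \<omega>)\<bar>"
    proof (cases "Y \<omega> \<ge> 0")
      case True
      then have "\<eta> * Y \<omega> \<ge> 1" using \<open>\<bar>Y \<omega>\<bar> \<ge> x\<close> x by (simp add: \<eta>_def)
      then show ?thesis by simp
    next
      case False
      then have "- \<eta> * Y \<omega> \<ge> 1" using \<open>\<bar>Y \<omega>\<bar> \<ge> x\<close> x by (simp add: \<eta>_def field_simps)
      then have "exp (- \<eta> * Y \<omega>) \<ge> 2" using exp_ge_add_one_self[of "- \<eta> * Y \<omega>"] by linarith
      then have "\<bar>1 - exp (- \<eta> * Y \<omega>)\<bar> \<ge> 1" by linarith
      moreover have "\<bar>1 - exp (-1::real)\<bar> \<le> 1" by simp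
      ultimately show ?thesis by linarith
    qed
    then show ?thesis unfolding sq abs_le_square_iff by (auto simp: indicator_def)
  next
    case False
    then show ?thesis unfolding sq by simp
  qed
  have "(1 - exp (-1))\<^sup>2 * prob {\<omega>\<in>space M. \<bar>Y \<omega>\<bar> \<ge> x}
      = (\<integral>\<omega>. (1 - exp (-1))\<^sup>2 * indicator {\<omega>\<in>space M. \<bar>Y \<omega>\<bar> \<ge> x} \<omega> \<partial>M)"
    by simp
  also have "\<dots> \<le> (\<integral>\<omega>. 1 - 2 * exp (- \<eta> * Y \<omega>) + exp (- (2 * \<eta>) * Y \<omega>) \<partial>M)"
    by (intro integral_mono pt integrable.intros[OF I] integrable_mult_right
      integrable_real_indicator)
       (auto simp: emeasure_eq_measure)
  also have "\<dots> = 1 - 2 * exp w + exp (2 powr \<beta> * w)" using I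
    by (rule has_bochner_integral_integral_eq)
  also have "\<dots> \<le> exp (2 powr \<beta> * w) - 1" using w by simp
  also have "2 powr \<beta> \<le> 2 powr (2::real)" using b by (intro powr_mono) auto
  then have "exp (2 powr \<beta> * w) - 1 \<le> exp (4 * w) - 1" using w by (simp add: mult_right_mono)
  also have "\<dots> \<le> 4 * exp 4 * w"
  proof -
    have "1 - exp (- (4 * w)) \<le> 4 * w" using exp_ge_add_one_self[of "- (4*w)"] by linarith
    then have "exp (4 * w) * (1 - exp (- (4 * w))) \<le> exp (4 * w) * (4 * w)" by simp
    also have "\<dots> \<le> exp 4 * (4 * w)" using w by (intro mult_right_mono) auto
    finally show ?thesis by (simp add: right_diff_distrib exp_add[symmetric] mult_ac)
  qed
  finally have "(1 - exp (-1))\<^sup>2 * prob {\<omega>\<in>space M. \<bar>Y \<omega>\<bar> \<ge> x} \<le> 4 * exp 4 * w" .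
  moreover have "(0::real) < (1 - exp (-1))\<^sup>2" by simp
  ultimately show ?thesis unfolding tail_const_def w_def by (simp add: field_simps)
qed

text \<open>With \<open>a = \<beta> - 1\<close> this is the strict concavity \<open>2 * 2 powr a > 1 + 3 powr a\<close>. Up to sign,
  the left side is the third difference at 0 of \<open>z powr \<beta>\<close>, and its sign drives the next lemma.\<close>
lemma powr_third_difference_pos:
  assumes "1 < \<beta>" "\<beta> < (2::real)"
  shows "3 * 2 powr \<beta> - 3 - 3 powr \<beta> > 0"
proof -
  define a where "a = \<beta> - 1"
  have a: "0 < a" "a < 1" using assms by (auto simp: a_def)
  have D: "\<And>z. z > 0 \<Longrightarrow> ((\<lambda>z. z powr a) has_real_derivative a * z powr (a - 1)) (at z)"
    by (rule has_real_derivative_powr)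
  obtain y where y: "2 < y" "y < 3" "3 powr a - 2 powr a = (3 - 2) * (a * y powr (a - 1))"
    using MVT2[of 2 3 "\<lambda>z. z powr a" "\<lambda>z. a * z powr (a - 1)"] D by force
  obtain z where z: "1 < z" "z < 2" "2 powr a - 1 powr a = (2 - 1) * (a * z powr (a - 1))"
    using MVT2[of 1 2 "\<lambda>z. z powr a" "\<lambda>z. a * z powr (a - 1)"] D by force
  have "y powr (a - 1) < z powr (a - 1)" using y z a by (intro powr_less_mono2_neg) auto
  then have "3 powr a - 2 powr a < 2 powr a - 1" using y z a by simp
  moreover have "2 powr \<beta> = 2 * 2 powr a" "3 powr \<beta> = 3 * 3 powr a"
    using powr_add[of 2 1 a] powr_add[of 3 1 a] by (auto simp: a_def)
  ultimately show ?thesis by simp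
qed

text \<open>The test function is \<open>p (exp (- \<eta> y))\<close> with \<open>p u = (1 - u)\<^sup>2 (v - u)\<close>. It is nonpositive
  for \<open>u \<ge> v\<close>, that is for \<open>y \<le> a\<close> when \<open>\<eta> = - ln v / a\<close>, and at most 1 for smaller \<open>u\<close>; so its
  expectation is a lower bound for \<open>P(Y > a)\<close>. Expanding \<open>p\<close> evaluates this expectation as
  \<open>F (h \<eta> powr \<beta>)\<close>, where \<open>F 0 = 0\<close> and the slope of \<open>F\<close> at 0 tends to the third difference
  above as \<open>v\<close> tends to 1. The constants come before the random variable because they are used
  for all increments at once.\<close>
lemma laplace_lower_tail:
  assumes b: "1 < \<beta>" "\<beta> < 2"
  obtains w1 c where "w1 > 0" "c > 0"
    "\<And>(M::'a measure) Y h a. prob_space M \<Longrightarrow> Y \<in> borel_measurable M \<Longrightarrow>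
       (\<And>\<eta>. \<eta> \<ge> 0 \<Longrightarrow> has_bochner_integral M (\<lambda>\<omega>. exp (- \<eta> * Y \<omega>)) (exp (h * \<eta> powr \<beta>))) \<Longrightarrow>
       h \<ge> 0 \<Longrightarrow> a > 0 \<Longrightarrow> h * a powr (-\<beta>) \<le> w1 \<Longrightarrow>
       c * (h * a powr (-\<beta>)) \<le> measure M {\<omega>\<in>space M. Y \<omega> > a}"
proof -
  define S where "S = 3 * 2 powr \<beta> - 3 - 3 powr \<beta>"
  have S: "S > 0" using powr_third_difference_pos[OF b] by (simp add: S_def)
  \<comment> \<open>Replacing 1 by \<open>v\<close> lowers the slope by \<open>(1 - v) (2 powr \<beta> - 2) \<le> S / 2\<close>.\<close>
  define v where "v = max (1/2) (1 - S / 4)"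
  have v: "0 < v" "v < 1" "1 - v \<le> S / 4" using S by (auto simp: v_def max_def)
  define S' where "S' = - (1 + 2 * v) + (2 + v) * 2 powr \<beta> - 3 powr \<beta>"
  have "2 powr \<beta> \<le> 2 powr (2::real)" "2 powr 1 \<le> 2 powr \<beta>" using b by (intro powr_mono; simp)+
  then have "(1 - v) * (2 powr \<beta> - 2) \<le> (S / 4) * 2" using v by (intro mult_mono) auto
  moreover have "S' = S - (1 - v) * (2 powr \<beta> - 2)" by (simp add: S'_def S_def algebra_simps)
  ultimately have S': "S' > 0" using S by simp
  define F where "F w = v - (1 + 2 * v) * exp w + (2 + v) * exp (2 powr \<beta> * w) - exp (3 powr \<beta> * w)"
    for w
  have "(F has_real_derivative S') (at 0)"
    unfolding F_def by (auto intro!: derivative_eq_intros simp: S'_def)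
  then have "((\<lambda>w. (F w - F 0) / (w - 0)) \<longlongrightarrow> S') (at 0)" by (simp add: has_field_derivative_iff)
  then have "eventually (\<lambda>w. (F w - F 0) / (w - 0) > S' / 2) (at 0)"
    using S' by (intro order_tendstoD) auto
  then obtain d where d: "d > 0" "\<And>w. w \<noteq> 0 \<Longrightarrow> \<bar>w\<bar> < d \<Longrightarrow> F w / w > S' / 2"
    unfolding eventually_at by (auto simp: F_def)
  have Fw: "F w \<ge> S' / 2 * w" if "0 \<le> w" "w < d" for w
    using d(2)[of w] that by (cases "w = 0") (auto simp: field_simps F_def)
  define \<kappa> where "\<kappa> = - ln v"
  have \<kappa>: "\<kappa> > 0" "exp (- \<kappa>) = v" using v by (auto simp: \<kappa>_def)
  show ?thesis
  proof (rule that[of "d / (2 * \<kappa> powr \<beta>)" "S' / 2 * \<kappa> powr \<beta>"])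
    show "d / (2 * \<kappa> powr \<beta>) > 0" "S' / 2 * \<kappa> powr \<beta> > 0" using d \<kappa> S' by auto
    fix M :: "'a measure" and Y h a
    assume "prob_space M" and [measurable]: "Y \<in> borel_measurable M"
      and L: "\<And>\<eta>. \<eta> \<ge> 0 \<Longrightarrow> has_bochner_integral M (\<lambda>\<omega>. exp (- \<eta> * Y \<omega>)) (exp (h * \<eta> powr \<beta>))"
      and h: "h \<ge> 0" and a: "a > 0" and ha: "h * a powr (-\<beta>) \<le> d / (2 * \<kappa> powr \<beta>)"
    interpret prob_space M by fact
    define \<eta> where "\<eta> = \<kappa> / a"
    define w where "w = h * \<eta> powr \<beta>"
    have w_eq: "w = \<kappa> powr \<beta> * (h * a powr (-\<beta>))" using a \<kappa>
      by (simp add: w_def \<eta>_def powr_divide powr_minus field_simps)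
    have w: "0 \<le> w" "w < d"
    proof -
      show "0 \<le> w" using h by (simp add: w_def)
      have "w \<le> d / 2" using ha \<kappa>(1) unfolding w_eq by (simp add: field_simps)
      then show "w < d" using d by simp
    qed
    have \<eta>: "\<eta> > 0" "h * (2 * \<eta>) powr \<beta> = 2 powr \<beta> * w" "h * (3 * \<eta>) powr \<beta> = 3 powr \<beta> * w"
      using a \<kappa> powr_mult[of 2 \<eta> \<beta>] powr_mult[of 3 \<eta> \<beta>] by (auto simp: \<eta>_def w_def)
    have I: "has_bochner_integral M (\<lambda>\<omega>. v - (1 + 2 * v) * exp (- \<eta> * Y \<omega>) + (2 + v)
      * exp (- (2 * \<eta>) * Y \<omega>)
          - exp (- (3 * \<eta>) * Y \<omega>)) (F w)"
      unfolding F_def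
      using L[of \<eta>] L[of "2 * \<eta>"] L[of "3 * \<eta>"] \<eta>
      by (intro has_bochner_integral_add has_bochner_integral_diff has_bochner_integral_mult_right)
         (auto simp: has_bochner_integral_iff prob_space w_def)
    have poly: "v - (1 + 2 * v) * exp (- \<eta> * y) + (2 + v) * exp (- (2 * \<eta>) * y)
      - exp (- (3 * \<eta>) * y)
        = (1 - exp (- \<eta> * y))\<^sup>2 * (v - exp (- \<eta> * y))" for y
    proof -
      have 2: "exp (- (2 * \<eta>) * y) = (exp (- \<eta> * y))\<^sup>2"
        by (simp add: exp_double[symmetric] mult.assoc)
      have 3: "exp (- (3 * \<eta>) * y) = (exp (- \<eta> * y)) ^ 3"
        using exp_of_nat_mult[of 3 "- \<eta> * y"] by (simp add: mult.assoc)
      show ?thesis unfolding 2 3 by (simp add: power2_eq_square power3_eq_cube algebra_simps)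
    qed
    have pt: "(1 - exp (- \<eta> * Y \<omega>))\<^sup>2 * (v - exp (- \<eta> * Y \<omega>)) \<le> indicator {\<omega>\<in>space M. Y \<omega> > a} \<omega>"
      if "\<omega> \<in> space M" for \<omega>
    proof (cases "Y \<omega> > a")
      case True
      have "\<eta> * Y \<omega> \<ge> 0" using True a \<eta> by simp
      then have e: "0 < exp (- \<eta> * Y \<omega>)" "exp (- \<eta> * Y \<omega>) \<le> 1" by auto
      have "(1 - exp (- \<eta> * Y \<omega>))\<^sup>2 * (v - exp (- \<eta> * Y \<omega>)) \<le> (1 - exp (- \<eta> * Y \<omega>))\<^sup>2 * 1"
        using e(1) v(2) by (intro mult_left_mono zero_le_power2) linarith
      also have "\<dots> \<le> 1" using e power_le_one[of "1 - exp (- \<eta> * Y \<omega>)" 2] by simp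
      finally show ?thesis using True that by simp
    next
      case False
      then have "- \<kappa> \<le> - \<eta> * Y \<omega>" using \<kappa>(1) a by (simp add: \<eta>_def field_simps)
      then have "v \<le> exp (- \<eta> * Y \<omega>)" using \<kappa>(2) by (metis exp_le_cancel_iff)
      then show ?thesis using False by (auto intro: mult_nonneg_nonpos)
    qed
    have "S' / 2 * \<kappa> powr \<beta> * (h * a powr (-\<beta>)) = S' / 2 * w" by (simp add: w_eq)
    also have "\<dots> \<le> F w" using Fw w by blast
    also have "F w = (\<integral>\<omega>. (1 - exp (- \<eta> * Y \<omega>))\<^sup>2 * (v - exp (- \<eta> * Y \<omega>)) \<partial>M)"
      using has_bochner_integral_integral_eq[OF I] unfolding poly by simp
    also have "\<dots> \<le> (\<integral>\<omega>. indicator {\<omega>\<in>space M. Y \<omega> > a} \<omega> \<partial>M)"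
      using integrable.intros[OF I] unfolding poly
      by (intro integral_mono pt integrable_real_indicator) (auto simp: emeasure_eq_measure)
    also have "\<dots> = measure M {\<omega>\<in>space M. Y \<omega> > a}" by simp
    finally show "S' / 2 * \<kappa> powr \<beta> * (h * a powr (-\<beta>)) \<le> measure M {\<omega>\<in>space M. Y \<omega> > a}" .
  qed
qed

text \<open>Expanding the exponential about \<open>r\<close> gives a power series. In the disc through the origin
  the exponents \<open>r - \<bar>z - r\<bar>\<close> and \<open>r + \<bar>z - r\<bar>\<close> are both positive, and the two real exponentials
  with these exponents dominate its partial sums.\<close>
lemma (in prob_space) complex_laplace_holomorphic:
  fixes Y :: "'a \<Rightarrow> real"
  assumes [measurable]: "Y \<in> borel_measurable M"
    and L: "\<And>\<eta>. \<eta> \<ge> 0 \<Longrightarrow> integrable M (\<lambda>\<omega>. exp (- \<eta> * Y \<omega>))"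
    and r: "r > 0"
  shows "(\<lambda>z. \<integral>\<omega>. exp (- z * complex_of_real (Y \<omega>)) \<partial>M) holomorphic_on ball (complex_of_real r) r"
proof (rule power_series_holomorphic)
  fix z assume z: "z \<in> ball (complex_of_real r) r"
  define w where "w = z - complex_of_real r"
  have w: "cmod w < r" "0 \<le> cmod w" using z by (simp_all add: w_def dist_norm norm_minus_commute)
  define f where "f n \<omega> = exp (- complex_of_real r * Y \<omega>) * ((- w * Y \<omega>) ^ n /\<^sub>R fact n)" for n \<omega>
  have nf: "norm (f n \<omega>) = exp (- r * Y \<omega>) * ((cmod w * \<bar>Y \<omega>\<bar>) ^ n /\<^sub>R fact n)" for n \<omega>
    by (simp add: f_def norm_mult norm_power norm_divide norm_exp_eq_Re divide_inverse)
  have sumsn: "(\<lambda>n. norm (f n \<omega>)) sums (exp (- r * Y \<omega>) * exp (cmod w * \<bar>Y \<omega>\<bar>))" for \<omega>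
    unfolding nf by (intro sums_mult exp_converges)
  define D where "D \<omega> = exp (- (r - cmod w) * Y \<omega>) + exp (- (r + cmod w) * Y \<omega>)" for \<omega>
  have D: "integrable M D" unfolding D_def using w r
    by (intro Bochner_Integration.integrable_add L) linarith+
  have le: "exp (- r * Y \<omega>) * exp (cmod w * \<bar>Y \<omega>\<bar>) \<le> D \<omega>" for \<omega>
    unfolding D_def exp_add[symmetric]
    by (cases "Y \<omega> \<ge> 0") (auto simp: algebra_simps add_increasing add_increasing2)
  have [measurable]: "f n \<in> borel_measurable M" for n unfolding f_def by measurable
  have f_le: "norm (f n \<omega>) \<le> D \<omega>" for n \<omega>
    using sum_le_suminf[OF sums_summable[OF sumsn[of \<omega>]], of
      "{n}"] sums_unique[OF sumsn[of \<omega>]] le[of \<omega>] by simp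
  have D0: "D \<omega> \<ge> 0" for \<omega> by (simp add: D_def)
  have fint: "integrable M (f n)" for n
    by (rule Bochner_Integration.integrable_bound[OF D]) (use f_le D0 in auto)
  have "(\<lambda>n. \<integral>\<omega>. f n \<omega> \<partial>M) sums (\<integral>\<omega>. (\<Sum>n. f n \<omega>) \<partial>M)"
  proof (rule sums_integral[OF fint])
    show "AE \<omega> in M. summable (\<lambda>n. norm (f n \<omega>))" using sumsn sums_summable by blast
    show "summable (\<lambda>n. \<integral>\<omega>. norm (f n \<omega>) \<partial>M)"
    proof (rule bounded_imp_summable)
      show "0 \<le> (\<integral>\<omega>. norm (f n \<omega>) \<partial>M)" for n by simp
      fix n
      have "(\<Sum>k\<le>n. \<integral>\<omega>. norm (f k \<omega>) \<partial>M) = (\<integral>\<omega>. (\<Sum>k\<le>n. norm (f k \<omega>)) \<partial>M)"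
        using fint by (intro Bochner_Integration.integral_sum[symmetric]) auto
      also have "\<dots> \<le> (\<integral>\<omega>. D \<omega> \<partial>M)"
      proof (rule integral_mono[OF _ D])
        show "integrable M (\<lambda>\<omega>. \<Sum>k\<le>n. norm (f k \<omega>))" using fint by auto
        fix \<omega>
        show "(\<Sum>k\<le>n. norm (f k \<omega>)) \<le> D \<omega>"
          using sum_le_suminf[OF sums_summable[OF sumsn[of \<omega>]], of
            "{..n}"] sums_unique[OF sumsn[of \<omega>]] le[of \<omega>]
          by simp
      qed
      finally show "(\<Sum>k\<le>n. \<integral>\<omega>. norm (f k \<omega>) \<partial>M) \<le> (\<integral>\<omega>. D \<omega> \<partial>M)" .
    qed
  qed
  moreover have "(\<Sum>n. f n \<omega>) = exp (- z * complex_of_real (Y \<omega>))" for \<omega>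
  proof -
    have "(\<lambda>n. f n \<omega>) sums (exp (- complex_of_real r * Y \<omega>) * exp (- w * Y \<omega>))"
      unfolding f_def by (intro sums_mult exp_converges)
    then show ?thesis unfolding exp_add[symmetric] by (simp add: w_def algebra_simps sums_iff)
  qed
  moreover have "f n \<omega> = (exp (- complex_of_real r * Y \<omega>)
    * ((- complex_of_real (Y \<omega>)) ^ n /\<^sub>R fact n)) * w ^ n" for n \<omega>
    by (simp add: f_def power_mult_distrib power_minus' scaleR_conv_of_real)
  then have "(\<integral>\<omega>. f n \<omega> \<partial>M) =
    (\<integral>\<omega>. exp (- complex_of_real r * Y \<omega>) * ((- complex_of_real
      (Y \<omega>)) ^ n /\<^sub>R fact n) \<partial>M) * w ^ n" for n
    by simp
  ultimately show "(\<lambda>n. (\<integral>\<omega>. exp (- complex_of_real r * Y \<omega>)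
    * ((- complex_of_real (Y \<omega>)) ^ n /\<^sub>R fact n) \<partial>M) *
       (z - complex_of_real r) ^ n) sums (\<integral>\<omega>. exp (- z * complex_of_real (Y \<omega>)) \<partial>M)"
    unfolding w_def by simp
qed

text \<open>The right half plane is covered by discs about real points that touch the imaginary axis
  at 0. In each of them both sides are holomorphic, and they agree on the real diameter.\<close>
lemma (in prob_space) complex_laplace_eq:
  fixes Y :: "'a \<Rightarrow> real"
  assumes [measurable]: "Y \<in> borel_measurable M"
    and L: "\<And>\<eta>. \<eta> \<ge> 0 \<Longrightarrow> has_bochner_integral M (\<lambda>\<omega>. exp (- \<eta> * Y \<omega>)) (exp (h * \<eta> powr \<beta>))"
    and z: "Re z > 0"
  shows "(\<integral>\<omega>. exp (- z * complex_of_real (Y \<omega>)) \<partial>M) =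
    exp (complex_of_real h * z powr complex_of_real \<beta>)"
proof -
  \<comment> \<open>\<open>\<bar>z - r\<bar> < r\<close> means \<open>\<bar>z\<bar>\<^sup>2 < 2 r Re z\<close>.\<close>
  define r where "r = (cmod z)\<^sup>2 / Re z"
  have z0: "z \<noteq> 0" using z by auto
  have r: "r > 0" using z z0 by (simp add: r_def)
  have rz: "r * Re z = (cmod z)\<^sup>2" using z by (simp add: r_def)
  let ?B = "ball (complex_of_real r) r"
  have "(cmod (complex_of_real r - z))\<^sup>2 = r\<^sup>2 - 2 * (r * Re z) + (cmod z)\<^sup>2"
    unfolding cmod_power2 by (simp add: power2_diff algebra_simps)
  also have "\<dots> < r\<^sup>2" unfolding rz using z0 by simp
  finally have zB: "z \<in> ?B" using r by (simp add: dist_norm power2_less_imp_less)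
  have pos: "Re y > 0" if "y \<in> ?B" for y
    using that abs_Re_le_cmod[of "complex_of_real r - y"] by (auto simp: dist_norm)
  define g where "g y = (\<integral>\<omega>. exp (- y * complex_of_real (Y \<omega>)) \<partial>M) - exp (complex_of_real h
    * y powr complex_of_real \<beta>)" for y
  have hol: "g holomorphic_on ?B"
    unfolding g_def
    by (intro holomorphic_intros complex_laplace_holomorphic r integrable.intros[OF L])
       (auto dest!: pos simp: complex_nonpos_Reals_iff simp del: mem_ball)
  have "g z = 0"
  proof (rule analytic_continuation[OF hol])
    show "complex_of_real ` {0<..<2*r} \<subseteq> ?B" by (auto simp: dist_norm simp flip: of_real_diff)
    show "complex_of_real r \<in> ?B" using r by simp
    show "complex_of_real r islimpt complex_of_real ` {0<..<2*r}"
      unfolding islimpt_approachable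
    proof (intro allI impI)
      fix e :: real assume e: "e > 0"
      define x where "x = r + min e r / 2"
      have "x \<in> {0<..<2*r}" "x \<noteq> r" "\<bar>x - r\<bar> < e"
        using e r by (auto simp: x_def min_def)
      then show "\<exists>x'\<in>complex_of_real ` {0<..<2*r}. x' \<noteq> complex_of_real r \<and>
        dist x' (complex_of_real r) < e"
        by (intro bexI[of _ "complex_of_real x"]) (auto simp: dist_norm simp flip: of_real_diff)
    qed
    fix y assume "y \<in> complex_of_real ` {0<..<2*r}"
    then obtain x where x: "y = complex_of_real x" "x > 0" by auto
    have "(\<integral>\<omega>. exp (- y * complex_of_real (Y \<omega>)) \<partial>M) = (\<integral>\<omega>. complex_of_real (exp (- x * Y \<omega>)) \<partial>M)"
      unfolding x by (intro Bochner_Integration.integral_cong refl)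
        (simp add: exp_of_real[symmetric])
    also have "\<dots> = complex_of_real (exp (h * x powr \<beta>))"
      using has_bochner_integral_integral_eq[OF L[of x]] x by simp
    also have "\<dots> = exp (complex_of_real h * y powr complex_of_real \<beta>)"
      using x by (simp add: powr_of_real exp_of_real[symmetric])
    finally show "g y = 0" by (simp add: g_def)
  qed (use zB in auto)
  then show ?thesis by (simp add: g_def)
qed

text \<open>The boundary value of the preceding identity at \<open>- \<i> u\<close>, by dominated convergence. The
  argument of \<open>(- \<i> u) powr \<beta>\<close> is \<open>\<beta> pi / 2\<close> up to sign; its cosine is negative for \<open>1 < \<beta> < 2\<close>.\<close>
lemma (in prob_space) char_bound:
  fixes Y :: "'a \<Rightarrow> real"
  assumes [measurable]: "Y \<in> borel_measurable M"
    and L: "\<And>\<eta>. \<eta> \<ge> 0 \<Longrightarrow> has_bochner_integral M (\<lambda>\<omega>. exp (- \<eta> * Y \<omega>)) (exp (h * \<eta> powr \<beta>))"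
    and u: "u \<noteq> 0"
  shows "cmod (\<integral>\<omega>. exp (\<i> * complex_of_real (u * Y \<omega>)) \<partial>M) =
    exp (h * cos (\<beta> * pi / 2) * \<bar>u\<bar> powr \<beta>)"
proof -
  define s where "s k = complex_of_real (1 / real (Suc k)) - \<i> * complex_of_real u" for k
  have s: "s \<longlonglongrightarrow> - \<i> * complex_of_real u"
  proof -
    have "(\<lambda>k. complex_of_real (1 / real (Suc k)) - \<i> * complex_of_real u) \<longlonglongrightarrow> complex_of_real 0 - \<i>
      * complex_of_real u"
      using LIMSEQ_inverse_real_of_nat by (intro tendsto_intros) (simp add: inverse_eq_divide)
    then show ?thesis by (simp add: s_def[abs_def])
  qed
  have "(\<lambda>k. \<integral>\<omega>. exp (- s k * complex_of_real (Y \<omega>)) \<partial>M) \<longlonglongrightarrow> (\<integral>\<omega>. exp (\<i> * complex_of_real (u * Y \<omega>))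
    \<partial>M)"
  proof (rule integral_dominated_convergence)
    show "integrable M (\<lambda>\<omega>. 1 + exp (- Y \<omega>))"
      using integrable.intros[OF L[of 1]] by (intro Bochner_Integration.integrable_add) auto
    show "AE \<omega> in M. (\<lambda>k. exp (- s k * complex_of_real (Y \<omega>))) \<longlonglongrightarrow> exp (\<i> * complex_of_real (u
      * Y \<omega>))"
    proof (rule AE_I2)
      fix \<omega>
      have "(\<lambda>k. exp (- s k * complex_of_real (Y \<omega>))) \<longlonglongrightarrow> exp (- (- \<i> * complex_of_real u)
        * complex_of_real (Y \<omega>))"
        by (intro tendsto_intros s)
      then show "(\<lambda>k. exp (- s k * complex_of_real (Y \<omega>))) \<longlonglongrightarrow> exp (\<i> * complex_of_real (u * Y \<omega>))"
        by (simp add: mult.assoc)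
    qed
    show "AE \<omega> in M. norm (exp (- s k * complex_of_real (Y \<omega>))) \<le> 1 + exp (- Y \<omega>)" for k
    proof (rule AE_I2)
      fix \<omega>
      have "norm (exp (- s k * complex_of_real (Y \<omega>))) = exp (- (1 / real (Suc k)) * Y \<omega>)"
        by (simp add: s_def norm_exp_eq_Re)
      also have "\<dots> \<le> 1 + exp (- Y \<omega>)"
      proof (cases "Y \<omega> \<ge> 0")
        case True
        then have "exp (- (1 / real (Suc k)) * Y \<omega>) \<le> 1" by simp
        then show ?thesis by (simp add: add_increasing2)
      next
        case False
        then have "(1 / real (Suc k)) * (- Y \<omega>) \<le> 1 * (- Y \<omega>)" by (intro mult_right_mono) auto
        then have "exp (- (1 / real (Suc k)) * Y \<omega>) \<le> exp (- Y \<omega>)" by simp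
        then show ?thesis by linarith
      qed
      finally show "norm (exp (- s k * complex_of_real (Y \<omega>))) \<le> 1 + exp (- Y \<omega>)" .
    qed
  qed auto
  then have "(\<lambda>k. cmod (\<integral>\<omega>. exp (- s k * complex_of_real (Y \<omega>)) \<partial>M)) \<longlonglongrightarrow> cmod (\<integral>\<omega>.
    exp (\<i> * complex_of_real (u * Y \<omega>)) \<partial>M)"
    by (rule tendsto_norm)
  moreover have "Re (s k) > 0" for k by (simp add: s_def)
  then have "(\<integral>\<omega>. exp (- s k * complex_of_real (Y \<omega>)) \<partial>M) =
    exp (complex_of_real h * s k powr complex_of_real \<beta>)" for k
    by (intro complex_laplace_eq L) auto
  moreover have "(\<lambda>k. cmod (exp (complex_of_real h * s k powr complex_of_real \<beta>))) \<longlonglongrightarrow>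
      cmod (exp (complex_of_real h * (- \<i> * complex_of_real u) powr complex_of_real \<beta>))"
    using u by (intro tendsto_intros s) (auto simp: complex_nonpos_Reals_iff)
  ultimately have "cmod (\<integral>\<omega>. exp (\<i> * complex_of_real (u * Y \<omega>)) \<partial>M) =
      cmod (exp (complex_of_real h * (- \<i> * complex_of_real u) powr complex_of_real \<beta>))"
    using LIMSEQ_unique by auto
  also have "\<dots> = exp (h * Re ((- \<i> * complex_of_real u) powr complex_of_real \<beta>))"
    by (simp add: norm_exp_eq_Re)
  also have "Re ((- \<i> * complex_of_real u) powr complex_of_real \<beta>) = cos (\<beta> * pi / 2) * \<bar>u\<bar> powr \<beta>"
  proof -
    let ?z = "- \<i> * complex_of_real u"
    have "Ln ?z = complex_of_real (ln \<bar>u\<bar>) + \<i> * complex_of_real (if u > 0 then - pi / 2 else pi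
      / 2)"
    proof (cases "u > 0")
      case True
      then show ?thesis using Ln_times_of_real[of u "- \<i>"] by (simp add: mult.commute Ln_of_real)
    next
      case False
      then have "- u > 0" using u by simp
      then show ?thesis using Ln_times_of_real[of "- u" "\<i>"] Ln_of_real[of "- u"] False u
        by (simp add: mult.commute Ln_of_real abs_if)
    qed
    then have "?z powr complex_of_real \<beta> =
      exp (complex_of_real (\<beta> * ln \<bar>u\<bar>) + \<i> * complex_of_real (\<beta> *
        (if u > 0 then - pi / 2 else pi / 2)))"
      using u unfolding powr_def by (simp add: distrib_left mult.assoc mult.left_commute)
    then have "Re (?z powr complex_of_real \<beta>) =
      exp (\<beta> * ln \<bar>u\<bar>) * cos (\<beta> * (if u > 0 then - pi / 2 else pi / 2))"
      by (simp add: Re_exp)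
    then show ?thesis using u by (auto simp: powr_def cos_minus[of "\<beta> * pi / 2"])
  qed
  finally show ?thesis by (simp add: mult.assoc)
qed

lemma nn_integral_two_sided_exponential:
  assumes B: "B > 0"
  shows "(\<integral>\<^sup>+\<theta>. ennreal (exp (1 - B * \<bar>\<theta>\<bar>)) \<partial>lborel) \<le> ennreal (2 * exp 1 / B)"
proof -
  have one: "(\<integral>\<^sup>+\<theta>. ennreal (exponential_density B \<theta>) \<partial>lborel) = 1"
    using prob_space.emeasure_space_1[OF prob_space_exponential_density[OF B]]
    by (simp add: emeasure_density)
  have "(\<integral>\<^sup>+\<theta>. ennreal (exponential_density B \<theta>) \<partial>lborel) =
    (\<integral>\<^sup>+\<theta>. ennreal (exponential_density B (- \<theta>)) \<partial>lborel)"
    using nn_integral_real_affine[of "\<lambda>\<theta>. ennreal (exponential_density B \<theta>)" "-1" 0] by simp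
  then have one': "(\<integral>\<^sup>+\<theta>. ennreal (exponential_density B (- \<theta>)) \<partial>lborel) = 1" using one by simp
  have "(\<integral>\<^sup>+\<theta>. ennreal (exp (1 - B * \<bar>\<theta>\<bar>)) \<partial>lborel) \<le>
      (\<integral>\<^sup>+\<theta>. ennreal (exp 1 / B) * (ennreal (exponential_density B \<theta>) + ennreal
        (exponential_density B (- \<theta>))) \<partial>lborel)"
  proof (intro nn_integral_mono)
    fix \<theta> :: real
    have "exp (1 - B * \<bar>\<theta>\<bar>) \<le> exp 1 / B * (exponential_density B \<theta> + exponential_density B (- \<theta>))"
    proof -
      have "exp (1 - B * \<bar>\<theta>\<bar>) = exp 1 / B * exponential_density B \<bar>\<theta>\<bar>"
        using B by (simp add: exponential_density_def exp_diff exp_minus divide_inverse mult_ac)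
      also have "\<dots> \<le> exp 1 / B * (exponential_density B \<theta> + exponential_density B (- \<theta>))"
        using B exponential_density_nonneg[OF B, of \<theta>] exponential_density_nonneg[OF B, of "- \<theta>"]
        by (intro mult_left_mono) (auto simp: abs_if)
      finally show ?thesis .
    qed
    then show "ennreal (exp (1 - B * \<bar>\<theta>\<bar>)) \<le>
      ennreal (exp 1 / B) * (ennreal (exponential_density B \<theta>) + ennreal (exponential_density B
        (- \<theta>)))"
      using B by (simp add: ennreal_mult[symmetric] ennreal_plus[symmetric]
        exponential_density_nonneg del: ennreal_plus)
  qed
  also have "\<dots> = ennreal (exp 1 / B) * (1 + 1)"
    by (subst nn_integral_cmult) (auto simp: nn_integral_add one one')
  also have "\<dots> = ennreal (2 * exp 1 / B)"
    using B by (simp add: one_add_one ennreal_mult''[symmetric] mult.commute flip: ennreal_numeral)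
  finally show ?thesis .
qed

definition concentration_const :: "real \<Rightarrow> real" where
  "concentration_const \<beta> = exp (1/2) * (2 * exp 1 * (- cos (\<beta> * pi / 2)) powr (- 1 / \<beta>))"

text \<open>Gaussian smoothing. The indicator of \<open>\<bar>Y - x\<bar> \<le> l\<close> is at most \<open>exp (1/2)\<close> times a Gaussian
  function of \<open>(Y - x) / l\<close>, which is the characteristic function of a standard normal variable
  \<open>\<theta>\<close>. By Fubini, its expectation averages the characteristic function of \<open>Y\<close> at \<open>\<theta> / l\<close>. As
  \<open>\<beta> > 1\<close>, the inequality \<open>A \<bar>\<theta>\<bar> powr \<beta> \<ge> A powr (1/\<beta>) \<bar>\<theta>\<bar> - 1\<close> reduces this average to an
  exponential integral.\<close>
lemma (in prob_space) laplace_concentration: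
  fixes Y :: "'a \<Rightarrow> real"
  assumes Y[measurable]: "Y \<in> borel_measurable M"
    and L: "\<And>\<eta>. \<eta> \<ge> 0 \<Longrightarrow> has_bochner_integral M (\<lambda>\<omega>. exp (- \<eta> * Y \<omega>)) (exp (h * \<eta> powr \<beta>))"
    and h: "h > 0" and l: "l > 0" and b: "1 < \<beta>" "\<beta> < 2"
  shows "prob {\<omega>\<in>space M. \<bar>Y \<omega> - x\<bar> \<le> l} \<le> concentration_const \<beta> * (l * h powr (- 1 / \<beta>))"
proof -
  define c where "c = - cos (\<beta> * pi / 2)"
  have c: "c > 0"
  proof -
    have "cos (\<beta> * pi / 2 - pi) > 0" using b by (intro cos_gt_zero_pi) (auto simp: field_simps)
    then show ?thesis by (simp add: c_def cos_diff)
  qed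
  define A where "A = h * c * l powr (-\<beta>)"
  define B where "B = A powr (1 / \<beta>)"
  have A: "A > 0" "B > 0" using h c l by (auto simp: A_def B_def)
  let ?S = "std_normal_distribution"
  interpret S: prob_space ?S by (rule real_dist_normal_dist[THEN real_distribution.axioms(1)])
  interpret MS: pair_prob_space M ?S ..
  define f where "f \<omega> \<theta> = exp (\<i> * complex_of_real (\<theta> * ((Y \<omega> - x) / l)))" for \<omega> \<theta>
  have nf: "cmod (f \<omega> \<theta>) = 1" for \<omega> \<theta> by (simp add: f_def)
  have int: "integrable (M \<Otimes>\<^sub>M ?S) (\<lambda>(\<omega>, \<theta>). f \<omega> \<theta>)"
    by (rule MS.P.integrable_const_bound[of _ 1]) (auto simp: nf f_def)
  have chr: "(\<integral>\<theta>. f \<omega> \<theta> \<partial>?S) = complex_of_real (exp (- ((Y \<omega> - x) / l)\<^sup>2 / 2))" for \<omega>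
    using fun_cong[OF char_std_normal_distribution, of "(Y \<omega> - x) / l"]
    unfolding char_def f_def by (simp add: mult.commute)
  have inner: "cmod (\<integral>\<omega>. f \<omega> \<theta> \<partial>M) \<le> exp (- A * \<bar>\<theta>\<bar> powr \<beta>)" for \<theta>
  proof (cases "\<theta> = 0")
    case True
    then show ?thesis by (simp add: f_def prob_space)
  next
    case False
    have "f \<omega> \<theta> = exp (- \<i> * complex_of_real (\<theta> * x / l)) * exp (\<i> * complex_of_real (\<theta> / l * Y \<omega>))"
      for \<omega>
      unfolding f_def exp_add[symmetric]
      by (simp add: diff_divide_distrib right_diff_distrib algebra_simps)
    then have "cmod (\<integral>\<omega>. f \<omega> \<theta> \<partial>M) = cmod (\<integral>\<omega>. exp (\<i> * complex_of_real (\<theta> / l * Y \<omega>)) \<partial>M)"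
      by (simp add: norm_mult norm_exp_eq_Re)
    also have "\<dots> = exp (h * cos (\<beta> * pi / 2) * \<bar>\<theta> / l\<bar> powr \<beta>)"
      using False l by (intro char_bound Y L) auto
    also have "\<bar>\<theta> / l\<bar> powr \<beta> = \<bar>\<theta>\<bar> powr \<beta> * l powr (-\<beta>)"
    proof -
      have "\<bar>\<theta> / l\<bar> powr \<beta> = \<bar>\<theta>\<bar> powr \<beta> / l powr \<beta>" using l by (simp add: powr_divide)
      then show ?thesis by (simp add: powr_minus divide_inverse)
    qed
    also have "h * cos (\<beta> * pi / 2) * (\<bar>\<theta>\<bar> powr \<beta> * l powr (-\<beta>)) = - A * \<bar>\<theta>\<bar> powr \<beta>"
      by (simp add: A_def c_def)
    finally show ?thesis by simp
  qed
  have pow_ge: "- A * \<bar>\<theta>\<bar> powr \<beta> \<le> 1 - B * \<bar>\<theta>\<bar>" for \<theta>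
  proof -
    have eq: "A * \<bar>\<theta>\<bar> powr \<beta> = (B * \<bar>\<theta>\<bar>) powr \<beta>"
      using A b by (simp add: B_def powr_mult powr_powr)
    show ?thesis
    proof (cases "B * \<bar>\<theta>\<bar> \<le> 1")
      case True
      moreover have "(B * \<bar>\<theta>\<bar>) powr \<beta> \<ge> 0" by simp
      ultimately show ?thesis unfolding mult_minus_left eq by linarith
    next
      case False
      then have "(B * \<bar>\<theta>\<bar>) powr 1 \<le> (B * \<bar>\<theta>\<bar>) powr \<beta>" using b by (intro powr_mono) auto
      then show ?thesis unfolding mult_minus_left eq using False by simp
    qed
  qed
  have [measurable]: "(\<lambda>\<theta>. \<integral>\<omega>. f \<omega> \<theta> \<partial>M) \<in> borel_measurable borel"
  proof -
    have "(\<lambda>\<theta>. \<integral>\<omega>. f \<omega> \<theta> \<partial>M) \<in> borel_measurable ?S"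
      unfolding f_def by (intro borel_measurable_lebesgue_integral) measurable
    then show ?thesis by simp
  qed
  have "exp (- 1/2) * prob {\<omega>\<in>space M. \<bar>Y \<omega> - x\<bar> \<le> l} =
    (\<integral>\<omega>. exp (- 1/2) * indicator {\<omega>\<in>space M. \<bar>Y \<omega> - x\<bar> \<le> l} \<omega> \<partial>M)"
    by simp
  also have "\<dots> \<le> (\<integral>\<omega>. exp (- ((Y \<omega> - x) / l)\<^sup>2 / 2) \<partial>M)"
  proof (rule integral_mono)
    show "integrable M (\<lambda>\<omega>. exp (- ((Y \<omega> - x) / l)\<^sup>2 / 2))"
      by (rule integrable_const_bound[of _ 1]) auto
    show "integrable M (\<lambda>\<omega>. exp (- 1/2) * indicat_real {\<omega>\<in>space M. \<bar>Y \<omega> - x\<bar> \<le> l} \<omega>)"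
      by (intro integrable_mult_right integrable_real_indicator) (auto simp: emeasure_eq_measure)
    fix \<omega>
    show "exp (- 1/2) * indicator {\<omega>\<in>space M. \<bar>Y \<omega> - x\<bar> \<le> l} \<omega> \<le> exp (- ((Y \<omega> - x) / l)\<^sup>2 / 2)"
    proof (cases "\<bar>Y \<omega> - x\<bar> \<le> l")
      case True
      then have "((Y \<omega> - x) / l)\<^sup>2 \<le> 1" using l by (simp add: abs_square_le_1 abs_divide)
      then show ?thesis by (simp add: indicator_def)
    qed simp
  qed
  also have "\<dots> = cmod (\<integral>\<omega>. (\<integral>\<theta>. f \<omega> \<theta> \<partial>?S) \<partial>M)"
  proof -
    have "0 \<le> (\<integral>\<omega>. exp (- ((Y \<omega> - x) / l)\<^sup>2 / 2) \<partial>M)" by (rule integral_nonneg_AE) simp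
    then show ?thesis unfolding chr by simp
  qed
  also have "(\<integral>\<omega>. (\<integral>\<theta>. f \<omega> \<theta> \<partial>?S) \<partial>M) = (\<integral>\<theta>. (\<integral>\<omega>. f \<omega> \<theta> \<partial>M) \<partial>?S)"
    by (rule MS.Fubini_integral[OF int, symmetric])
  also have "cmod \<dots> \<le> (\<integral>\<theta>. cmod (\<integral>\<omega>. f \<omega> \<theta> \<partial>M) \<partial>?S)" by simp
  finally have main: "exp (- 1/2) * prob {\<omega>\<in>space M. \<bar>Y \<omega> - x\<bar> \<le> l} \<le>
    (\<integral>\<theta>. cmod (\<integral>\<omega>. f \<omega> \<theta> \<partial>M) \<partial>?S)" .
  have "ennreal (\<integral>\<theta>. cmod (\<integral>\<omega>. f \<omega> \<theta> \<partial>M) \<partial>?S) \<le> (\<integral>\<^sup>+\<theta>. ennreal (cmod (\<integral>\<omega>. f \<omega> \<theta> \<partial>M)) \<partial>?S)"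
    by (simp add: integral_eq_nn_integral le_ennreal_iff ennreal_enn2real_if)
  also have "\<dots> \<le> (\<integral>\<^sup>+\<theta>. ennreal (exp (1 - B * \<bar>\<theta>\<bar>)) \<partial>?S)"
    using inner pow_ge by (intro nn_integral_mono ennreal_leI) (meson exp_le_cancel_iff order_trans)
  also have "\<dots> = (\<integral>\<^sup>+\<theta>. ennreal (std_normal_density \<theta>) * ennreal (exp (1 - B * \<bar>\<theta>\<bar>)) \<partial>lborel)"
    by (subst nn_integral_density) auto
  also have "\<dots> \<le> (\<integral>\<^sup>+\<theta>. ennreal (exp (1 - B * \<bar>\<theta>\<bar>)) \<partial>lborel)"
  proof (intro nn_integral_mono)
    fix \<theta> :: real
    have "1 \<le> sqrt (2 * pi)" using pi_gt3 by (intro real_le_rsqrt) auto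
    then have "std_normal_density \<theta> \<le> 1"
      unfolding std_normal_density_def by (intro mult_le_one) auto
    then have "ennreal (std_normal_density \<theta>) * ennreal (exp (1 - B * \<bar>\<theta>\<bar>)) \<le>
      1 * ennreal (exp (1 - B * \<bar>\<theta>\<bar>))"
      by (intro mult_right_mono) (auto simp: ennreal_le_1)
    then show "ennreal (std_normal_density \<theta>) * ennreal (exp (1 - B * \<bar>\<theta>\<bar>)) \<le>
      ennreal (exp (1 - B * \<bar>\<theta>\<bar>))" by simp
  qed
  also have "\<dots> \<le> ennreal (2 * exp 1 / B)" by (rule nn_integral_two_sided_exponential[OF A(2)])
  finally have "(\<integral>\<theta>. cmod (\<integral>\<omega>. f \<omega> \<theta> \<partial>M) \<partial>?S) \<le> 2 * exp 1 / B" using A(2)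
    by (simp add: ennreal_le_iff)
  with main have "exp (- 1/2) * prob {\<omega>\<in>space M. \<bar>Y \<omega> - x\<bar> \<le> l} \<le> 2 * exp 1 / B" by linarith
  then have le: "prob {\<omega>\<in>space M. \<bar>Y \<omega> - x\<bar> \<le> l} \<le> exp (1/2) * (2 * exp 1 / B)"
  proof -
    assume "exp (- 1/2) * prob {\<omega>\<in>space M. \<bar>Y \<omega> - x\<bar> \<le> l} \<le> 2 * exp 1 / B"
    then have "exp (1/2) * (exp (- 1/2) * prob {\<omega>\<in>space M. \<bar>Y \<omega> - x\<bar> \<le> l}) \<le>
      exp (1/2) * (2 * exp 1 / B)"
      by (rule mult_left_mono) simp
    then show ?thesis unfolding mult.assoc[symmetric] exp_add[symmetric] by simp
  qed
  have "B = h powr (1/\<beta>) * c powr (1/\<beta>) * (1 / l)"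
  proof -
    have "B = (h * c) powr (1/\<beta>) * (l powr (-\<beta>)) powr (1/\<beta>)"
      using l c h unfolding B_def A_def by (simp only: powr_mult)
    also have "(l powr (-\<beta>)) powr (1/\<beta>) = 1 / l"
      using l b by (subst powr_powr) (simp add: powr_minus_divide)
    also have "(h * c) powr (1/\<beta>) = h powr (1/\<beta>) * c powr (1/\<beta>)"
      by (rule powr_mult)
    finally show ?thesis .
  qed
  then have "1 / B = c powr (-1/\<beta>) * (l * h powr (-1/\<beta>))"
  proof -
    assume B: "B = h powr (1/\<beta>) * c powr (1/\<beta>) * (1 / l)"
    have "c powr (-1/\<beta>) = 1 / c powr (1/\<beta>)" "h powr (-1/\<beta>) = 1 / h powr (1/\<beta>)"
      using powr_minus_divide[of c "1/\<beta>"] powr_minus_divide[of h "1/\<beta>"] by simp_all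
    then show ?thesis unfolding B by simp
  qed
  then have inv: "2 * exp 1 / B = 2 * exp 1 * (c powr (-1/\<beta>) * (l * h powr (-1/\<beta>)))"
    by (metis times_divide_eq_right mult.right_neutral)
  have "exp (1/2) * (2 * exp 1 / B) = concentration_const \<beta> * (l * h powr (- 1 / \<beta>))"
    unfolding concentration_const_def c_def[symmetric] inv by (simp only: mult.assoc)
  with le show ?thesis by simp
qed

section \<open>Cadlag paths and fine grids\<close>

lemma cadlag_left_lim:
  assumes "cadlag x" "t > 0"
  shows "(x \<longlongrightarrow> left_lim x t) (at_left t)"
  using assms by (auto simp: cadlag_def left_lim_def tendsto_Lim)

lemma jump_eq_0: "t \<le> 0 \<Longrightarrow> t \<ge> 0 \<Longrightarrow> jump x t = 0"
  by (simp add: jump_def left_lim_def)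

lemma cadlag_local:
  assumes "cadlag x" "s \<ge> 0" "e > 0"
  obtains d where "d > 0" "\<And>z. s \<le> z \<Longrightarrow> z < s + d \<Longrightarrow> \<bar>x z - x s\<bar> < e"
    "\<And>z. s > 0 \<Longrightarrow> s - d < z \<Longrightarrow> z < s \<Longrightarrow> \<bar>x z - left_lim x s\<bar> < e"
proof -
  have "(x \<longlongrightarrow> x s) (at_right s)" using assms by (simp add: cadlag_def)
  then have "eventually (\<lambda>z. dist (x z) (x s) < e) (at_right s)" using assms(3) by (rule tendstoD)
  then obtain b where b: "b > s" "\<And>z. s < z \<Longrightarrow> z < b \<Longrightarrow> \<bar>x z - x s\<bar> < e"
    unfolding eventually_at_right_field by (auto simp: dist_real_def)
  have "\<exists>c<s. s > 0 \<longrightarrow> (\<forall>z>c. z < s \<longrightarrow> \<bar>x z - left_lim x s\<bar> < e)"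
  proof (cases "s > 0")
    case True
    have "eventually (\<lambda>z. dist (x z) (left_lim x s) < e) (at_left s)"
      using cadlag_left_lim[OF assms(1) True] assms(3) by (rule tendstoD)
    then show ?thesis unfolding eventually_at_left_field by (auto simp: dist_real_def)
  qed (auto intro: exI[of _ "s - 1"])
  then obtain c where c: "c < s" "\<And>z. s > 0 \<Longrightarrow> c < z \<Longrightarrow> z < s \<Longrightarrow> \<bar>x z - left_lim x s\<bar> < e" by blast
  show ?thesis
  proof (rule that[of "min (b - s) (s - c)"])
    show "min (b - s) (s - c) > 0" using b c by simp
    fix z
    show "\<bar>x z - x s\<bar> < e" if "s \<le> z" "z < s + min (b - s) (s - c)"
      using b(2)[of z] that assms(3) by (cases "z = s") auto
    show "\<bar>x z - left_lim x s\<bar> < e" if "s > 0" "s - min (b - s) (s - c) < z" "z < s"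
      using c(2)[of z] that by auto
  qed
qed

lemma left_lim_close:
  assumes "cadlag x" "t > 0" "c < t" "\<And>z. c < z \<Longrightarrow> z < t \<Longrightarrow> \<bar>x z - l\<bar> < e"
  shows "\<bar>left_lim x t - l\<bar> \<le> e"
proof (rule tendsto_upperbound)
  show "((\<lambda>z. \<bar>x z - l\<bar>) \<longlongrightarrow> \<bar>left_lim x t - l\<bar>) (at_left t)"
    by (intro tendsto_intros cadlag_left_lim assms)
  show "eventually (\<lambda>z. \<bar>x z - l\<bar> \<le> e) (at_left t)"
    unfolding eventually_at_left_field using assms(3,4)
    by (intro exI[of _ c]) (auto intro: less_imp_le)
qed simp

lemma cadlag_bounded:
  assumes "cadlag x"
  obtains R where "R > 0" "\<And>t. 0 \<le> t \<Longrightarrow> t \<le> T \<Longrightarrow> \<bar>x t\<bar> \<le> R"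
proof -
  have "\<exists>R. \<forall>t\<in>{0..T}. \<bar>x t\<bar> \<le> R"
  proof (rule ccontr)
    assume "\<not> ?thesis"
    then have "\<forall>m::nat. \<exists>t\<in>{0..T}. \<bar>x t\<bar> > real m" by (meson not_le)
    then obtain f where f: "\<And>m::nat. f m \<in> {0..T}" "\<And>m::nat. \<bar>x (f m)\<bar> > real m" by metis
    from f(1) obtain s r where s: "s \<in> {0..T}" "strict_mono (r::nat\<Rightarrow>nat)" "(f \<circ> r) \<longlonglongrightarrow> s"
      by (metis compact_Icc seq_compactE compact_imp_seq_compact)
    obtain d where d: "d > 0" "\<And>z. s \<le> z \<Longrightarrow> z < s + d \<Longrightarrow> \<bar>x z - x s\<bar> < 1"
      "\<And>z. s > 0 \<Longrightarrow> s - d < z \<Longrightarrow> z < s \<Longrightarrow> \<bar>x z - left_lim x s\<bar> < 1"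
      using cadlag_local[OF assms, of s 1] s(1) by auto
    have "eventually (\<lambda>n. \<bar>f (r n) - s\<bar> < d) sequentially"
      using tendstoD[OF s(3) d(1)] by (simp add: dist_real_def)
    moreover obtain N where N: "\<bar>x s\<bar> + \<bar>left_lim x s\<bar> + 1 < real N" using reals_Archimedean2
      by blast
    ultimately obtain n where n: "n \<ge> N" "\<bar>f (r n) - s\<bar> < d"
      unfolding eventually_sequentially by (meson linear order_trans)
    have "real n \<le> real (r n)" using seq_suble[OF s(2)] by simp
    then have "\<bar>x (f (r n))\<bar> > \<bar>x s\<bar> + \<bar>left_lim x s\<bar> + 1" using f(2)[of "r n"] N n(1) by linarith
    moreover have "f (r n) \<ge> 0" using f(1) by auto
    ultimately show False
      using d(2)[of "f (r n)"] d(3)[of "f (r n)"] n(2) by (cases "f (r n) \<ge> s") auto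
  qed
  then obtain R where "\<forall>t\<in>{0..T}. \<bar>x t\<bar> \<le> R" by blast
  then show ?thesis by (intro that[of "max R 1"]) (auto simp: le_max_iff_disj)
qed

lemma cadlag_finite_jumps:
  assumes "cadlag x" "a > 0"
  shows "finite {t\<in>{0..T}. jump x t \<ge> a}"
proof (rule ccontr)
  assume "infinite {t\<in>{0..T}. jump x t \<ge> a}"
  then obtain s where s: "s \<in> {0..T}" "s islimpt {t\<in>{0..T}. jump x t \<ge> a}"
    using Heine_Borel_imp_Bolzano_Weierstrass[of "{0..T}" "{t\<in>{0..T}. jump x t \<ge> a}"] by blast
  obtain d where d: "d > 0" "\<And>z. s \<le> z \<Longrightarrow> z < s + d \<Longrightarrow> \<bar>x z - x s\<bar> < a / 3"
      "\<And>z. s > 0 \<Longrightarrow> s - d < z \<Longrightarrow> z < s \<Longrightarrow> \<bar>x z - left_lim x s\<bar> < a / 3"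
    using cadlag_local[OF assms(1), of s "a/3"] s(1) assms(2) by auto
  obtain t where t: "t \<in> {0..T}" "jump x t \<ge> a" "t \<noteq> s" "\<bar>t - s\<bar> < d"
    using s(2) d(1) unfolding islimpt_approachable by (auto simp: dist_real_def)
  have t0: "t > 0" using t jump_eq_0[of t x] assms(2) by (cases "t = 0") auto
  show False
  proof (cases "t > s")
    case True
    have "\<bar>left_lim x t - x s\<bar> \<le> a / 3"
      by (rule left_lim_close[OF assms(1) t0, of s]) (use True d t in auto)
    then show False using d(2)[of t] t True assms(2) unfolding jump_def
      by (auto simp: abs_if split: if_splits)
  next
    case False
    then have s0: "t < s" "s > 0" using t t0 by auto
    have "\<bar>left_lim x t - left_lim x s\<bar> \<le> a / 3"
      by (rule left_lim_close[OF assms(1) t0, of "s - d"]) (use s0 d t in auto)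
    then show False using d(3)[of t] t s0 assms(2) unfolding jump_def
      by (auto simp: abs_if split: if_splits)
  qed
qed

text \<open>Along a subsequence the intervals \<open>[p m, q m]\<close> shrink to a point \<open>s\<close>. Increments over
  intervals on one side of \<open>s\<close> tend to 0, so the intervals contain \<open>s\<close> with \<open>p m < s\<close>, and then
  their increments tend to the jump at \<open>s\<close>. That the jump lies in one of the given intervals
  attributes it to a grid cell in \<open>grid_increment_localises_jump\<close>.\<close>
lemma jump_of_shrinking_increments:
  assumes x: "cadlag x" and "0 \<le> u" "a > 0"
    and pq: "\<And>m. u \<le> p m" "\<And>m. p m < q m" "\<And>m. q m \<le> v" "\<And>m. a \<le> x (q m) - x (p m)"
    and lim: "(\<lambda>m::nat. q m - p m) \<longlonglongrightarrow> 0"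
  shows "\<exists>t\<in>{u<..v}. a \<le> jump x t \<and> (\<exists>m. p m < t \<and> t \<le> q m)"
proof -
  have "p m \<in> {u..v}" for m using pq(1,2,3)[of m] by auto
  then obtain s r where s: "s \<in> {u..v}" "strict_mono (r::nat\<Rightarrow>nat)" "(p \<circ> r) \<longlonglongrightarrow> s"
    by (metis compact_Icc seq_compactE compact_imp_seq_compact)
  have "(\<lambda>n. (q \<circ> r) n - (p \<circ> r) n + (p \<circ> r) n) \<longlonglongrightarrow> 0 + s"
    using LIMSEQ_subseq_LIMSEQ[OF lim s(2)] s(3) by (intro tendsto_add) (auto simp: o_def)
  then have qs: "(q \<circ> r) \<longlonglongrightarrow> s" by (simp add: o_def)
  have s0: "s \<ge> 0" using s assms(2) by auto
  \<comment> \<open>The bound \<open>a / 2\<close> on \<open>e\<close> excludes that both endpoints lie on one side of \<open>s\<close>.\<close>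
  have straddle: "\<exists>m. p m < s \<and> s \<le> q m \<and> s > 0 \<and> \<bar>x (p m) - left_lim x s\<bar> < e \<and> \<bar>x (q m) - x s\<bar> <
    e"
    if e: "0 < e" "e \<le> a / 2" for e
  proof -
    obtain d where d: "d > 0" "\<And>z. s \<le> z \<Longrightarrow> z < s + d \<Longrightarrow> \<bar>x z - x s\<bar> < e"
      "\<And>z. s > 0 \<Longrightarrow> s - d < z \<Longrightarrow> z < s \<Longrightarrow> \<bar>x z - left_lim x s\<bar> < e"
      using cadlag_local[OF x s0 e(1)] by blast
    have "eventually (\<lambda>n. \<bar>p (r n) - s\<bar> < d \<and> \<bar>q (r n) - s\<bar> < d) sequentially"
      using tendstoD[OF s(3) d(1)] tendstoD[OF qs d(1)] by (simp add: dist_real_def eventually_conj)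
    then obtain n where n: "\<bar>p (r n) - s\<bar> < d" "\<bar>q (r n) - s\<bar> < d"
      unfolding eventually_sequentially by blast
    let ?m = "r n"
    note m = pq(1,2,3,4)[of ?m] assms(2) n
    have 1: "p ?m < s"
    proof (rule ccontr)
      assume "\<not> ?thesis"
      then have "\<bar>x (p ?m) - x s\<bar> < e" "\<bar>x (q ?m) - x s\<bar> < e"
        using d(2)[of "p ?m"] d(2)[of "q ?m"] m by auto
      then show False using m e by linarith
    qed
    have s1: "s > 0" using 1 m by linarith
    have 2: "s \<le> q ?m"
    proof (rule ccontr)
      assume "\<not> ?thesis"
      then have "\<bar>x (p ?m) - left_lim x s\<bar> < e" "\<bar>x (q ?m) - left_lim x s\<bar> < e"
        using d(3)[of "p ?m"] d(3)[of "q ?m"] m s1 1 by auto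
      then show False using m e by linarith
    qed
    show ?thesis using 1 2 s1 d(2)[of "q ?m"] d(3)[of "p ?m"] m by (intro exI[of _ ?m]) auto
  qed
  obtain m where m: "p m < s" "s \<le> q m" using straddle[of "a/2"] assms(3) by auto
  have "a \<le> jump x s + e" if "e > 0" for e
  proof -
    have "0 < min (e/2) (a/2)" "min (e/2) (a/2) \<le> a / 2" using that assms(3) by auto
    from straddle[OF this]
    obtain k where "\<bar>x (p k) - left_lim x s\<bar> < min (e/2) (a/2)" "\<bar>x (q k) - x s\<bar> < min (e/2) (a/2)"
      by blast
    then show ?thesis using pq(4)[of k] unfolding jump_def by linarith
  qed
  then have "a \<le> jump x s" by (rule field_le_epsilon)
  then show ?thesis using m pq(1)[of m] s by (intro bexI[of _ s]) auto
qed

definition grid :: "real \<Rightarrow> real \<Rightarrow> nat \<Rightarrow> nat \<Rightarrow> real" where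
  "grid u w m j = u + real j * ((w - u) / real m)"

lemma grid_mono: "u < w \<Longrightarrow> m > 0 \<Longrightarrow> grid u w m i < grid u w m j \<longleftrightarrow> i < j"
proof -
  assume a: "u < w" "m > 0"
  then have "(w - u) / real m > 0" by simp
  then show ?thesis unfolding grid_def add_less_cancel_left by (subst mult_less_cancel_right) auto
qed

lemma grid_le: "u < w \<Longrightarrow> m > 0 \<Longrightarrow> grid u w m i \<le> grid u w m j \<longleftrightarrow> i \<le> j"
  using grid_mono[of u w m j i] by linarith

lemma grid_0 [simp]: "grid u w m 0 = u" by (simp add: grid_def)
lemma grid_end [simp]: "m > 0 \<Longrightarrow> grid u w m m = w" by (simp add: grid_def)
lemma grid_Suc: "grid u w m (Suc j) = grid u w m j + (w - u) / real m"
  unfolding grid_def of_nat_Suc distrib_right by simp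

lemma grid_cell:
  assumes "u < t" "t \<le> w" "m > 0"
  obtains j where "j < m" "grid u w m j < t" "t \<le> grid u w m (Suc j)"
proof -
  define j where "j = (LEAST j. t \<le> grid u w m (Suc j))"
  have ex: "t \<le> grid u w m (Suc (m - 1))" using assms by simp
  have 1: "t \<le> grid u w m (Suc j)" unfolding j_def
    by (rule LeastI[where P = "\<lambda>j. t \<le> grid u w m (Suc j)", OF ex])
  have 2: "j \<le> m - 1" unfolding j_def
    by (rule Least_le[where P = "\<lambda>j. t \<le> grid u w m (Suc j)", OF ex])
  have 3: "grid u w m j < t"
  proof (cases j)
    case (Suc i)
    then have "\<not> t \<le> grid u w m (Suc i)" unfolding j_def using not_less_Least by (metis j_def lessI)
    then show ?thesis using Suc by simp
  qed (use assms in simp)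
  show ?thesis using that[of j] 1 2 3 assms by auto
qed

lemma grid_cell_unique:
  assumes "u < w" "m > 0" "grid u w m i < t" "t \<le> grid u w m (Suc i)" "grid u w m j < t" "t \<le>
    grid u w m (Suc j)"
  shows "i = j"
proof -
  have "grid u w m i < grid u w m (Suc j)" "grid u w m j < grid u w m (Suc i)" using assms
    by linarith+
  then show ?thesis using grid_mono[OF assms(1,2)] by auto
qed

lemma grid_step_tendsto_0: "(\<lambda>m. (w - u) / real m) \<longlonglongrightarrow> 0"
  by (rule lim_const_over_n)

text \<open>The cells \<open>(grid j, grid (Suc j)]\<close> are closed on the right, so that a jump belongs to the
  cell whose increment shows it, even if it occurs at a grid point.\<close>
lemma grid_cell_at_jump:
  assumes x: "cadlag x" and u: "0 \<le> u" "u < t" "t \<le> w" and e: "e > 0"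
  shows "eventually (\<lambda>m. m > 0 \<and> (\<forall>j. grid u w m j < t \<and> t \<le> grid u w m (Suc j) \<longrightarrow>
           \<bar>x (grid u w m j) - left_lim x t\<bar> < e \<and> \<bar>x (grid u w m
             (Suc j)) - x t\<bar> < e)) sequentially"
proof -
  have t: "t > 0" using u by linarith
  obtain d where d: "d > 0" "\<And>z. t \<le> z \<Longrightarrow> z < t + d \<Longrightarrow> \<bar>x z - x t\<bar> < e"
      "\<And>z. t > 0 \<Longrightarrow> t - d < z \<Longrightarrow> z < t \<Longrightarrow> \<bar>x z - left_lim x t\<bar> < e"
    using cadlag_local[OF x less_imp_le[OF t] e] by blast
  have "eventually (\<lambda>m. dist ((w - u) / real m) 0 < d) sequentially"
    by (rule tendstoD[OF grid_step_tendsto_0 d(1)])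
  then show ?thesis using eventually_gt_at_top[of "0::nat"]
  proof eventually_elim
    case (elim m)
    have "(w - u) / real m < d" using elim by (simp only: dist_real_def diff_0_right abs_less_iff)
    then show ?case using d(2)[of "grid u w m (Suc _)"] d(3)[of "grid u w m _"] elim t
      by (auto simp: grid_Suc)
  qed
qed

lemma grid_separates:
  assumes "s < t"
  shows "eventually (\<lambda>m. \<forall>j. \<not> (grid u w m j < s \<and> t \<le> grid u w m (Suc j))) sequentially"
proof -
  have "eventually (\<lambda>m. dist ((w - u) / real m) 0 < t - s) sequentially"
    using tendstoD[OF grid_step_tendsto_0, of "t - s"] assms by simp
  then show ?thesis
  proof eventually_elim
    case (elim m)
    have "(w - u) / real m < t - s" using elim
      by (simp only: dist_real_def diff_0_right abs_less_iff)
    then show ?case by (auto simp: grid_Suc)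
  qed
qed

lemma grid_injective_on_finite:
  assumes F: "finite F"
  shows "eventually (\<lambda>m. \<forall>s\<in>F. \<forall>t\<in>F. \<forall>j. grid u w m j < s \<and> s \<le> grid u w m (Suc j) \<and>
           grid u w m j < t \<and> t \<le> grid u w m (Suc j) \<longrightarrow> s = t) sequentially"
proof -
  have "eventually (\<lambda>m. \<forall>j. grid u w m j < s \<and> s \<le> grid u w m (Suc j) \<and>
           grid u w m j < t \<and> t \<le> grid u w m (Suc j) \<longrightarrow> s = t) sequentially" for s t
  proof (cases s t rule: linorder_cases)
    case less
    from grid_separates[OF less] show ?thesis by eventually_elim blast
  next
    case greater
    from grid_separates[OF greater] show ?thesis by eventually_elim blast
  qed auto
  then show ?thesis using F by (auto intro!: eventually_ball_finite)
qed

text \<open>Cells without a jump of size \<open>a\<close> but with increment at least \<open>a\<close>, on grids of mesh tending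
  to 0, would contradict \<open>jump_of_shrinking_increments\<close>.\<close>
lemma grid_increment_localises_jump:
  assumes x: "cadlag x" and u: "0 \<le> u" "u < w" and a: "a > 0"
  shows "eventually (\<lambda>m. \<forall>j<m. a \<le> x (grid u w m (Suc j)) - x (grid u w m j) \<longrightarrow>
           (\<exists>t. grid u w m j < t \<and> t \<le> grid u w m (Suc j) \<and> a \<le> jump x t)) sequentially"
proof (rule ccontr)
  assume "\<not> ?thesis"
  then have "\<forall>n. \<exists>m\<ge>Suc n. \<exists>j<m. a \<le> x (grid u w m (Suc j)) - x (grid u w m j) \<and>
           \<not> (\<exists>t. grid u w m j < t \<and> t \<le> grid u w m (Suc j) \<and> a \<le> jump x t)"
    unfolding eventually_sequentially by blast
  then obtain m j where m: "\<And>n. m n \<ge> Suc n" "\<And>n. j n < m n"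
    "\<And>n. a \<le> x (grid u w (m n) (Suc (j n))) - x (grid u w (m n) (j n))"
    "\<And>n. \<not> (\<exists>t. grid u w (m n) (j n) < t \<and> t \<le> grid u w (m n) (Suc (j n)) \<and> a \<le> jump x t)"
    by metis
  define p where "p n = grid u w (m n) (j n)" for n
  define q where "q n = grid u w (m n) (Suc (j n))" for n
  have mpos: "m n > 0" for n using m(1)[of n] by linarith
  have up: "u \<le> p n" for n using grid_le[OF u(2) mpos, of n 0 "j n"] by (simp add: p_def)
  have pq: "p n < q n" for n using grid_mono[OF u(2) mpos] by (simp add: p_def q_def)
  have qw: "q n \<le> w" for n using grid_le[OF u(2) mpos, of n "Suc (j n)" "m n"] m(2)[of n] mpos[of n]
    by (simp add: q_def)
  have mtop: "filterlim m at_top sequentially"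
    unfolding filterlim_at_top eventually_sequentially using m(1)
    by (meson Suc_le_D le_Suc_eq order_trans)
  have "(\<lambda>n. (w - u) / real (m n)) \<longlonglongrightarrow> 0"
    using filterlim_compose[OF grid_step_tendsto_0 mtop] .
  then have "(\<lambda>n. q n - p n) \<longlonglongrightarrow> 0" by (simp add: p_def q_def grid_Suc)
  then obtain t n where "t \<in> {u<..w}" "a \<le> jump x t" "p n < t \<and> t \<le> q n"
    using jump_of_shrinking_increments[where p = p
      and q = q, OF x u(1) a up pq qw] m(3)[folded p_def q_def] by blast
  then show False using m(4)[of n] by (auto simp: p_def q_def)
qed

section \<open>Hoelder constants of marks\<close>

text \<open>Increments over the whole line are tested, and not only those over the duration of the
  mark: this gives one fixed event for marks of all durations.\<close>
definition holder_violating :: "real \<Rightarrow> real \<Rightarrow> (real \<Rightarrow> real) set" where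
  "holder_violating \<gamma> v = {f\<in>space path_space. \<exists>r s. r < s \<and> v * (s - r) powr \<gamma> < \<bar>f s - f r\<bar>}"

lemma space_path_space: "space path_space = {f. continuous_on UNIV f}"
  by (simp add: path_space_def space_restrict_space space_PiM)

lemma path_eval_measurable: "(\<lambda>f. f s) \<in> borel_measurable path_space"
  unfolding path_space_def by (intro measurable_restrict_space1 measurable_component_singleton) simp

text \<open>By continuity a strict violation persists at nearby rational times.\<close>
lemma holder_violating_rational:
  "holder_violating \<gamma> v = (\<Union>r\<in>\<rat>. \<Union>s\<in>\<rat>\<inter>{r<..}. {f\<in>space path_space. v * (s - r) powr \<gamma> <
    \<bar>f s - f r\<bar>})"
proof
  show "holder_violating \<gamma> v \<subseteq> (\<Union>r\<in>\<rat>. \<Union>s\<in>\<rat>\<inter>{r<..}. {f\<in>space path_space. v * (s - r) powr \<gamma> <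
    \<bar>f s - f r\<bar>})"
  proof
    fix f assume "f \<in> holder_violating \<gamma> v"
    then obtain r s where f: "f \<in> space path_space"
      and rs: "r < s" "v * (s - r) powr \<gamma> < \<bar>f s - f r\<bar>"
      unfolding holder_violating_def by blast
    have cont: "continuous_on UNIV f" using f by (simp add: space_path_space)
    define g where "g h = \<bar>f (s - h) - f (r + h)\<bar> - v * (s - h - (r + h)) powr \<gamma>" for h
    define G where "G p = \<bar>f (snd p) - f (fst p)\<bar> - v * (snd p - fst p) powr \<gamma>" for p
    have "isCont G (r, s)"
    proof -
      have *: "isCont f z" for z using cont by (simp add: continuous_on_eq_continuous_at)
      have "isCont (\<lambda>p. f (snd p)) (r, s)" "isCont (\<lambda>p. f (fst p)) (r, s)"
        by (rule continuous_at_compose[unfolded o_def, OF _ *], intro continuous_intros)+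
      then show ?thesis unfolding G_def using rs(1) by (intro continuous_intros) auto
    qed
    then have "(G \<longlongrightarrow> G (r, s)) (nhds (r, s))" by (simp add: continuous_at tendsto_nhds_iff)
    moreover have "G (r, s) > 0" using rs by (simp add: G_def)
    ultimately have "eventually (\<lambda>p. G p > 0) (nhds (r, s))" by (intro order_tendstoD)
    then obtain d where d: "d > 0" "\<And>p. dist p (r, s) < d \<Longrightarrow> G p > 0"
      unfolding eventually_nhds_metric by blast
    define e where "e = min (d / 2) ((s - r) / 2)"
    have e: "e > 0" "e \<le> d / 2" "e + e \<le> s - r"
    proof -
      show "e > 0" unfolding e_def min_less_iff_conj using d(1) rs(1) by simp
      show "e \<le> d / 2" unfolding e_def by (rule min.cobounded1)
      have "e \<le> (s - r) / 2" unfolding e_def by (rule min.cobounded2)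
      then show "e + e \<le> s - r" by simp
    qed
    obtain r' where r': "r' \<in> \<rat>" "r < r'" "r' < r + e" using Rats_dense_in_real[of r "r + e"] e
      by auto
    obtain s' where s': "s' \<in> \<rat>" "s - e < s'" "s' < s" using Rats_dense_in_real[of "s - e" s] e
      by auto
    have "dist (r', s') (r, s) \<le> \<bar>r' - r\<bar> + \<bar>s' - s\<bar>"
      by (simp add: dist_prod_def dist_real_def sqrt_sum_squares_le_sum_abs)
    also have "\<dots> < d" using r' s' e by linarith
    finally have "G (r', s') > 0" by (rule d(2))
    moreover have "r' < s'" using r' s' e by linarith
    ultimately show "f \<in> (\<Union>r\<in>\<rat>. \<Union>s\<in>\<rat>\<inter>{r<..}. {f\<in>space path_space. v * (s - r) powr \<gamma> <
      \<bar>f s - f r\<bar>})"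
      using f r'(1) s'(1) by (intro UN_I[OF r'(1)] UN_I[of s']) (auto simp: G_def)
  qed
qed (auto simp: holder_violating_def)

lemma holder_violating_sets: "holder_violating \<gamma> v \<in> sets path_space"
proof -
  note [measurable] = path_eval_measurable
  have "{f\<in>space path_space. v * (s - r) powr \<gamma> < \<bar>f s - f r\<bar>} \<in> sets path_space" for r s
    by measurable
  then show ?thesis unfolding holder_violating_rational
    by (intro sets.countable_UN' countable_rat countable_Int1 image_subsetI) auto
qed

lemma holder_const_le:
  assumes "f \<in> space path_space" "f \<notin> holder_violating \<gamma> v"
  shows "holder_const \<gamma> x f \<le> ennreal v"
  unfolding holder_const_def
proof (intro SUP_least, clarify)
  fix r s :: real assume "0 \<le> r" "r < s" "s \<le> x"
  then have "\<bar>f s - f r\<bar> \<le> v * (s - r) powr \<gamma>"     using assms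
    unfolding holder_violating_def mem_Collect_eq not_less[symmetric] by blast
  then show "ennreal (\<bar>f s - f r\<bar> / \<bar>s - r\<bar> powr \<gamma>) \<le> ennreal v"
    using \<open>r < s\<close> by (intro ennreal_leI) (simp add: pos_divide_le_eq)
qed

text \<open>Moving both times to the nearest points of \<open>[0, 1]\<close> keeps the values of \<open>z\<close> and does not
  increase the distance.\<close>
lemma holder_bound_on_line:
  assumes \<gamma>: "\<gamma> > 0" and D: "holder_const \<gamma> 1 z \<le> ennreal D" "D \<ge> 0"
    and z: "\<And>s. s \<notin> {0<..<1} \<Longrightarrow> z s = 0" and rs: "r < s"
  shows "\<bar>z s - z r\<bar> \<le> D * (s - r) powr \<gamma>"
proof -
  have inside: "\<bar>z s - z r\<bar> \<le> D * (s - r) powr \<gamma>" if "0 \<le> r" "r < s" "s \<le> 1" for r s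
  proof -
    have "ennreal (\<bar>z s - z r\<bar> / \<bar>s - r\<bar> powr \<gamma>) \<le> holder_const \<gamma> 1 z"
      unfolding holder_const_def using that by (intro SUP_upper2[of "(r, s)"]) auto
    also have "\<dots> \<le> ennreal D" by fact
    finally show ?thesis using that D(2) by (simp add: ennreal_le_iff pos_divide_le_eq)
  qed
  define r' where "r' = max 0 (min 1 r)"
  define s' where "s' = max 0 (min 1 s)"
  have eq: "z r' = z r" "z s' = z s" using z[of r] z[of s] z[of 0] z[of 1]
    by (auto simp: r'_def s'_def min_def max_def)
  show ?thesis
  proof (cases "r' < s'")
    case True
    then have "\<bar>z s' - z r'\<bar> \<le> D * (s' - r') powr \<gamma>" by (intro inside) (auto simp: r'_def s'_def)
    also have "\<dots> \<le> D * (s - r) powr \<gamma>"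
      using True D(2) \<gamma> by (intro mult_left_mono powr_mono2)
        (auto simp: r'_def s'_def min_def max_def split: if_splits)
    finally show ?thesis by (simp add: eq)
  next
    case False
    then have "r' = s'" using rs by (auto simp: r'_def s'_def)
    then have "z s = z r" using eq by simp
    then show ?thesis using D(2) by simp
  qed
qed

text \<open>This makes \<open>kappa\<close> an image measure in the proper sense.\<close>
lemma scaled_path_measurable:
  assumes exc: "random_excursion N Z" and x: "x > 0"
  shows "(\<lambda>\<omega> s. x powr q * Z \<omega> (s / x)) \<in> N \<rightarrow>\<^sub>M path_space"
proof -
  have Zm: "Z \<in> N \<rightarrow>\<^sub>M path_space" using exc by (simp add: random_excursion_def)
  have ev: "(\<lambda>\<omega>. Z \<omega> s) \<in> borel_measurable N" for s
    using measurable_compose[OF Zm path_eval_measurable] .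
  have cont: "continuous_on UNIV (Z \<omega>)" if "\<omega> \<in> space N" for \<omega>
    using measurable_space[OF Zm that] by (simp add: space_path_space)
  show ?thesis unfolding path_space_def
  proof (rule measurable_restrict_space2)
    show "(\<lambda>\<omega> s. x powr q * Z \<omega> (s / x)) \<in> space N \<rightarrow> {f. continuous_on UNIV f}"
    proof (intro Pi_I CollectI)
      fix \<omega> assume "\<omega> \<in> space N"
      then show "continuous_on UNIV (\<lambda>s. x powr q * Z \<omega> (s / x))"
        using x by (intro continuous_intros continuous_on_compose2[OF cont, of \<omega> UNIV
          "\<lambda>s. s / x"]) auto
    qed
    show "(\<lambda>\<omega> s. x powr q * Z \<omega> (s / x)) \<in> N \<rightarrow>\<^sub>M Pi\<^sub>M UNIV (\<lambda>s. borel)"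
    proof (rule measurable_PiM_single')
      show "(\<lambda>\<omega>. x powr q * Z \<omega> (s / x)) \<in> borel_measurable N" for s
        by (intro borel_measurable_times borel_measurable_const ev)
    qed (auto simp: PiE_def)
  qed
qed

text \<open>Rescaling multiplies Hoelder constants by \<open>x powr (q - \<gamma>)\<close>, and Markov's inequality
  applies to the \<open>p\<close>-th power of the constant of \<open>Z\<close>.\<close>
lemma kappa_holder_violating:
  assumes exc: "random_excursion N Z" and \<gamma>: "0 < \<gamma>" "\<gamma> < q"
    and fin: "AE \<omega> in N. holder_const \<gamma> 1 (Z \<omega>) < \<infinity>"
    and mom: "moments_of_all_orders N (\<lambda>\<omega>. enn2real (holder_const \<gamma> 1 (Z \<omega>)))"
    and x: "0 < x" "x \<le> b" and v: "v > 0" and p: "p > 0"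
  shows "emeasure (kappa N Z q x) (holder_violating \<gamma> v) \<le>
     ennreal ((\<integral>\<omega>. enn2real (holder_const \<gamma> 1 (Z \<omega>)) powr p \<partial>N) * (b powr (q - \<gamma>) / v) powr p)"
proof -
  interpret prob_space N using exc unfolding random_excursion_def by blast
  define D where "D \<omega> = enn2real (holder_const \<gamma> 1 (Z \<omega>))" for \<omega>
  have D: "D \<omega> \<ge> 0" for \<omega> by (simp add: D_def)
  have Dint: "integrable N (\<lambda>\<omega>. D \<omega> powr p)" using mom p
    by (simp add: moments_of_all_orders_def D_def)
  let ?B = "holder_violating \<gamma> v"
  let ?S = "(\<lambda>\<omega> s. x powr q * Z \<omega> (s / x)) -` ?B \<inter> space N"
  note sm = scaled_path_measurable[OF exc x(1), of q]
  have S: "?S \<in> sets N" by (rule measurable_sets[OF sm holder_violating_sets])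
  define c where "c = (b powr (q - \<gamma>) / v) powr p"
  have z0: "Z \<omega> s = 0" if "\<omega> \<in> space N" "s \<notin> {0<..<1}" for \<omega> s
    using exc that unfolding random_excursion_def
    by (cases "s = 0 \<or> s = 1") (auto simp: less_le)
  have "AE \<omega> in N. indicator ?S \<omega> \<le> ennreal (c * D \<omega> powr p)"
    using fin AE_space
  proof eventually_elim
    case (elim \<omega>)
    show ?case
    proof (cases "\<omega> \<in> ?S")
      case True
      then obtain r s where rs: "r < s" "v * (s - r) powr \<gamma> < \<bar>x powr q * Z \<omega> (s / x) - x powr q
        * Z \<omega> (r / x)\<bar>"
        by (auto simp: holder_violating_def)
      have "\<bar>Z \<omega> (s / x) - Z \<omega> (r / x)\<bar> \<le> D \<omega> * (s / x - r / x) powr \<gamma>"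
        using rs x elim z0[OF elim(2)] \<gamma>
        by (intro holder_bound_on_line D) (auto simp: D_def divide_strict_right_mono)
      also have "(s / x - r / x) powr \<gamma> = (s - r) powr \<gamma> / x powr \<gamma>"
        unfolding diff_divide_distrib[symmetric] by (rule powr_divide)
      finally have "x powr q * \<bar>Z \<omega> (s / x) - Z \<omega> (r / x)\<bar> \<le>
        x powr q * (D \<omega> * ((s - r) powr \<gamma> / x powr \<gamma>))"
        by (rule mult_left_mono) simp
      also have "x powr q * (D \<omega> * ((s - r) powr \<gamma> / x powr \<gamma>)) = x powr (q - \<gamma>) * D \<omega>
        * (s - r) powr \<gamma>"
        by (simp add: powr_diff)
      also have "x powr q * \<bar>Z \<omega> (s / x) - Z \<omega> (r / x)\<bar> = \<bar>x powr q * Z \<omega> (s / x) - x powr q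
        * Z \<omega> (r / x)\<bar>"
        by (simp add: abs_mult right_diff_distrib[symmetric])
      finally have "v * (s - r) powr \<gamma> < x powr (q - \<gamma>) * D \<omega> * (s - r) powr \<gamma>" using rs(2)
        by linarith
      then have "v < x powr (q - \<gamma>) * D \<omega>" using rs(1) by simp
      also have "\<dots> \<le> b powr (q - \<gamma>) * D \<omega>" using x \<gamma> D by (intro mult_right_mono powr_mono2) auto
      finally have "1 \<le> b powr (q - \<gamma>) / v * D \<omega>" using v by (simp add: pos_le_divide_eq)
      then have "1 powr p \<le> (b powr (q - \<gamma>) / v * D \<omega>) powr p" using p by (intro powr_mono2) auto
      also have "\<dots> = c * D \<omega> powr p" unfolding c_def by (rule powr_mult)
      finally have "1 \<le> c * D \<omega> powr p" by simp
      then show ?thesis using True by simp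
    qed simp
  qed
  then have "(\<integral>\<^sup>+\<omega>. indicator ?S \<omega> \<partial>N) \<le> (\<integral>\<^sup>+\<omega>. ennreal (c * D \<omega> powr p) \<partial>N)"
    by (rule nn_integral_mono_AE)
  also have "\<dots> = ennreal (\<integral>\<omega>. c * D \<omega> powr p \<partial>N)"
    using Dint by (intro nn_integral_eq_integral) (auto simp: c_def)
  also have "(\<integral>\<omega>. c * D \<omega> powr p \<partial>N) = (\<integral>\<omega>. D \<omega> powr p \<partial>N) * c" by simp
  finally have "emeasure N ?S \<le> ennreal ((\<integral>\<omega>. D \<omega> powr p \<partial>N) * c)" using S by simp
  then show ?thesis
    unfolding kappa_def D_def c_def by (subst emeasure_distr[OF sm holder_violating_sets])
qed

section \<open>Colouring intervals and padding classes\<close>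

text \<open>The intervals are coloured in the order of their left endpoints. The earlier intervals
  that meet the current one all contain its left endpoint, so fewer than \<open>K\<close> colours are
  forbidden.\<close>
lemma interval_colouring:
  fixes lo hi :: "'i \<Rightarrow> real"
  assumes "finite S" and "\<And>i. i \<in> S \<Longrightarrow> lo i \<le> hi i"
    and "\<And>a. card {i\<in>S. lo i \<le> a \<and> a \<le> hi i} \<le> K"
  shows "\<exists>c. (\<forall>i\<in>S. c i < K) \<and> (\<forall>i\<in>S. \<forall>j\<in>S. i \<noteq> j \<and> c i = c j \<longrightarrow> {lo i..hi i} \<inter> {lo j..hi j} = {})"
  using assms
proof (induction S rule: finite_ranking_induct[where f = lo])
  case empty
  then show ?case by simp
next
  case (insert x S)
  show ?case
  proof (cases "x \<in> S")
    case True
    then show ?thesis using insert by (simp add: insert_absorb)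
  next
    case False
    have "card {i\<in>S. lo i \<le> a \<and> a \<le> hi i} \<le> K" for a
    proof -
      have "card {i\<in>S. lo i \<le> a \<and> a \<le> hi i} \<le> card {i\<in>insert x S. lo i \<le> a \<and> a \<le> hi i}"
        using insert.hyps by (intro card_mono) auto
      then show ?thesis using insert.prems(2)[of a] by linarith
    qed
    then obtain c where c: "\<And>i. i \<in> S \<Longrightarrow> c i < K"
      "\<And>i j. i \<in> S \<Longrightarrow> j \<in> S \<Longrightarrow> i \<noteq> j \<Longrightarrow> c i = c j \<Longrightarrow> {lo i..hi i} \<inter> {lo j..hi j} = {}"
      using insert.IH insert.prems(1) by fastforce
    define N where "N = {j\<in>S. {lo x..hi x} \<inter> {lo j..hi j} \<noteq> {}}"
    have N: "finite N" using insert.hyps by (simp add: N_def)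
    have "insert x N \<subseteq> {i\<in>insert x S. lo i \<le> lo x \<and> lo x \<le> hi i}"
      using insert.hyps insert.prems(1) by (auto simp: N_def)
    then have "card (insert x N) \<le> card {i\<in>insert x S. lo i \<le> lo x \<and> lo x \<le> hi i}"
      using insert.hyps by (intro card_mono) auto
    also have "\<dots> \<le> K" by (rule insert.prems(2))
    finally have le: "card (insert x N) \<le> K" .
    have "x \<notin> N" using False unfolding N_def by blast
    then have "card N < K" using le N by simp
    then have "card (c ` N) < card {..<K}" using card_image_le[OF N, of c] by simp
    then have "\<not> {..<K} \<subseteq> c ` N" using card_mono[of "c ` N" "{..<K}"] N by auto
    then obtain k where k: "k < K" "k \<notin> c ` N" by blast
    have "(c(x := k)) i < K" if "i \<in> insert x S" for i using that c(1) k(1) by auto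
    moreover have "{lo i..hi i} \<inter> {lo j..hi j} = {}"
      if "i \<in> insert x S" "j \<in> insert x S" "i \<noteq> j" "(c(x := k)) i = (c(x := k)) j" for i j
    proof -
      have k': "{lo x..hi x} \<inter> {lo j..hi j} = {}" if "j \<in> S" "c j = k" for j
        using that k(2) by (auto simp: N_def)
      consider "i = x" "j \<in> S" | "j = x" "i \<in> S" | "i \<in> S" "j \<in> S" "i \<noteq> x" "j \<noteq> x"
        using \<open>i \<in> _\<close> \<open>j \<in> _\<close> \<open>i \<noteq> j\<close> by auto
      then show ?thesis
      proof cases
        case 1
        then show ?thesis using that k'[of j] by auto
      next
        case 2
        then show ?thesis using that k'[of i] by auto
      next
        case 3
        then show ?thesis using that c(2)[of i j] by auto
      qed
    qed
    ultimately show ?thesis by (intro exI[of _ "c(x := k)"]) blast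
  qed
qed

text \<open>One element is reserved for each pair \<open>(k, j)\<close>, in the order of an enumeration of these
  pairs. By \<open>ext\<close> it can be taken new and disjoint from everything reserved before and from the
  finite class \<open>k\<close>, with \<open>H\<close> below \<open>(1/2) ^ k\<close>. A reserved element leaves its original class, so
  that the new class \<open>k\<close> is what remains of the old one together with the elements reserved for
  \<open>(k, 0), (k, 1), \<dots>\<close>.\<close>
lemma pad_classes:
  fixes S :: "'i set" and I :: "'i \<Rightarrow> 'j set" and H :: "'i \<Rightarrow> ennreal" and cls :: "'i \<Rightarrow> nat"
  assumes fin: "\<And>k. finite {i\<in>S. cls i = k}"
    and compat: "\<And>i j. i \<in> S \<Longrightarrow> j \<in> S \<Longrightarrow> i \<noteq> j \<Longrightarrow> cls i = cls j \<Longrightarrow> I i \<inter> I j = {}"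
    and ext: "\<And>F e. finite F \<Longrightarrow> F \<subseteq> S \<Longrightarrow> e > 0 \<Longrightarrow> \<exists>t\<in>S - F. H t < ennreal e \<and> (\<forall>i\<in>F. I t \<inter> I i = {})"
    and sum: "(\<Sum>k. SUP i\<in>{i\<in>S. cls i = k}. H i) < \<infinity>"
  shows "\<exists>J :: nat \<Rightarrow> nat \<Rightarrow> 'i. bij_betw (\<lambda>(k, j). J k j) UNIV S \<and>
     (\<forall>k. disjoint_family (\<lambda>j. I (J k j))) \<and> (\<Sum>k. SUP j. H (J k j)) < \<infinity>"
proof -
  define C where "C k = {i\<in>S. cls i = k}" for k
  define c where "c e = fst (prod_decode e)" for e
  define good where "good e F t \<longleftrightarrow> t \<in> S \<and> t \<notin> F \<and> H t < ennreal ((1/2) ^ c e) \<and>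
    (\<forall>i\<in>F \<union> C (c e). I t \<inter> I i = {})" for e F t
  \<comment> \<open>\<open>f n\<close> is the set of elements reserved before step \<open>n\<close>, and \<open>t\<close> is the element reserved at
    step \<open>n\<close>.\<close>
  have "\<exists>f. \<forall>n. (finite (f n) \<and> f n \<subseteq> S) \<and> (\<exists>t. f (Suc n) = insert t (f n) \<and> good n (f n) t)"
  proof (rule dependent_nat_choice)
    show "\<exists>F. finite F \<and> F \<subseteq> S" by blast
    fix F n assume F: "finite F \<and> F \<subseteq> S"
    have "\<exists>t\<in>S - (F \<union> C (c n)). H t < ennreal ((1/2) ^ c n) \<and> (\<forall>i\<in>F \<union> C (c n). I t \<inter> I i = {})"
      using F fin by (intro ext) (auto simp: C_def)
    then obtain t where "good n F t" by (auto simp: good_def)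
    then show "\<exists>F'. (finite F' \<and> F' \<subseteq> S) \<and> (\<exists>t. F' = insert t F \<and> good n F t)"
      using F by (intro exI[of _ "insert t F"]) (auto simp: good_def)
  qed
  then obtain f r where f: "\<And>n. f (Suc n) = insert (r n) (f n)" "\<And>n. good n (f n) (r n)" by metis
  have r_in: "r m \<in> f n" if "m < n" for m n
    using that by (induction n) (auto simp: f(1) less_Suc_eq)
  have r: "r n \<in> S" "H (r n) < ennreal ((1/2) ^ c n)" "i \<in> C (c n) \<Longrightarrow> I (r n) \<inter> I i = {}" for n i
    using f(2)[of n] by (auto simp: good_def)
  have r_less: "r m \<noteq> r n" "I (r n) \<inter> I (r m) = {}" if "m < n" for m n
    using f(2)[of n] r_in[OF that] by (auto simp: good_def)
  have r_inj: "r m = r n \<Longrightarrow> m = n" for m n using r_less(1)[of m n] r_less(1)[of n m]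
    by (cases m n rule: linorder_cases) auto
  have r_disj: "I (r m) \<inter> I (r n) = {}" if "m \<noteq> n" for m n
    using that r_less(2)[of m n] r_less(2)[of n m] by (cases m n rule: linorder_cases) auto
  define D where "D k = (C k - range r) \<union> range (\<lambda>j. r (prod_encode (k, j)))" for k
  have ck: "c (prod_encode (k, j)) = k" for k j by (simp add: c_def)
  have D: "countable (D k)" "infinite (D k)" for k
  proof -
    have "finite (C k)" using fin by (simp add: C_def)
    then have "countable (C k - range r)" by (intro countable_finite finite_Diff)
    then show "countable (D k)" unfolding D_def by (intro countable_Un countable_image) auto
    have "inj (\<lambda>j. r (prod_encode (k, j)))" by (rule injI) (auto dest!: r_inj)
    then have "infinite (range (\<lambda>j. r (prod_encode (k, j))))" by (rule range_inj_infinite)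
    then show "infinite (D k)" unfolding D_def by simp
  qed
  define J where "J k = from_nat_into (D k)" for k
  have J: "bij_betw (J k) UNIV (D k)" for k unfolding J_def by (rule bij_betw_from_nat_into[OF D])
  have D_unique: "k = k'" if D: "x \<in> D k" "x \<in> D k'" for x k k'
  proof (cases "x \<in> range r")
    case True
    obtain j where "x = r (prod_encode (k, j))" using D(1) True unfolding D_def by blast
    moreover obtain j' where "x = r (prod_encode (k', j'))" using D(2) True unfolding D_def by blast
    ultimately have "r (prod_encode (k, j)) = r (prod_encode (k', j'))" by simp
    then have "prod_encode (k, j) = prod_encode (k', j')" by (rule r_inj)
    then show ?thesis by simp
  next
    case False
    then show ?thesis using that by (auto simp: D_def C_def)
  qed
  have D_S: "(\<Union>k. D k) = S"
  proof
    show "(\<Union>k. D k) \<subseteq> S" using r(1) by (auto simp: D_def C_def)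
    show "S \<subseteq> (\<Union>k. D k)"
    proof
      fix x assume x: "x \<in> S"
      show "x \<in> (\<Union>k. D k)"
      proof (cases "x \<in> range r")
        case True
        then obtain n where "x = r n" by blast
        then have "x = r (prod_encode (fst (prod_decode n), snd (prod_decode n)))" by simp
        then show ?thesis unfolding D_def by blast
      next
        case False
        then show ?thesis using x by (auto simp: D_def C_def)
      qed
    qed
  qed
  have D_disj: "I x \<inter> I y = {}" if xy: "x \<in> D k" "y \<in> D k" "x \<noteq> y" for x y k
  proof -
    have CR: "I x \<inter> I (r (prod_encode (k, j))) = {}" if "x \<in> C k" for x j
      using r(3)[of x "prod_encode (k, j)"] that ck by auto
    consider "x \<in> C k" "y \<in> C k" | j where "x \<in> C k" "y = r (prod_encode (k, j))"
      | j where "x = r (prod_encode (k, j))" "y \<in> C k" | i j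
        where "x = r (prod_encode (k, i))" "y = r (prod_encode (k, j))"
      using xy(1,2) unfolding D_def by blast
    then show ?thesis
    proof cases
      case 1
      then show ?thesis using compat xy(3) by (auto simp: C_def)
    next
      case 2
      then show ?thesis using CR by simp
    next
      case 3
      then show ?thesis using CR[of y] by auto
    next
      case 4
      then have "prod_encode (k, i) \<noteq> prod_encode (k, j)" using xy(3) by metis
      then show ?thesis using r_disj 4 by simp
    qed
  qed
  have bij: "bij_betw (\<lambda>(k, j). J k j) UNIV S"
    unfolding bij_betw_def
  proof
    show "inj (\<lambda>(k, j). J k j)"
    proof (rule injI, clarify)
      fix k j k' j' assume eq: "J k j = J k' j'"
      have "J k j \<in> D k" "J k' j' \<in> D k'" using J by (auto simp: bij_betw_def)
      then have "k = k'" using eq D_unique by metis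
      then show "k = k' \<and> j = j'" using eq J[of k] by (auto simp: bij_betw_def dest: injD)
    qed
    have "range (\<lambda>(k, j). J k j) = (\<Union>k. range (J k))" by auto
    also have "\<dots> = S" using J D_S by (simp add: bij_betw_def)
    finally show "range (\<lambda>(k, j). J k j) = S" .
  qed
  have "(\<Sum>k. SUP j. H (J k j)) \<le> (\<Sum>k. (SUP i\<in>C k. H i) + ennreal ((1/2) ^ k))"
  proof (intro suminf_le summableI SUP_least)
    fix k j
    have "J k j \<in> D k" using J[of k] by (auto simp: bij_betw_def)
    then consider "J k j \<in> C k" | i where "J k j = r (prod_encode (k, i))" by (auto simp: D_def)
    then show "H (J k j) \<le> (SUP i\<in>C k. H i) + ennreal ((1/2) ^ k)"
    proof cases
      case 1
      then have "H (J k j) \<le> (SUP i\<in>C k. H i)" by (rule SUP_upper)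
      then show ?thesis by (simp add: add_increasing2)
    next
      case 2
      then have "H (J k j) \<le> ennreal ((1/2) ^ k)" using r(2)[of "prod_encode (k, i)"] ck
        by (simp add: less_imp_le)
      then show ?thesis by (simp add: add_increasing)
    qed
  qed
  also have "\<dots> = (\<Sum>k. SUP i\<in>C k. H i) + (\<Sum>k. ennreal ((1/2) ^ k))"
    by (rule suminf_add[symmetric]) auto
  also have "\<dots> < \<infinity>"
  proof -
    have "(\<Sum>k. ennreal ((1/2) ^ k)) = ennreal (\<Sum>k. (1/2) ^ k)"
      by (intro suminf_ennreal2) (auto intro: summable_geometric)
    then have "(\<Sum>k. ennreal ((1/2) ^ k)) < \<infinity>" by simp
    then show ?thesis using sum by (simp add: C_def)
  qed
  finally have fin_sum: "(\<Sum>k. SUP j. H (J k j)) < \<infinity>" .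
  have "disjoint_family (\<lambda>j. I (J k j))" for k
    unfolding disjoint_family_on_def
  proof (intro ballI impI)
    fix i j :: nat assume "i \<noteq> j"
    then have "J k i \<noteq> J k j" using J[of k] by (auto simp: bij_betw_def dest: injD)
    moreover have "J k i \<in> D k" "J k j \<in> D k" using J[of k] by (auto simp: bij_betw_def)
    ultimately show "I (J k i) \<inter> I (J k j) = {}" by (intro D_disj)
  qed
  then show ?thesis using bij fin_sum by blast
qed

text \<open>A class consists of the elements of one colour at one scale, so the sum over the classes
  is at most the sum over the scales of the number of colours times the bound on \<open>H\<close>.\<close>
lemma pad_graded_classes:
  fixes S :: "'i set" and I :: "'i \<Rightarrow> 'j set" and H :: "'i \<Rightarrow> ennreal" and scale colour :: "'i \<Rightarrow> nat"
    and K :: "nat \<Rightarrow> nat" and v :: "nat \<Rightarrow> ennreal"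
  assumes fin: "\<And>n. finite {i\<in>S. scale i = n}"
    and compat: "\<And>i j. i \<in> S \<Longrightarrow> j \<in> S \<Longrightarrow> i \<noteq> j \<Longrightarrow> scale i = scale j \<Longrightarrow> colour i = colour j \<Longrightarrow> I i \<inter> I j =
      {}"
    and ext: "\<And>F e. finite F \<Longrightarrow> F \<subseteq> S \<Longrightarrow> e > 0 \<Longrightarrow> \<exists>t\<in>S - F. H t < ennreal e \<and> (\<forall>i\<in>F. I t \<inter> I i = {})"
    and colour: "\<And>i. i \<in> S \<Longrightarrow> colour i < K (scale i)" and H: "\<And>i. i \<in> S \<Longrightarrow> H i \<le> v (scale i)"
    and sum: "(\<Sum>n. of_nat (K n) * v n) < \<infinity>"
  shows "\<exists>J :: nat \<Rightarrow> nat \<Rightarrow> 'i. bij_betw (\<lambda>(k, j). J k j) UNIV S \<and>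
     (\<forall>k. disjoint_family (\<lambda>j. I (J k j))) \<and> (\<Sum>k. SUP j. H (J k j)) < \<infinity>"
proof (rule pad_classes[where cls = "\<lambda>i. prod_encode (scale i, colour i)"])
  show "finite {i\<in>S. prod_encode (scale i, colour i) = k}" for k
    by (rule finite_subset[OF _ fin[of "fst (prod_decode k)"]]) auto
  show "I i \<inter> I j = {}" if "i \<in> S" "j \<in> S" "i \<noteq> j" "prod_encode (scale i, colour i) =
    prod_encode (scale j, colour j)" for i j
    using that by (intro compat) auto
  show "\<exists>t\<in>S - F. H t < ennreal e \<and> (\<forall>i\<in>F. I t \<inter> I i = {})" if "finite F" "F \<subseteq> S" "e > 0" for F e
    by (rule ext[OF that])
  define w where "w z = (if snd z < K (fst z) then v (fst z) else 0)" for z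
  have "(\<Sum>k. SUP i\<in>{i\<in>S. prod_encode (scale i, colour i) = k}. H i) \<le> (\<Sum>k. w (prod_decode k))"
    using colour H by (intro suminf_le summableI SUP_least) (auto simp: w_def)
  also have "\<dots> = (\<Sum>n. of_nat (K n) * v n)"
  proof (rule suminf_ennreal_2dimen)
    fix n
    have "(\<Sum>c. w (n, c)) = (\<Sum>c<K n. w (n, c))" by (rule suminf_finite) (auto simp: w_def)
    then show "of_nat (K n) * v n = (\<Sum>c. w (n, c))" by (simp add: w_def)
  qed
  finally show "(\<Sum>k. SUP i\<in>{i\<in>S. prod_encode (scale i, colour i) = k}. H i) < \<infinity>" using sum
    by (rule le_less_trans)
qed

section \<open>Independence and stationarity of increments\<close>

lemma (in prob_space) eventually_event_le:
  assumes E: "\<And>m. E m \<in> events" and le: "eventually (\<lambda>m. emeasure M (E m) \<le> c) sequentially"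
  shows "(\<Union>k. \<Inter>m\<in>{k..}. E m) \<in> events" "emeasure M (\<Union>k::nat. \<Inter>m\<in>{k..}. E m) \<le> c"
proof -
  show "(\<Union>k. \<Inter>m\<in>{k..}. E m) \<in> events" using E by (auto intro!: sets.countable_UN sets.countable_INT)
  have "emeasure M (\<Union>k. \<Inter>m\<in>{k..}. E m) = (SUP k. emeasure M (\<Inter>m\<in>{k..}. E m))"
    using E by (intro SUP_emeasure_incseq[symmetric])
      (auto simp: incseq_def intro!: sets.countable_INT)
  also have "\<dots> \<le> c"
  proof (rule SUP_least)
    fix k
    obtain N where N: "\<And>m. m \<ge> N \<Longrightarrow> emeasure M (E m) \<le> c" using le unfolding eventually_sequentially
      by blast
    have "emeasure M (\<Inter>m\<in>{k..}. E m) \<le> emeasure M (E (max k N))" using E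
      by (intro emeasure_mono) auto
    also have "\<dots> \<le> c" using N by simp
    finally show "emeasure M (\<Inter>m\<in>{k..}. E m) \<le> c" .
  qed
  finally show "emeasure M (\<Union>k::nat. \<Inter>m\<in>{k..}. E m) \<le> c" .
qed

locale stable_process = prob_space M for M :: "'a measure" +
  fixes X :: "real \<Rightarrow> 'a \<Rightarrow> real" and \<alpha> :: real
  assumes \<alpha>: "0 < \<alpha>" "\<alpha> < 1" and stable: "spectrally_positive_stable M X \<alpha>"
begin

abbreviation "\<beta> \<equiv> 1 + \<alpha>"

abbreviation jump_at :: "'a \<Rightarrow> real \<Rightarrow> real" where "jump_at \<omega> \<equiv> jump (\<lambda>u. X u \<omega>)"

lemma X_measurable: "t \<ge> 0 \<Longrightarrow> X t \<in> borel_measurable M"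
  and X_cadlag: "\<omega> \<in> space M \<Longrightarrow> cadlag (\<lambda>t. X t \<omega>)"
  and X_0: "AE \<omega> in M. X 0 \<omega> = 0"
  and increment_distr: "s \<ge> 0 \<Longrightarrow> h \<ge> 0 \<Longrightarrow> distr M borel (\<lambda>\<omega>. X (s + h) \<omega> - X s \<omega>) =
    distr M borel (X h)"
  using stable by (auto simp: spectrally_positive_stable_def levy_process_def)

lemma increments_indep:
  fixes t :: "nat \<Rightarrow> real"
  assumes "0 \<le> t 0" "\<And>i. i < n \<Longrightarrow> t i < t (Suc i)"
  shows "indep_vars (\<lambda>_. borel) (\<lambda>i \<omega>. X (t (Suc i)) \<omega> - X (t i) \<omega>) {..<n}"
  using stable assms by (auto simp: spectrally_positive_stable_def levy_process_def)

lemma increment_laplace: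
  assumes "s \<ge> 0" "h \<ge> 0" "\<eta> \<ge> 0"
  shows "has_bochner_integral M (\<lambda>\<omega>. exp (- \<eta> * (X (s + h) \<omega> - X s \<omega>))) (exp (h * \<eta> powr \<beta>))"
proof -
  have L: "has_bochner_integral M (\<lambda>\<omega>. exp (- \<eta> * X h \<omega>)) (exp (h * \<eta> powr \<beta>))"
    using stable assms by (auto simp: spectrally_positive_stable_def has_laplace_exponent_def)
  have [measurable]: "random_variable borel (X h)" "random_variable borel (\<lambda>\<omega>. X (s + h) \<omega> - X s \<omega>)"
    using assms by (auto intro!: borel_measurable_diff X_measurable)
  have "integrable (distr M borel (X h)) (\<lambda>y. exp (- \<eta> * y))" "integral\<^sup>L (distr M borel (X h)) (\<lambda>y.
    exp (- \<eta> * y)) = exp (h * \<eta> powr \<beta>)"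
    using L by (subst integrable_distr_eq integral_distr; simp add: has_bochner_integral_iff)+
  then show ?thesis unfolding increment_distr[OF assms(1,2), symmetric] has_bochner_integral_iff
    by (subst (asm) integrable_distr_eq, simp, simp) (subst (asm) integral_distr, simp_all)
qed

lemma increment_measurable: "0 \<le> s \<Longrightarrow> 0 \<le> t \<Longrightarrow> random_variable borel (\<lambda>\<omega>. X t \<omega> - X s \<omega>)"
  by (intro borel_measurable_diff X_measurable)

lemma increment_tail:
  assumes "s \<ge> 0" "h \<ge> 0" "x > 0"
  shows "prob {\<omega>\<in>space M. \<bar>X (s + h) \<omega> - X s \<omega>\<bar> \<ge> x} \<le> tail_const * (h * x powr (-\<beta>))"
  using assms \<alpha> by (intro laplace_tail increment_measurable increment_laplace) auto

lemma increment_concentration: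
  assumes "s \<ge> 0" "h > 0" "l > 0"
  shows "prob {\<omega>\<in>space M. \<bar>X (s + h) \<omega> - X s \<omega> - x\<bar> \<le> l} \<le> concentration_const \<beta>
    * (l * h powr (- 1 / \<beta>))"
  using assms \<alpha> by (intro laplace_concentration increment_measurable increment_laplace) auto

text \<open>By independence the joint law is a product of one-dimensional laws, which are stationary.\<close>
lemma increments_shift:
  fixes r :: "nat \<Rightarrow> real"
  assumes s: "s \<ge> 0" and r: "r 0 = 0" "\<And>i. i < J \<Longrightarrow> r i < r (Suc i)" and J: "J > 0"
  shows "distr M (PiM {..<J} (\<lambda>_. borel)) (\<lambda>\<omega>. \<lambda>i\<in>{..<J}. X (s + r (Suc i)) \<omega> - X (s + r i) \<omega>)
       = PiM {..<J} (\<lambda>i. distr M borel (X (r (Suc i) - r i)))"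
proof -
  have nonneg: "0 \<le> r i" if "i \<le> J" for i
    using that by (induction i) (use r in \<open>auto simp: less_imp_le Suc_le_eq intro: order_trans[OF _
      less_imp_le]\<close>)
  have "indep_vars (\<lambda>_. borel) (\<lambda>i \<omega>. X (s + r (Suc i)) \<omega> - X (s + r i) \<omega>) {..<J}"
    using s r increments_indep[of "\<lambda>i. s + r i" J] by auto
  then have "distr M (PiM {..<J} (\<lambda>_. borel)) (\<lambda>\<omega>. \<lambda>i\<in>{..<J}. X (s + r (Suc i)) \<omega> - X (s + r i) \<omega>)
       = PiM {..<J} (\<lambda>i. distr M borel (\<lambda>\<omega>. X (s + r (Suc i)) \<omega> - X (s + r i) \<omega>))"
    using J s nonneg by (subst indep_vars_iff_distr_eq_PiM'[symmetric])
      (auto intro!: increment_measurable)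
  also have "\<dots> = PiM {..<J} (\<lambda>i. distr M borel (X (r (Suc i) - r i)))"
  proof (rule PiM_cong)
    fix i assume "i \<in> {..<J}"
    then show "distr M borel (\<lambda>\<omega>. X (s + r (Suc i)) \<omega> - X (s + r i) \<omega>) =
      distr M borel (X (r (Suc i) - r i))"
      using increment_distr[of "s + r i" "r (Suc i) - r i"] nonneg[of i] r(2)[of i] s by simp
  qed simp
  finally show ?thesis .
qed

text \<open>Only finitely many times are observed, so that the event depends on finitely many
  increments.\<close>
definition stays_below :: "(nat \<Rightarrow> real) \<Rightarrow> nat \<Rightarrow> real \<Rightarrow> real \<Rightarrow> 'a set" where
  "stays_below r J \<delta> s = {\<omega>\<in>space M. \<forall>j\<le>J. X (s + r j) \<omega> - X s \<omega> \<le> \<delta>}"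

lemma stays_below_eq:
  assumes "r 0 = 0"
  shows "stays_below r J \<delta> s = (\<lambda>\<omega>. \<lambda>i\<in>{..<J}. X (s + r (Suc i)) \<omega> - X (s + r i) \<omega>) -`
     {f\<in>space (PiM {..<J} (\<lambda>_. borel)). \<forall>j\<le>J. (\<Sum>i<j. f i) \<le> \<delta>} \<inter> space M"
proof -
  have "(\<Sum>i<j. (\<lambda>i\<in>{..<J}. X (s + r (Suc i)) \<omega> - X (s + r i) \<omega>) i) = X (s + r j) \<omega> - X s \<omega>"
    if "j \<le> J" for j \<omega>
  proof -
    have "(\<Sum>i<j. (\<lambda>i\<in>{..<J}. X (s + r (Suc i)) \<omega> - X (s + r i) \<omega>) i) =
      (\<Sum>i<j. X (s + r (Suc i)) \<omega> - X (s + r i) \<omega>)"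
      using that by (intro sum.cong) (auto dest: less_le_trans)
    also have "\<dots> = X (s + r j) \<omega> - X s \<omega>"
      using assms sum_lessThan_telescope[of "\<lambda>i. X (s + r i) \<omega>" j] by simp
    finally show ?thesis .
  qed
  then show ?thesis by (auto simp: stays_below_def space_PiM)
qed

lemma stays_below_set_measurable:
  fixes J :: nat
  shows
  "{f\<in>space (PiM {..<J} (\<lambda>_. borel)). \<forall>j\<le>J. (\<Sum>i<j. f i) \<le>
    (\<delta>::real)} \<in> sets (PiM {..<J} (\<lambda>_. borel))"
proof -
  have "(\<lambda>f. \<Sum>i<j. f i :: real) \<in> borel_measurable (PiM {..<J} (\<lambda>_. borel))" if "j \<le> J" for j
    using that by (intro borel_measurable_sum[of "{..<j}"
      "\<lambda>i f. f i"] measurable_component_singleton)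
      (auto dest: less_le_trans)
  then have "{f\<in>space (PiM {..<J} (\<lambda>_. borel)). \<forall>j\<in>{..J}. (\<Sum>i<j. f i) \<le>
    \<delta>} \<in> sets (PiM {..<J} (\<lambda>_. borel))"
    by (intro sets.sets_Collect_finite_All) (auto intro!: borel_measurable_le)
  then show ?thesis by simp
qed

text \<open>The Markov property at time \<open>s\<close>: the increment that ends at \<open>s\<close> and those that start at
  \<open>s\<close> or later form two independent blocks.\<close>
lemma increment_then_stays_below:
  assumes s: "0 \<le> s'" "s' < s" and r: "r 0 = 0" "\<And>i. i < J \<Longrightarrow> r i < r (Suc i)" and J: "J > 0"
    and B: "B \<in> sets borel"
  shows "{\<omega>\<in>space M. X s \<omega> - X s' \<omega> \<in> B \<and> \<omega> \<in> stays_below r J \<delta> s} \<in> events" (is ?e)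
    and "prob {\<omega>\<in>space M. X s \<omega> - X s' \<omega> \<in> B \<and> \<omega> \<in> stays_below r J \<delta> s} =
       prob {\<omega>\<in>space M. X s \<omega> - X s' \<omega> \<in> B} * prob (stays_below r J \<delta> 0)" (is ?p)
proof -
  let ?P = "\<lambda>J. PiM {..<J} (\<lambda>_. borel :: real measure)"
  let ?S = "{f\<in>space (?P J). \<forall>j\<le>J. (\<Sum>i<j. f i) \<le> \<delta>}"
  have S: "?S \<in> sets (?P J)" by (rule stays_below_set_measurable)
  have nonneg: "0 \<le> r i" if "i \<le> J" for i
    using that by (induction i) (use r in \<open>auto simp: less_imp_le Suc_le_eq intro: order_trans[OF _
      less_imp_le]\<close>)
  have Fm: "(\<lambda>\<omega>. \<lambda>i\<in>{..<J}. X (u + r (Suc i)) \<omega> - X (u + r i) \<omega>) \<in> measurable M (?P J)" if "u \<ge> 0"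
    for u
    using that nonneg by (intro measurable_restrict increment_measurable)
      (auto intro!: add_nonneg_nonneg)
  have sm: "stays_below r J \<delta> u \<in> events" if "u \<ge> 0" for u
    unfolding stays_below_eq[of r, OF r(1)] by (rule measurable_sets[OF Fm S]) fact
  have im: "random_variable borel (\<lambda>\<omega>. X s \<omega> - X s' \<omega>)" using s by (intro increment_measurable) auto
  have "{\<omega>\<in>space M. X s \<omega> - X s' \<omega> \<in> B} \<in> events" using measurable_sets[OF im B]
    by (simp add: vimage_def Int_def conj_commute)
  moreover have "stays_below r J \<delta> s \<in> events" using sm s by simp
  ultimately have "{\<omega>\<in>space M. X s \<omega> - X s' \<omega> \<in> B} \<inter> stays_below r J \<delta> s \<in> events"
    by (rule sets.Int)
  moreover have "{\<omega>\<in>space M. X s \<omega> - X s' \<omega> \<in> B} \<inter> stays_below r J \<delta> s =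
    {\<omega>\<in>space M. X s \<omega> - X s' \<omega> \<in> B \<and> \<omega> \<in> stays_below r J \<delta> s}" by auto
  ultimately show ?e by simp
  have shift: "prob (stays_below r J \<delta> u) =
    measure (PiM {..<J} (\<lambda>i. distr M borel (X (r (Suc i) - r i)))) ?S" if "u \<ge> 0" for u
  proof -
    have "measure (distr M (?P J) (\<lambda>\<omega>. \<lambda>i\<in>{..<J}. X (u + r (Suc i)) \<omega> - X (u + r i) \<omega>)) ?S =
      prob (stays_below r J \<delta> u)"
      unfolding stays_below_eq[of r, OF r(1)] by (rule measure_distr[OF Fm[OF that] S])
    then show ?thesis using increments_shift[of u r J, OF that r J] by simp
  qed
  define t where "t i = (case i of 0 \<Rightarrow> s' | Suc j \<Rightarrow> s + r j)" for i
  have "indep_vars (\<lambda>_. borel) (\<lambda>i \<omega>. X (t (Suc i)) \<omega> - X (t i) \<omega>) {..<Suc J}"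
    using s r by (intro increments_indep) (auto simp: t_def split: nat.split)
  then have "indep_var (PiM {0} (\<lambda>_. borel)) (\<lambda>\<omega>. \<lambda>i\<in>{0}. X (t (Suc i)) \<omega> - X (t i) \<omega>)
      (PiM {1..J} (\<lambda>_. borel)) (\<lambda>\<omega>. \<lambda>i\<in>{1..J}. X (t (Suc i)) \<omega> - X (t i) \<omega>)"
    by (rule indep_var_restrict) auto
  then have "indep_var (PiM {0} (\<lambda>_. borel)) (id \<circ> (\<lambda>\<omega>. \<lambda>i\<in>{0}. X (t (Suc i)) \<omega> - X (t i) \<omega>))
      (?P J) ((\<lambda>f. \<lambda>i\<in>{..<J}. f (Suc i)) \<circ> (\<lambda>\<omega>. \<lambda>i\<in>{1..J}. X (t (Suc i)) \<omega> - X (t i) \<omega>))"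
    by (rule indep_var_compose) (auto intro!: measurable_restrict measurable_component_singleton)
  moreover have "id \<circ> (\<lambda>\<omega>. \<lambda>i\<in>{0}. X (t (Suc i)) \<omega> - X (t i) \<omega>) = (\<lambda>\<omega>. \<lambda>i\<in>{0}. X s \<omega> - X s' \<omega>)"
    using r by (auto simp: t_def restrict_def fun_eq_iff)
  moreover have "(\<lambda>f. \<lambda>i\<in>{..<J}. f (Suc i)) \<circ> (\<lambda>\<omega>. \<lambda>i\<in>{1..J}. X (t (Suc i)) \<omega> - X (t i) \<omega>) =
      (\<lambda>\<omega>. \<lambda>i\<in>{..<J}. X (s + r (Suc i)) \<omega> - X (s + r i) \<omega>)"
    by (auto simp: t_def restrict_def fun_eq_iff)
  ultimately have iv: "indep_var (PiM {0} (\<lambda>_. borel)) (\<lambda>\<omega>. \<lambda>i\<in>{0}. X s \<omega> - X s' \<omega>) (?P J) (\<lambda>\<omega>.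
    \<lambda>i\<in>{..<J}. X (s + r (Suc i)) \<omega> - X (s + r i) \<omega>)"
    by simp
  let ?B = "{f\<in>space (PiM {0::nat} (\<lambda>_. borel :: real measure)). f 0 \<in> B}"
  have Bm: "?B \<in> sets (PiM {0} (\<lambda>_. borel))"
    using measurable_sets[OF measurable_component_singleton[of 0 "{0::nat}"
      "\<lambda>_. borel :: real measure"] B]
    by (simp add: vimage_def Int_def conj_commute)
  from indep_varD[OF iv Bm S]
  have "prob ((\<lambda>\<omega>. (\<lambda>i\<in>{0}. X s \<omega> - X s' \<omega>, \<lambda>i\<in>{..<J}. X (s + r (Suc i)) \<omega> - X (s + r i) \<omega>)) -`
    (?B \<times> ?S) \<inter> space M)
    = prob ((\<lambda>\<omega>. \<lambda>i\<in>{0}. X s \<omega> - X s' \<omega>) -` ?B \<inter> space M) * prob (stays_below r J \<delta> s)"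
    unfolding stays_below_eq[of r, OF r(1)] .
  moreover have "(\<lambda>\<omega>. (\<lambda>i\<in>{0::nat}. X s \<omega> - X s' \<omega>, \<lambda>i\<in>{..<J}. X (s + r (Suc i)) \<omega> - X (s + r i) \<omega>))
    -` (?B \<times> ?S) \<inter> space M =
     {\<omega>\<in>space M. X s \<omega> - X s' \<omega> \<in> B \<and> \<omega> \<in> stays_below r J \<delta> s}"
    unfolding stays_below_eq[of r, OF r(1)] by (auto simp: space_PiM)
  moreover have "(\<lambda>\<omega>. \<lambda>i\<in>{0::nat}. X s \<omega> - X s' \<omega>) -` ?B \<inter> space M =
    {\<omega>\<in>space M. X s \<omega> - X s' \<omega> \<in> B}" by (auto simp: space_PiM)
  ultimately show ?p using shift[of s] shift[of 0] s by simp
qed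

text \<open>The last increment can be integrated out while the earlier ones are held fixed.\<close>
lemma history_nn_integral:
  fixes t :: "nat \<Rightarrow> real"
  assumes t: "0 \<le> t 0" "\<And>i. i < Suc k \<Longrightarrow> t i < t (Suc i)"
    and H[measurable]: "case_prod H \<in> borel_measurable (PiM {..<k} (\<lambda>_. borel) \<Otimes>\<^sub>M borel)"
  shows "(\<integral>\<^sup>+\<omega>. H (\<lambda>i\<in>{..<k}. X (t (Suc i)) \<omega> - X (t i) \<omega>) (X (t (Suc k)) \<omega> - X (t k) \<omega>) \<partial>M)
       = (\<integral>\<^sup>+\<omega>. (\<integral>\<^sup>+y. H (\<lambda>i\<in>{..<k}. X (t (Suc i)) \<omega> - X (t i) \<omega>) y \<partial>distr M borel (X (t
         (Suc k) - t k))) \<partial>M)"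
proof -
  let ?Y = "\<lambda>i \<omega>. X (t (Suc i)) \<omega> - X (t i) \<omega>"
  let ?P = "PiM {..<k} (\<lambda>_. borel :: real measure)"
  let ?K = "PiM {k} (\<lambda>_. borel :: real measure)"
  let ?Z = "\<lambda>\<omega>. \<lambda>i\<in>{k}. ?Y i \<omega>"
  let ?D = "distr M borel (X (t (Suc k) - t k))"
  have "indep_vars (\<lambda>_. borel) ?Y {..<Suc k}"
    using t by (intro increments_indep) auto
  then have iv: "indep_var ?P (\<lambda>\<omega>. \<lambda>i\<in>{..<k}. ?Y i \<omega>) ?K ?Z"
    by (rule indep_var_restrict) auto
  have nonneg: "0 \<le> t i" if "i \<le> Suc k" for i
    using that by (induction i) (use t in \<open>auto simp: less_imp_le less_Suc_eq_le intro:
      order_trans[OF _ less_imp_le]\<close>)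
  have Ym: "random_variable borel (?Y i)" if "i \<le> k" for i using that nonneg
    by (intro increment_measurable) auto
  have Fm[measurable]: "random_variable ?P (\<lambda>\<omega>. \<lambda>i\<in>{..<k}. ?Y i \<omega>)"
    by (intro measurable_restrict Ym) auto
  have Zm[measurable]: "random_variable ?K ?Z" by (intro measurable_restrict Ym) auto
  have Gm[measurable]: "(\<lambda>g. g k) \<in> borel_measurable ?K"
    by (rule measurable_component_singleton) simp
  have D: "distr M borel (?Y k) = ?D"
    using increment_distr[of "t k" "t (Suc k) - t k"] nonneg[of k] t(2)[of k] by simp
  have eq: "distr M ?P (\<lambda>\<omega>. \<lambda>i\<in>{..<k}. ?Y i \<omega>) \<Otimes>\<^sub>M distr M ?K ?Z =
      distr M (?P \<Otimes>\<^sub>M ?K) (\<lambda>\<omega>. (\<lambda>i\<in>{..<k}. ?Y i \<omega>, ?Z \<omega>))"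
    using iv unfolding indep_var_distribution_eq by blast
  interpret D: prob_space ?D using t(2)[of k] by (intro prob_space_distr X_measurable) auto
  interpret K: prob_space "distr M ?K ?Z" by (intro prob_space_distr Zm)
  have Hm[measurable]: "(\<lambda>z. H (fst z) (snd z k)) \<in> borel_measurable (?P \<Otimes>\<^sub>M ?K)"
    using measurable_compose[OF _ H, of "\<lambda>z. (fst z, snd z k)" "?P \<Otimes>\<^sub>M ?K"]
    by (simp add: case_prod_beta)
  have last: "(\<integral>\<^sup>+g. H f (g k) \<partial>distr M ?K ?Z) = (\<integral>\<^sup>+y. H f y \<partial>?D)"
    if f: "f \<in> space ?P" for f
  proof -
    have [measurable]: "H f \<in> borel_measurable borel"
      using measurable_compose[OF measurable_Pair1' H, OF f] by simp
    show ?thesis unfolding D[symmetric] using Ym by (subst (1 2) nn_integral_distr) auto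
  qed
  have "(\<integral>\<^sup>+\<omega>. H (\<lambda>i\<in>{..<k}. ?Y i \<omega>) (?Y k \<omega>) \<partial>M) =
      (\<integral>\<^sup>+z. H (fst z) (snd z k) \<partial>distr M (?P \<Otimes>\<^sub>M ?K) (\<lambda>\<omega>. (\<lambda>i\<in>{..<k}. ?Y i \<omega>, ?Z \<omega>)))"
    using Zm Fm by (subst nn_integral_distr) auto
  also have "\<dots> = (\<integral>\<^sup>+f. (\<integral>\<^sup>+g. H f (g k) \<partial>distr M ?K ?Z) \<partial>distr M ?P (\<lambda>\<omega>. \<lambda>i\<in>{..<k}. ?Y i \<omega>))"
    unfolding eq[symmetric] by (subst K.nn_integral_fst[symmetric]) auto
  also have "\<dots> = (\<integral>\<^sup>+f. (\<integral>\<^sup>+y. H f y \<partial>?D) \<partial>distr M ?P (\<lambda>\<omega>. \<lambda>i\<in>{..<k}. ?Y i \<omega>))"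
    by (intro nn_integral_cong last) simp
  also have "\<dots> = (\<integral>\<^sup>+\<omega>. (\<integral>\<^sup>+y. H (\<lambda>i\<in>{..<k}. ?Y i \<omega>) y \<partial>?D) \<partial>M)"
    by (subst nn_integral_distr) (auto simp: Fm)
  finally show ?thesis .
qed

lemma two_increments_nn_integral:
  assumes s: "s \<ge> 0" "h > 0" "u > 0"
    and f[measurable]: "case_prod f \<in> borel_measurable (borel \<Otimes>\<^sub>M borel)"
  shows "(\<integral>\<^sup>+\<omega>. f (X (s + h) \<omega> - X s \<omega>) (X (s + h + u) \<omega> - X (s + h) \<omega>) \<partial>M)
       = (\<integral>\<^sup>+a. (\<integral>\<^sup>+b. f a b \<partial>distr M borel (X u)) \<partial>distr M borel (X h))"
proof -
  define t where "t i = (if i = 0 then s else if i = 1 then s + h else s + h + u)" for i :: nat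
  interpret D: prob_space "distr M borel (X u)" using s
    by (intro prob_space_distr X_measurable) auto
  have [measurable]: "(\<lambda>g. g 0) \<in> borel_measurable (PiM {..<1::nat} (\<lambda>_. borel :: real measure))"
    by (rule measurable_component_singleton) simp
  have "(\<lambda>z. f (fst z 0) (snd z)) \<in> borel_measurable (PiM {..<1::nat} (\<lambda>_. borel :: real measure)
    \<Otimes>\<^sub>M borel)"
    using measurable_compose[OF _ f, of "\<lambda>z. (fst z 0, snd z)"
      "PiM {..<1::nat} (\<lambda>_. borel :: real measure) \<Otimes>\<^sub>M borel"] by simp
  then have "(\<integral>\<^sup>+\<omega>. f ((\<lambda>i\<in>{..<1}. X (t (Suc i)) \<omega> - X (t i) \<omega>) 0) (X (t (Suc 1)) \<omega> - X (t 1) \<omega>) \<partial>M)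
      = (\<integral>\<^sup>+\<omega>. (\<integral>\<^sup>+y. f ((\<lambda>i\<in>{..<1}. X (t (Suc i)) \<omega> - X (t i) \<omega>) 0) y \<partial>distr M borel (X (t
        (Suc 1) - t 1))) \<partial>M)"
    using s by (intro history_nn_integral[where H = "\<lambda>g. f (g 0)"])
      (auto simp: t_def case_prod_beta)
  then have "(\<integral>\<^sup>+\<omega>. f (X (s + h) \<omega> - X s \<omega>) (X (s + h + u) \<omega> - X (s + h) \<omega>) \<partial>M)
      = (\<integral>\<^sup>+\<omega>. (\<integral>\<^sup>+y. f (X (s + h) \<omega> - X s \<omega>) y \<partial>distr M borel (X u)) \<partial>M)"
    by (simp add: t_def)
  also have "\<dots> = (\<integral>\<^sup>+a. (\<integral>\<^sup>+b. f a b \<partial>distr M borel (X u)) \<partial>distr M borel (\<lambda>\<omega>. X (s + h) \<omega>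
    - X s \<omega>))"
    using s by (subst nn_integral_distr) (auto intro!: increment_measurable)
  finally show ?thesis using increment_distr[of s h] s by simp
qed

end

section \<open>Visits of the process to a level\<close>

lemma sum_powr_le:
  assumes s: "0 < s" "s < (1::real)"
  shows "(\<Sum>i\<in>{1..m}. real i powr (-s)) \<le> real m powr (1 - s) / (1 - s)"
proof (induction m)
  case (Suc m)
  have "real (Suc m) powr (-s) \<le> (real (Suc m) powr (1 - s) - real m powr (1 - s)) / (1 - s)"
  proof (cases "m = 0")
    case False
    have "\<exists>z. real m < z \<and> z < real (Suc m) \<and> real (Suc m) powr (1 - s) - real m powr (1 - s)
        = (real (Suc m) - real m) * ((1 - s) * z powr (1 - s - 1))"
      using False by (intro MVT2 has_real_derivative_powr) auto
    then obtain z where z: "real m < z" "z < real (Suc m)"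
        "real (Suc m) powr (1 - s) - real m powr (1 - s) = (1 - s) * z powr (- s)"
      by auto
    have "real (Suc m) powr (-s) \<le> z powr (-s)" using z s False by (intro powr_mono2') auto
    then show ?thesis using z(3) s by simp
  qed (use s in simp)
  then show ?case using Suc by (simp add: diff_divide_distrib)
qed simp

context stable_process
begin

text \<open>This is what a jump looks like on a grid. If a jump of size in \<open>(l/2, l]\<close> starts within
  \<open>2 l\<close> of \<open>y\<close>, then on every fine grid the cell of the jump has its left end value \<open>x\<close> and its
  increment \<open>\<xi>\<close> in this relation; the larger window and the smaller threshold leave room for the
  discretization.\<close>
definition visit :: "real \<Rightarrow> real \<Rightarrow> real \<Rightarrow> real \<Rightarrow> bool" where
  "visit y l x \<xi> \<longleftrightarrow> \<bar>x - y\<bar> \<le> 3 * l \<and> l / 4 \<le> \<xi>"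

definition near_prob :: "real \<Rightarrow> real \<Rightarrow> real \<Rightarrow> nat \<Rightarrow> real \<Rightarrow> ennreal" where
  "near_prob h y l i x = (\<integral>\<^sup>+b. indicator {b. \<bar>x + b - y\<bar> \<le> 3 * l} b \<partial>distr M borel (\<lambda>\<omega>.
    X (real i * h) \<omega> - X 0 \<omega>))"

text \<open>The expected number of visits during \<open>k\<close> steps from \<open>x\<close>. It is a product since the next
  increment is independent of the current position.\<close>
definition mean_visits :: "real \<Rightarrow> real \<Rightarrow> real \<Rightarrow> nat \<Rightarrow> real \<Rightarrow> ennreal" where
  "mean_visits h y l k x = emeasure (distr M borel (X h)) {l/4..} * (\<Sum>i<k. near_prob h y l i x)"

lemma near_prob_measurable [measurable]:
  assumes "h > 0" shows "near_prob h y l i \<in> borel_measurable borel"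
proof -
  interpret D: prob_space "distr M borel (\<lambda>\<omega>. X (real i * h) \<omega> - X 0 \<omega>)"
    using assms by (intro prob_space_distr increment_measurable) auto
  have "near_prob h y l i = (\<lambda>x. \<integral>\<^sup>+b. (if \<bar>x + b - y\<bar> \<le> 3 * l then 1 else 0) \<partial>distr M borel (\<lambda>\<omega>.
    X (real i * h) \<omega> - X 0 \<omega>))"
    by (auto simp: near_prob_def fun_eq_iff indicator_def of_bool_def intro!: nn_integral_cong)
  also have "\<dots> \<in> borel_measurable borel"
    by (intro D.borel_measurable_nn_integral) measurable
  finally show ?thesis .
qed

lemma mean_visits_measurable [measurable]:
  "h > 0 \<Longrightarrow> mean_visits h y l k \<in> borel_measurable borel"
  unfolding mean_visits_def[abs_def]
  by (intro borel_measurable_times_ennreal borel_measurable_const borel_measurable_sum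
    near_prob_measurable)

text \<open>The Chapman-Kolmogorov equation for the first step.\<close>
lemma near_prob_step:
  assumes h: "h > 0"
  shows "(\<integral>\<^sup>+\<xi>. near_prob h y l i (x + \<xi>) \<partial>distr M borel (X h)) = near_prob h y l (Suc i) x"
proof (cases "i = 0")
  case True
  have D: "distr M borel (X h) = distr M borel (\<lambda>\<omega>. X (real (Suc 0) * h) \<omega> - X 0 \<omega>)"
    using increment_distr[of 0 h] h by simp
  have "near_prob h y l 0 z = indicator {b. \<bar>z + b - y\<bar> \<le> 3 * l} 0" for z
    unfolding near_prob_def using h by (subst nn_integral_distr) (auto simp: emeasure_space_1)
  then have "near_prob h y l 0 (x + \<xi>) = indicator {b. \<bar>x + b - y\<bar> \<le> 3 * l} \<xi>" for \<xi>
    by (simp add: indicator_def)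
  then show ?thesis unfolding True D near_prob_def[of _ _ _ "Suc 0"] by simp
next
  case False
  define f :: "real \<Rightarrow> real \<Rightarrow> ennreal" where "f a b = (if \<bar>x + a + b - y\<bar> \<le> 3 * l then 1 else 0)"
    for a b
  have [measurable]: "case_prod f \<in> borel_measurable (borel \<Otimes>\<^sub>M borel)" unfolding f_def
    by measurable
  have ih: "real i * h > 0" using h False by simp
  have D: "distr M borel (X (real i * h)) = distr M borel (\<lambda>\<omega>. X (real i * h) \<omega> - X 0 \<omega>)"
    using increment_distr[of 0 "real i * h"] ih by simp
  have "(\<integral>\<^sup>+\<xi>. near_prob h y l i (x + \<xi>) \<partial>distr M borel (X h)) =
      (\<integral>\<^sup>+a. (\<integral>\<^sup>+b. f a b \<partial>distr M borel (X (real i * h))) \<partial>distr M borel (X h))"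
  proof -
    have "f a = indicator {b. \<bar>x + a + b - y\<bar> \<le> 3 * l}" for a by (auto simp: f_def indicator_def)
    then show ?thesis unfolding near_prob_def D by simp
  qed
  also have "\<dots> = (\<integral>\<^sup>+\<omega>. f (X (0 + h) \<omega> - X 0 \<omega>) (X (0 + h + real i * h) \<omega> - X (0 + h) \<omega>) \<partial>M)"
    using h ih by (intro two_increments_nn_integral[symmetric]) auto
  also have "\<dots> = (\<integral>\<^sup>+\<omega>. indicator {b. \<bar>x + b - y\<bar> \<le> 3 * l} (X (real (Suc i) * h) \<omega> - X 0 \<omega>) \<partial>M)"
    by (intro nn_integral_cong) (auto simp: f_def indicator_def algebra_simps)
  also have "\<dots> = near_prob h y l (Suc i) x"
    unfolding near_prob_def using h by (subst nn_integral_distr) (auto intro!: increment_measurable)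
  finally show ?thesis .
qed

lemma near_prob_0: "near_prob h y l 0 x = (if \<bar>x - y\<bar> \<le> 3 * l then 1 else 0)"
  unfolding near_prob_def by (subst nn_integral_distr) (auto simp: emeasure_space_1 indicator_def)

lemma mean_visits_step:
  assumes h: "h > 0"
  shows "(\<integral>\<^sup>+\<xi>. (if visit y l x \<xi> then 1 else 0) + mean_visits h y l k (x + \<xi>) \<partial>distr M borel (X h))
    = mean_visits h y l (Suc k) x"
proof -
  let ?D = "distr M borel (X h)"
  have "(\<integral>\<^sup>+\<xi>. mean_visits h y l k (x + \<xi>) \<partial>?D) =
    emeasure ?D {l/4..} * (\<Sum>i<k. \<integral>\<^sup>+\<xi>. near_prob h y l i (x + \<xi>) \<partial>?D)"
    unfolding mean_visits_def using near_prob_measurable[OF h]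
    by (subst nn_integral_cmult) (auto intro!: nn_integral_sum arg_cong[where f = "(*) _"])
  also have "\<dots> = emeasure ?D {l/4..} * (\<Sum>i<k. near_prob h y l (Suc i) x)"
    using near_prob_step[OF h] by simp
  finally have 1: "(\<integral>\<^sup>+\<xi>. mean_visits h y l k (x + \<xi>) \<partial>?D) =
    emeasure ?D {l/4..} * (\<Sum>i<k. near_prob h y l (Suc i) x)" .
  have "(\<integral>\<^sup>+\<xi>. (if visit y l x \<xi> then 1 else 0) \<partial>?D) =
    (\<integral>\<^sup>+\<xi>. near_prob h y l 0 x * indicator {l/4..} \<xi> \<partial>?D)"
    by (intro nn_integral_cong) (auto simp: near_prob_0 visit_def indicator_def)
  also have "\<dots> = emeasure ?D {l/4..} * near_prob h y l 0 x"
    by (subst nn_integral_cmult) (auto simp: mult.commute)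
  finally have 2: "(\<integral>\<^sup>+\<xi>. (if visit y l x \<xi> then 1 else 0) \<partial>?D) =
    emeasure ?D {l/4..} * near_prob h y l 0 x" .
  have [measurable]: "(\<lambda>\<xi>. mean_visits h y l k (x + \<xi>)) \<in> borel_measurable borel"
    by (rule measurable_compose[OF _ mean_visits_measurable[OF h]]) measurable
  have [measurable]: "(\<lambda>\<xi>. (if visit y l x \<xi> then 1 else 0) :: ennreal) \<in> borel_measurable borel"
    unfolding visit_def by measurable
  have "(\<integral>\<^sup>+\<xi>. (if visit y l x \<xi> then 1 else 0) + mean_visits h y l k (x + \<xi>) \<partial>?D) =
      emeasure ?D {l/4..} * near_prob h y l 0 x + emeasure ?D {l/4..} * (\<Sum>i<k. near_prob h y l
        (Suc i) x)"
    unfolding 1[symmetric] 2[symmetric] by (rule nn_integral_add) auto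
  then show ?thesis
    by (simp only: mean_visits_def[of _ _ _ "Suc k"] sum.lessThan_Suc_shift distrib_left)
qed

text \<open>Let \<open>w\<close> be \<open>1 + lam\<close> at each visit and 1 at the other steps. The product of the \<open>w\<close> so
  far, multiplied by \<open>\<Phi>\<close>, that is by \<open>1 + 2 lam\<close> times the expected number of visits still to
  come, is a supermartingale: with \<open>b\<close> the second summand of \<open>\<Phi>\<close> after a visit, \<open>b \<le> 1\<close> implies
  \<open>(1 + lam) (1 + b) \<le> 1 + b + 2 lam\<close>, and the last term is what a visit removes from the
  expectation. The initial value is at most 2.\<close>
lemma exponential_visits:
  assumes h: "h > 0" and lam: "lam \<ge> (0::real)"
    and small: "\<And>k x. k \<le> m \<Longrightarrow> ennreal (2 * lam) * mean_visits h y l k x \<le> 1"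
  shows "(\<integral>\<^sup>+\<omega>. ennreal (1 + lam) ^ card {j\<in>{..<m}. visit y l (X (real j * h) \<omega>
    - X 0 \<omega>) (X (real (Suc j) * h) \<omega> - X (real j * h) \<omega>)} \<partial>M) \<le> 2"
proof -
  let ?Y = "\<lambda>i \<omega>. X (real (Suc i) * h) \<omega> - X (real i * h) \<omega>"
  let ?D = "distr M borel (X h)"
  define w where "w x \<xi> = (if visit y l x \<xi> then ennreal (1 + lam) else 1)" for x \<xi>
  define \<Phi> where "\<Phi> k x = 1 + ennreal (2 * lam) * mean_visits h y l k x" for k x
  define G where "G k f = (\<Prod>j<k. w (\<Sum>i<j. f i) (f j))" for k :: nat and f :: "nat \<Rightarrow> real"
  define S where "S k = (\<integral>\<^sup>+\<omega>. G k (\<lambda>i. ?Y i \<omega>) * \<Phi> (m - k) (\<Sum>i<k. ?Y i \<omega>) \<partial>M)" for k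
  have tele: "(\<Sum>i<j. ?Y i \<omega>) = X (real j * h) \<omega> - X 0 \<omega>" for j \<omega>
    using sum_lessThan_telescope[of "\<lambda>i. X (real i * h) \<omega>" j] by simp
  have [measurable]: "\<Phi> k \<in> borel_measurable borel" for k
    unfolding \<Phi>_def[abs_def] using mean_visits_measurable[OF h]
    by (intro borel_measurable_add borel_measurable_times_ennreal) auto
  have wm[measurable]: "case_prod w \<in> borel_measurable (borel \<Otimes>\<^sub>M borel)"
    unfolding w_def visit_def by measurable
  have one_step: "(\<integral>\<^sup>+\<xi>. w x \<xi> * \<Phi> k (x + \<xi>) \<partial>?D) \<le> \<Phi> (Suc k) x" if "k \<le> m" for k x
  proof -
    have "w x \<xi> * \<Phi> k (x + \<xi>) \<le> 1 + ennreal (2 * lam) * ((if visit y l x \<xi> then 1 else 0)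
      + mean_visits h y l k (x + \<xi>))" for \<xi>
    proof (cases "visit y l x \<xi>")
      case True
      \<comment> \<open>Here \<open>?b \<le> 1\<close> by \<open>small\<close>, so \<open>lam + lam ?b \<le> 2 lam\<close>.\<close>
      let ?b = "ennreal (2 * lam) * mean_visits h y l k (x + \<xi>)"
      have "w x \<xi> * \<Phi> k (x + \<xi>) = (1 + ennreal lam) * (1 + ?b)" using True lam
        by (simp add: w_def \<Phi>_def)
      also have "\<dots> = 1 + ?b + (ennreal lam + ennreal lam * ?b)"
        by (simp add: distrib_left distrib_right add_ac)
      also have "\<dots> \<le> 1 + ?b + (ennreal lam + ennreal lam * 1)"
        using small[OF that] by (intro add_left_mono mult_left_mono) auto
      also have "ennreal lam + ennreal lam * 1 = ennreal (2 * lam)" using lam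
        by (simp add: ennreal_plus[symmetric] del: ennreal_plus)
      finally show ?thesis using True by (simp add: distrib_left add_ac)
    qed (simp add: w_def \<Phi>_def)
    then have "(\<integral>\<^sup>+\<xi>. w x \<xi> * \<Phi> k (x + \<xi>) \<partial>?D) \<le>
        (\<integral>\<^sup>+\<xi>. 1 + ennreal (2 * lam) * ((if visit y l x \<xi> then 1 else 0) + mean_visits h y l k
          (x + \<xi>)) \<partial>?D)"
      by (intro nn_integral_mono) auto
    also have "\<dots> = \<Phi> (Suc k) x"
    proof -
      have [measurable]: "(\<lambda>\<xi>. mean_visits h y l k (x + \<xi>)) \<in> borel_measurable borel"
        by (rule measurable_compose[OF _ mean_visits_measurable[OF h]]) measurable
      have [measurable]: "(\<lambda>\<xi>. (if visit y l x \<xi> then 1 else 0) :: ennreal) \<in> borel_measurable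
        borel"
        unfolding visit_def by measurable
      interpret D: prob_space ?D using h by (intro prob_space_distr X_measurable) auto
      show ?thesis
        unfolding \<Phi>_def mean_visits_step[OF h, symmetric]
        by (subst nn_integral_add) (auto simp: nn_integral_cmult D.emeasure_space_1[simplified])
    qed
    finally show ?thesis .
  qed
  have Suc_le: "S (Suc k) \<le> S k" if k: "k < m" for k
  proof -
    define H where "H f \<xi> = G k f * (w (\<Sum>i<k. f i) \<xi> * \<Phi> (m - Suc k) ((\<Sum>i<k. f i) + \<xi>))" for f \<xi>
    let ?P = "PiM {..<k} (\<lambda>_. borel :: real measure)"
    have comp: "(\<lambda>z. fst z i) \<in> borel_measurable (?P \<Otimes>\<^sub>M (borel :: real measure))" if "i < k" for i
      using that by (intro measurable_compose[OF measurable_fst measurable_component_singleton])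
        auto
    have psum: "(\<lambda>z. \<Sum>i<j. fst z i) \<in> borel_measurable (?P \<Otimes>\<^sub>M (borel :: real measure))" if "j \<le> k"
      for j
      using that by (intro borel_measurable_sum comp) auto
    have Gm: "(\<lambda>z. G k (fst z)) \<in> borel_measurable (?P \<Otimes>\<^sub>M (borel :: real measure))"
      unfolding G_def
    proof (intro borel_measurable_prod_ennreal)
      fix j assume "j \<in> {..<k}"
      then show "(\<lambda>z. w (\<Sum>i<j. fst z i) (fst z j)) \<in> borel_measurable
        (?P \<Otimes>\<^sub>M (borel :: real measure))"
        using measurable_compose[OF measurable_Pair[OF psum[of j] comp[of j]] wm] by simp
    qed
    have Hm: "case_prod H \<in> borel_measurable (?P \<Otimes>\<^sub>M borel)"
    proof -
      note [measurable] = psum[OF order_refl] Gm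
      have "(\<lambda>z. w (\<Sum>i<k. fst z i) (snd z)) \<in> borel_measurable (?P \<Otimes>\<^sub>M (borel :: real measure))"
        using measurable_compose[OF measurable_Pair[OF psum[OF order_refl] measurable_snd] wm]
        by simp
      moreover have "(\<lambda>z. \<Phi> (m - Suc k) ((\<Sum>i<k. fst z i) + snd z)) \<in> borel_measurable
        (?P \<Otimes>\<^sub>M (borel :: real measure))"
        by measurable
      ultimately show ?thesis unfolding H_def case_prod_beta using Gm
        by (intro borel_measurable_times_ennreal)
    qed
    let ?R = "\<lambda>\<omega>. \<lambda>i\<in>{..<k}. ?Y i \<omega>"
    have rs: "(\<Sum>i<j. ?R \<omega> i) = (\<Sum>i<j. ?Y i \<omega>)" if "j \<le> k" for j \<omega>
      using that by (intro sum.cong) auto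
    have rG: "G k (?R \<omega>) = G k (\<lambda>i. ?Y i \<omega>)" for \<omega>
    proof -
      have "w (\<Sum>i<j. ?R \<omega> i) (?R \<omega> j) = w (\<Sum>i<j. ?Y i \<omega>) (?Y j \<omega>)" if "j < k" for j
      proof -
        have "?R \<omega> j = ?Y j \<omega>" using that by (simp only: restrict_apply lessThan_iff if_True)
        then show ?thesis by (simp only: rs[OF less_imp_le[OF that]])
      qed
      then show ?thesis unfolding G_def by (intro prod.cong refl) blast
    qed
    have s1: "S (Suc k) = (\<integral>\<^sup>+\<omega>. H (?R \<omega>) (?Y k \<omega>) \<partial>M)"
      unfolding S_def
    proof (intro nn_integral_cong)
      fix \<omega>
      have "G (Suc k) (\<lambda>i. ?Y i \<omega>) = G k (\<lambda>i. ?Y i \<omega>) * w (\<Sum>i<k. ?Y i \<omega>) (?Y k \<omega>)"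
        unfolding G_def by (rule prod.lessThan_Suc)
      moreover have "(\<Sum>i<Suc k. ?Y i \<omega>) = (\<Sum>i<k. ?Y i \<omega>) + ?Y k \<omega>" by (rule sum.lessThan_Suc)
      ultimately show "G (Suc k) (\<lambda>i. ?Y i \<omega>) * \<Phi> (m - Suc k) (\<Sum>i<Suc k. ?Y i \<omega>) =
        H (?R \<omega>) (?Y k \<omega>)"
        by (simp only: H_def rG rs[OF order_refl] mult.assoc)
    qed
    have s2: "(\<integral>\<^sup>+\<omega>. H (?R \<omega>) (?Y k \<omega>) \<partial>M) = (\<integral>\<^sup>+\<omega>. (\<integral>\<^sup>+\<xi>. H (?R \<omega>) \<xi> \<partial>?D) \<partial>M)"
    proof -
      have e: "real (Suc k) * h - real k * h = h" by (simp add: algebra_simps)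
      have "(\<integral>\<^sup>+\<omega>. H (?R \<omega>) (?Y k \<omega>) \<partial>M) =
        (\<integral>\<^sup>+\<omega>. (\<integral>\<^sup>+\<xi>. H (?R \<omega>) \<xi> \<partial>distr M borel (X (real (Suc k) * h - real k * h))) \<partial>M)"
      proof (rule history_nn_integral[of "\<lambda>i. real i * h" k H])
        show "0 \<le> real 0 * h" by simp
        show "real i * h < real (Suc i) * h" for i using h by simp
      qed (rule Hm)
      then show ?thesis
        by (rule subst[OF e, where P = "\<lambda>d. (\<integral>\<^sup>+\<omega>. H (?R \<omega>) (?Y k \<omega>) \<partial>M) =
          (\<integral>\<^sup>+\<omega>. (\<integral>\<^sup>+\<xi>. H (?R \<omega>) \<xi> \<partial>distr M borel (X d)) \<partial>M)"])
    qed
    have s3: "(\<integral>\<^sup>+\<omega>. (\<integral>\<^sup>+\<xi>. H (?R \<omega>) \<xi> \<partial>?D) \<partial>M) \<le> S k"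
      unfolding S_def
    proof (intro nn_integral_mono)
      fix \<omega>
      let ?x = "\<Sum>i<k. ?Y i \<omega>"
      have i1: "(\<integral>\<^sup>+\<xi>. H (?R \<omega>) \<xi> \<partial>?D) =
        G k (\<lambda>i. ?Y i \<omega>) * (\<integral>\<^sup>+\<xi>. w ?x \<xi> * \<Phi> (m - Suc k) (?x + \<xi>) \<partial>?D)"
      proof -
        have "(\<lambda>\<xi>. w ?x \<xi>) \<in> borel_measurable borel"
          using measurable_compose[OF measurable_Pair1' wm, of ?x] by simp
        then have "(\<lambda>\<xi>. w ?x \<xi> * \<Phi> (m - Suc k) (?x + \<xi>)) \<in> borel_measurable ?D" by measurable
        then show ?thesis unfolding H_def rG rs[OF order_refl] by (rule nn_integral_cmult)
      qed
      have i3: "Suc (m - Suc k) = m - k" using k by simp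
      have "(\<integral>\<^sup>+\<xi>. w ?x \<xi> * \<Phi> (m - Suc k) (?x + \<xi>) \<partial>?D) \<le> \<Phi> (Suc (m - Suc k)) ?x"
        by (rule one_step) simp
      then have "G k (\<lambda>i. ?Y i \<omega>) * (\<integral>\<^sup>+\<xi>. w ?x \<xi> * \<Phi> (m - Suc k) (?x + \<xi>) \<partial>?D) \<le>
        G k (\<lambda>i. ?Y i \<omega>) * \<Phi> (m - k) ?x"
        unfolding i3 by (rule mult_left_mono) simp
      then show "(\<integral>\<^sup>+\<xi>. H (?R \<omega>) \<xi> \<partial>?D) \<le> G k (\<lambda>i. ?Y i \<omega>) * \<Phi> (m - k) ?x"
        unfolding i1 .
    qed
    show ?thesis by (rule ord_eq_le_trans[OF trans[OF s1 s2] s3])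
  qed
  have "S k \<le> S 0" if "k \<le> m" for k
    using that by (induction k) (auto intro: order_trans[OF Suc_le])
  then have "S m \<le> S 0" by simp
  also have "S 0 \<le> (\<integral>\<^sup>+\<omega>. 2 \<partial>M)"
    unfolding S_def
  proof (intro nn_integral_mono)
    fix \<omega>
    have "1 + ennreal (2 * lam) * mean_visits h y l m 0 \<le> 1 + 1" by (intro add_left_mono small) simp
    then show "G 0 (\<lambda>i. ?Y i \<omega>) * \<Phi> (m - 0) (\<Sum>i<0. ?Y i \<omega>) \<le> 2" by (simp add: G_def \<Phi>_def)
  qed
  also have "\<dots> = 2" by (simp add: emeasure_space_1)
  finally have "S m \<le> 2" .
  moreover have "S m = (\<integral>\<^sup>+\<omega>. ennreal (1 + lam) ^ card {j\<in>{..<m}. visit y l (X (real j * h) \<omega>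
    - X 0 \<omega>) (?Y j \<omega>)} \<partial>M)"
    unfolding S_def
  proof (intro nn_integral_cong)
    fix \<omega>
    have "G m (\<lambda>i. ?Y i \<omega>) = (\<Prod>j\<in>{j\<in>{..<m}. visit y l (X (real j * h) \<omega> - X 0 \<omega>) (?Y j \<omega>)}.
      ennreal (1 + lam))"
      unfolding G_def w_def tele by (subst prod.inter_filter[symmetric]) auto
    then show "G m (\<lambda>i. ?Y i \<omega>) * \<Phi> (m - m) (\<Sum>i<m. ?Y i \<omega>) =
      ennreal (1 + lam) ^ card {j\<in>{..<m}. visit y l (X (real j * h) \<omega> - X 0 \<omega>) (?Y j \<omega>)}"
      by (simp add: \<Phi>_def mean_visits_def)
  qed
  ultimately show ?thesis by simp
qed

end

text \<open>The set \<open>S\<close> may fail to be measurable; it is covered by the intersection of events with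
  small probabilities.\<close>
lemma (in prob_space) AE_avoids_if_small:
  assumes "\<And>e. e > 0 \<Longrightarrow> \<exists>U\<in>events. S \<subseteq> U \<and> prob U \<le> e"
  shows "AE \<omega> in M. \<omega> \<notin> S"
proof -
  have "\<forall>n::nat. \<exists>U\<in>events. S \<subseteq> U \<and> prob U \<le> 1 / real (Suc n)" using assms by simp
  then obtain U where U: "\<And>n. U n \<in> events" "\<And>n. S \<subseteq> U n" "\<And>n. prob (U n) \<le> 1 / real (Suc n)"
    by metis
  have I: "(\<Inter>n. U n) \<in> events" using U(1) by auto
  have "prob (\<Inter>n. U n) \<le> 0"
  proof (rule LIMSEQ_le_const)
    show "(\<lambda>n. 1 / real (Suc n)) \<longlonglongrightarrow> 0" using LIMSEQ_inverse_real_of_nat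
      by (simp add: inverse_eq_divide)
    have "prob (\<Inter>n. U n) \<le> 1 / real (Suc n)" for n
      using U(1,3)[of n] by (intro order_trans[OF finite_measure_mono U(3)]) auto
    then show "\<exists>N. \<forall>n\<ge>N. prob (\<Inter>n. U n) \<le> 1 / real (Suc n)" by blast
  qed
  then have "(\<Inter>n. U n) \<in> null_sets M" using I
    by (auto simp: null_sets_def emeasure_eq_measure measure_le_0_iff)
  then have "AE \<omega> in M. \<omega> \<notin> (\<Inter>n. U n)" by (rule AE_not_in)
  then show ?thesis by eventually_elim (use U(2) in auto)
qed

text \<open>The passage from grids to paths. A property \<open>S\<close> of the path implies the discrete event
  \<open>E m\<close> for all large \<open>m\<close>, so it is contained in the lower limit of the \<open>E m\<close>, and bounds that
  are uniform in \<open>m\<close> survive.\<close>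
lemma (in prob_space) eventually_event_superset:
  assumes E: "\<And>m. E m \<in> events" and le: "eventually (\<lambda>m. prob (E m) \<le> c) sequentially"
    and S: "\<And>\<omega>. \<omega> \<in> S \<Longrightarrow> eventually (\<lambda>m. \<omega> \<in> E m) sequentially"
  obtains U where "U \<in> events" "S \<subseteq> U" "prob U \<le> c"
proof (rule that[of "\<Union>k. \<Inter>m\<in>{k..}. E m"])
  obtain m where "prob (E m) \<le> c" using eventually_happens'[OF _ le] by auto
  then have "0 \<le> c" using measure_nonneg order_trans by blast
  have le': "eventually (\<lambda>m. emeasure M (E m) \<le> ennreal c) sequentially"
    using le by eventually_elim (simp add: emeasure_eq_measure ennreal_leI)
  from eventually_event_le(2)[OF E le'] show "prob (\<Union>k::nat. \<Inter>m\<in>{k..}. E m) \<le> c"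
    unfolding emeasure_eq_measure by (simp only: ennreal_le_iff[OF \<open>0 \<le> c\<close>])
  show "(\<Union>k. \<Inter>m\<in>{k..}. E m) \<in> events" by (rule eventually_event_le(1)[OF E le'])
  show "S \<subseteq> (\<Union>k. \<Inter>m\<in>{k..}. E m)"
  proof
    fix \<omega> assume "\<omega> \<in> S"
    then obtain k where "\<And>m. m \<ge> k \<Longrightarrow> \<omega> \<in> E m" using S unfolding eventually_sequentially by blast
    then show "\<omega> \<in> (\<Union>k. \<Inter>m\<in>{k..}. E m)" by blast
  qed
qed

context stable_process
begin

definition visit_const :: "real \<Rightarrow> real" where
  "visit_const T = tail_const * 4 powr \<beta> * (1 + 3 * concentration_const \<beta> * T powr (1 - 1 / \<beta>)
    / (1 - 1 / \<beta>))"

lemma concentration_const_nonneg: "concentration_const b \<ge> 0" by (simp add: concentration_const_def)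

lemma visit_const_pos: "visit_const T > 0"
proof -
  have "3 * concentration_const \<beta> * T powr (1 - 1 / \<beta>) / (1 - 1 / \<beta>) \<ge> 0"
    using \<alpha> concentration_const_nonneg[of \<beta>] by (intro divide_nonneg_nonneg mult_nonneg_nonneg) auto
  moreover have "tail_const > 0" using tail_const_ge_1 by simp
  ultimately show ?thesis unfolding visit_const_def by (intro mult_pos_pos) auto
qed

text \<open>At time \<open>i h\<close> the process is near \<open>y\<close> with probability at most \<open>C l (i h) powr (-1/\<beta>)\<close>,
  and the next increment is large with probability at most \<open>C h l powr -\<beta>\<close>. As \<open>\<beta> > 1\<close>, the
  Riemann sums of \<open>t powr (-1/\<beta>)\<close> over \<open>[0, T]\<close> are bounded, so the total is of order
  \<open>l powr (1 - \<beta>)\<close>. The term \<open>i = 0\<close> contributes \<open>h l powr -\<beta>\<close>, which is of this order for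
  \<open>h \<le> l\<close>.\<close>
lemma mean_visits_le:
  assumes T: "T > 0" and m: "m > 0" and l: "l > 0" "T / real m \<le> l" and k: "k \<le> m"
  shows "mean_visits (T / real m) y l k x \<le> ennreal (visit_const T * l powr (-\<alpha>))"
proof -
  define h where "h = T / real m"
  define s where "s = 1 / \<beta>"
  define K where "K = concentration_const \<beta>"
  have h: "h > 0" "h \<le> l" using T m l by (auto simp: h_def)
  have s: "0 < s" "s < 1" using \<alpha> by (auto simp: s_def)
  have K: "K \<ge> 0" by (simp add: K_def concentration_const_nonneg)
  have p: "emeasure (distr M borel (X h)) {l/4..} \<le> ennreal (tail_const * (h * (l / 4) powr (-\<beta>)))"
  proof -
    have "emeasure (distr M borel (X h)) {l/4..} = emeasure M {\<omega>\<in>space M. X (0 + h) \<omega> - X 0 \<omega> \<ge> l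
      / 4}"
      using h by (subst increment_distr[of 0 h, symmetric])
        (auto simp: emeasure_distr increment_measurable vimage_def Int_def conj_commute)
    also have "\<dots> \<le> emeasure M {\<omega>\<in>space M. \<bar>X (0 + h) \<omega> - X 0 \<omega>\<bar> \<ge> l / 4}"
      using h increment_measurable[of 0 "0 + h"] by (intro emeasure_mono) auto
    also have "\<dots> \<le> ennreal (tail_const * (h * (l / 4) powr (-\<beta>)))"
      unfolding emeasure_eq_measure using h l by (intro ennreal_leI increment_tail) auto
    finally show ?thesis .
  qed
  have q: "near_prob h y l i x \<le> ennreal (3 * l * K * h powr (-s) * real i powr (-s))" if "i \<ge> 1"
    for i
  proof -
    have ih: "real i * h > 0" using that h by simp
    have "near_prob h y l i x = emeasure M {\<omega>\<in>space M. \<bar>X (0 + real i * h) \<omega> - X 0 \<omega> - (y - x)\<bar> \<le>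
      3 * l}"
      unfolding near_prob_def using h
      by (subst nn_integral_indicator) (auto simp: emeasure_distr increment_measurable vimage_def
        Int_def conj_commute algebra_simps intro!: arg_cong[where f = "emeasure M"])
    also have "\<dots> \<le> ennreal (K * (3 * l * (real i * h) powr (-1/\<beta>)))"
      unfolding emeasure_eq_measure K_def using ih l
      by (intro ennreal_leI increment_concentration) auto
    also have "(real i * h) powr (-1/\<beta>) = h powr (-s) * real i powr (-s)"
      by (simp add: s_def powr_mult)
    finally show ?thesis by (simp add: mult_ac)
  qed
  have "(\<Sum>i<k. near_prob h y l i x) \<le> 1 + (\<Sum>i\<in>{1..m}. near_prob h y l i x)"
  proof -
    have "(\<Sum>i<k. near_prob h y l i x) \<le> (\<Sum>i\<in>insert 0 {1..m}. near_prob h y l i x)"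
      using k by (intro sum_mono2) auto
    also have "\<dots> = near_prob h y l 0 x + (\<Sum>i\<in>{1..m}. near_prob h y l i x)" by simp
    also have "near_prob h y l 0 x \<le> 1" by (simp add: near_prob_0)
    finally show ?thesis by (simp add: add_right_mono)
  qed
  also have "(\<Sum>i\<in>{1..m}. near_prob h y l i x) \<le>
    (\<Sum>i\<in>{1..m}. ennreal (3 * l * K * h powr (-s) * real i powr (-s)))"
    by (intro sum_mono q) auto
  also have "\<dots> = ennreal (3 * l * K * h powr (-s) * (\<Sum>i\<in>{1..m}. real i powr (-s)))"
    using l K by (subst sum_ennreal) (auto simp: sum_distrib_left)
  also have "\<dots> \<le> ennreal (3 * l * K * h powr (-s) * (real m powr (1 - s) / (1 - s)))"
    using l K by (intro ennreal_leI mult_left_mono sum_powr_le s) auto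
  also have "3 * l * K * h powr (-s) * (real m powr (1 - s) / (1 - s)) = 3 * l * K * T powr (1 - s)
    / (1 - s) / h"
  proof -
    have "h powr (-s) = h powr (1 - s) / h" using h powr_diff[of h "1 - s" 1] by simp
    moreover have "h powr (1 - s) * real m powr (1 - s) = T powr (1 - s)"
      using m T by (simp add: h_def powr_mult[symmetric])
    ultimately show ?thesis by (simp add: field_simps)
  qed
  finally have sum: "(\<Sum>i<k. near_prob h y l i x) \<le> 1 + ennreal (3 * l * K * T powr (1 - s) / (1 - s)
    / h)"
    by (simp add: add_left_mono)
  define Q where "Q = 3 * K * T powr (1 - s) / (1 - s)"
  have Q: "Q \<ge> 0" using K s by (simp add: Q_def)
  have "mean_visits h y l k x \<le> ennreal (tail_const * (h * (l / 4) powr (-\<beta>)))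
    * (1 + ennreal (l * Q / h))"
    unfolding mean_visits_def using sum by (intro mult_mono p) (auto simp: Q_def mult_ac)
  also have "1 + ennreal (l * Q / h) = ennreal (1 + l * Q / h)"
    using l Q h by (subst ennreal_plus) auto
  also have "ennreal (tail_const * (h * (l / 4) powr (-\<beta>))) * ennreal (1 + l * Q / h) =
    ennreal (tail_const * (h * (l / 4) powr (-\<beta>)) * (1 + l * Q / h))"
    using tail_const_ge_1 h l Q by (intro ennreal_mult[symmetric]) auto
  also have "\<dots> \<le> ennreal (visit_const T * l powr (-\<alpha>))"
  proof (rule ennreal_leI)
    have "(l / 4) powr (-\<beta>) = l powr (-\<beta>) / 4 powr (-\<beta>)" by (rule powr_divide)
    then have e1: "(l / 4) powr (-\<beta>) = 4 powr \<beta> * l powr (-\<beta>)"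
      by (simp only: powr_minus_divide) simp
    have e2: "h * (1 + l * Q / h) = h + l * Q" using h by (simp add: distrib_left)
    have e3: "l powr (-\<beta>) * l = l powr (-\<alpha>)" using l powr_add[of l "-\<beta>" 1] by simp
    have "tail_const * (h * (l / 4) powr (-\<beta>)) * (1 + l * Q / h) = tail_const * 4 powr \<beta>
      * l powr (-\<beta>) * (h * (1 + l * Q / h))"
      unfolding e1 by (simp only: mult_ac)
    also have "\<dots> \<le> tail_const * 4 powr \<beta> * l powr (-\<beta>) * (l * (1 + Q))"
      unfolding e2 using h Q tail_const_ge_1 by (intro mult_left_mono) (auto simp: algebra_simps)
    also have "\<dots> = tail_const * 4 powr \<beta> * (1 + Q) * (l powr (-\<beta>) * l)" by (simp only: mult_ac)
    also have "\<dots> = visit_const T * l powr (-\<alpha>)"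
      unfolding e3 visit_const_def Q_def K_def s_def by (rule refl)
    finally show "tail_const * (h * (l / 4) powr (-\<beta>)) * (1 + l * Q / h) \<le>
      visit_const T * l powr (-\<alpha>)" .
  qed
  finally show ?thesis by (simp add: h_def)
qed

definition visit_count :: "real \<Rightarrow> nat \<Rightarrow> real \<Rightarrow> real \<Rightarrow> 'a \<Rightarrow> nat" where
  "visit_count T m y l \<omega> = card {j\<in>{..<m}. visit y l (X (grid 0 T m j) \<omega> - X 0 \<omega>)
      (X (grid 0 T m (Suc j)) \<omega> - X (grid 0 T m j) \<omega>)}"

lemma visit_count_measurable:
  assumes T: "T > 0"
  shows "visit_count T m y l \<in> measurable M (count_space UNIV)"
proof -
  have "0 \<le> grid 0 T m j" for j using T by (simp add: grid_def)
  then have [measurable]: "random_variable borel (X (grid 0 T m j))" for j by (rule X_measurable)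
  have [measurable]: "random_variable borel (X 0)" by (rule X_measurable) simp
  have "visit_count T m y l = (\<lambda>\<omega>. \<Sum>j<m. if visit y l (X (grid 0 T m j) \<omega> - X 0 \<omega>)
      (X (grid 0 T m (Suc j)) \<omega> - X (grid 0 T m j) \<omega>) then 1 else 0)"
    by (auto simp: visit_count_def fun_eq_iff sum.If_cases Int_def)
  also have "\<dots> \<in> measurable M (count_space UNIV)"
    unfolding visit_def by measurable
  finally show ?thesis .
qed

text \<open>Markov's inequality for the exponential moment.\<close>
lemma visit_count_tail:
  assumes T: "T > 0" and m: "m > 0" and l: "l > 0" "T / real m \<le> l"
  shows "prob {\<omega>\<in>space M. \<kappa> \<le> visit_count T m y l \<omega>} \<le> 2 / (1 + l powr \<alpha> / (2 * visit_const T)) ^ \<kappa>"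
proof -
  define lam where "lam = l powr \<alpha> / (2 * visit_const T)"
  have lam: "lam > 0" using l visit_const_pos[of T] by (simp add: lam_def)
  have small: "ennreal (2 * lam) * mean_visits (T / real m) y l k x \<le> 1" if "k \<le> m" for k x
  proof -
    have "ennreal (2 * lam) * mean_visits (T / real m) y l k x \<le>
      ennreal (2 * lam) * ennreal (visit_const T * l powr (-\<alpha>))"
      by (intro mult_left_mono mean_visits_le T m l that) auto
    also have "\<dots> = ennreal (2 * lam * (visit_const T * l powr (-\<alpha>)))"
      using lam visit_const_pos[of T] by (intro ennreal_mult[symmetric]) auto
    also have "2 * lam * (visit_const T * l powr (-\<alpha>)) = 1"
      using visit_const_pos[of T] l by (simp add: lam_def powr_minus field_simps)
    finally show ?thesis by simp
  qed
  have grid: "grid 0 T m j = real j * (T / real m)" for j by (simp add: grid_def)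
  note [measurable] = visit_count_measurable[OF T]
  have E: "(\<integral>\<^sup>+\<omega>. ennreal (1 + lam) ^ visit_count T m y l \<omega> \<partial>M) \<le> 2"
    unfolding visit_count_def grid using T m lam by (intro exponential_visits small) auto
  have "emeasure M {\<omega>\<in>space M. \<kappa> \<le> visit_count T m y l \<omega>} \<le>
      emeasure M {\<omega>\<in>space M. 1 \<le> ennreal (1 / (1 + lam) ^ \<kappa>) * ennreal
        (1 + lam) ^ visit_count T m y l \<omega>}"
  proof (intro emeasure_mono)
    show "{\<omega>\<in>space M. \<kappa> \<le> visit_count T m y l \<omega>} \<subseteq>
      {\<omega>\<in>space M. 1 \<le> ennreal (1 / (1 + lam) ^ \<kappa>) * ennreal (1 + lam) ^ visit_count T m y l \<omega>}"
    proof safe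
      fix \<omega> assume "\<kappa> \<le> visit_count T m y l \<omega>"
      then have "(1 + lam) ^ \<kappa> \<le> (1 + lam) ^ visit_count T m y l \<omega>" using lam
        by (intro power_increasing) auto
      then have "1 \<le> (1 / (1 + lam) ^ \<kappa>) * (1 + lam) ^ visit_count T m y l \<omega>" using lam
        by (simp add: field_simps)
      then show "1 \<le> ennreal (1 / (1 + lam) ^ \<kappa>) * ennreal (1 + lam) ^ visit_count T m y l \<omega>"
        using lam by (simp add: ennreal_power ennreal_mult[symmetric] del: ennreal_plus)
    qed
  qed measurable
  also have "\<dots> \<le> ennreal (1 / (1 + lam) ^ \<kappa>) * (\<integral>\<^sup>+\<omega>. ennreal (1 + lam) ^ visit_count T m y l \<omega> \<partial>M)"
    using nn_integral_Markov_inequality[of "\<lambda>\<omega>. ennreal (1 + lam) ^ visit_count T m y l \<omega>"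
      "space M" M "ennreal (1 / (1 + lam) ^ \<kappa>)"]
    by (simp cong: nn_integral_cong)
  also have "\<dots> \<le> ennreal (1 / (1 + lam) ^ \<kappa>) * ennreal 2" using E by (intro mult_left_mono) auto
  also have "\<dots> = ennreal (2 / (1 + lam) ^ \<kappa>)" using lam ennreal_mult[of "1 / (1 + lam) ^ \<kappa>" 2]
    by simp
  finally show ?thesis using lam by (simp add: emeasure_eq_measure lam_def ennreal_le_iff)
qed

text \<open>The condition \<open>X 0 = 0\<close> relates the levels \<open>y\<close> to the walk \<open>X - X 0\<close> whose visits are
  counted.\<close>
definition crowded :: "real \<Rightarrow> real \<Rightarrow> real set \<Rightarrow> nat \<Rightarrow> 'a set" where
  "crowded T l Y \<kappa> = {\<omega>\<in>space M. X 0 \<omega> = 0 \<and> (\<exists>y\<in>Y. \<exists>F\<subseteq>{0<..T}. finite F \<and> \<kappa> \<le> card F \<and>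
     (\<forall>t\<in>F. l / 2 < jump_at \<omega> t \<and> \<bar>left_lim (\<lambda>u. X u \<omega>) t - y\<bar> \<le> 2 * l))}"
text \<open>On a fine grid, different jumps occupy different cells, and each of these cells is a
  visit.\<close>
lemma crowding_event:
  assumes T: "T > 0" and l: "l > 0" and Y: "finite Y"
  obtains U where "U \<in> events" "prob U \<le>
    real (card Y) * (2 / (1 + l powr \<alpha> / (2 * visit_const T)) ^ \<kappa>)"
    "crowded T l Y \<kappa> \<subseteq> U"
proof -
  let ?c = "2 / (1 + l powr \<alpha> / (2 * visit_const T)) ^ \<kappa>"
  define E where "E m = (\<Union>y\<in>Y. {\<omega>\<in>space M. \<kappa> \<le> visit_count T m y l \<omega>})" for m
  note [measurable] = visit_count_measurable[OF T]
  have E: "E m \<in> events" for m unfolding E_def using Y by (intro sets.finite_UN) measurable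
  have "eventually (\<lambda>m. dist ((T - 0) / real m) 0 < l) sequentially"
    using tendstoD[OF grid_step_tendsto_0 l] .
  then have le: "eventually (\<lambda>m. prob (E m) \<le> real (card Y) * ?c) sequentially"
    using eventually_gt_at_top[of "0::nat"]
  proof eventually_elim
    case (elim m)
    have "prob (E m) \<le> (\<Sum>y\<in>Y. prob {\<omega>\<in>space M. \<kappa> \<le> visit_count T m y l \<omega>})"
      unfolding E_def by (intro finite_measure_subadditive_finite Y) auto
    also have "\<dots> \<le> (\<Sum>y\<in>Y. ?c)" using elim T l
      by (intro sum_mono visit_count_tail) (auto simp: dist_real_def)
    finally show ?case by simp
  qed
  have inE: "eventually (\<lambda>m. \<omega> \<in> E m) sequentially" if "\<omega> \<in> crowded T l Y \<kappa>" for \<omega>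
  proof -
    let ?x = "\<lambda>u. X u \<omega>"
    from that obtain y F where \<omega>: "\<omega> \<in> space M" "X 0 \<omega> = 0" and y: "y \<in> Y"
      and F: "F \<subseteq> {0<..T}" "finite F" "\<kappa> \<le> card F"
      "\<And>t. t \<in> F \<Longrightarrow> l / 2 < jump ?x t" "\<And>t. t \<in> F \<Longrightarrow> \<bar>left_lim ?x t - y\<bar> \<le> 2 * l"
        unfolding crowded_def by blast
    have x: "cadlag ?x" using \<omega> by (simp add: X_cadlag)
    have "eventually (\<lambda>m. \<forall>t\<in>F. m > 0 \<and> (\<forall>j. grid 0 T m j < t \<and> t \<le> grid 0 T m (Suc j) \<longrightarrow>
           \<bar>?x (grid 0 T m j) - left_lim ?x t\<bar> < l / 8 \<and> \<bar>?x (grid 0 T m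
             (Suc j)) - ?x t\<bar> < l / 8)) sequentially"
      using F(1,2) l x by (intro eventually_ball_finite ballI grid_cell_at_jump) auto
    with grid_injective_on_finite[OF F(2), of 0 T] eventually_gt_at_top[of "0::nat"]
    show ?thesis
    proof eventually_elim
      case (elim m)
      have "\<exists>j<m. grid 0 T m j < t \<and> t \<le> grid 0 T m (Suc j)" if "t \<in> F" for t
        using grid_cell[of 0 t T m] F(1) that elim(2) by (metis greaterThanAtMost_iff subsetD)
      then obtain c where c: "\<And>t. t \<in> F \<Longrightarrow> c t < m \<and> grid 0 T m (c t) < t \<and> t \<le>
        grid 0 T m (Suc (c t))" by metis
      have "inj_on c F"
      proof (rule inj_onI)
        fix s t assume "s \<in> F" "t \<in> F" "c s = c t"
        then show "s = t" using elim(1) c[of s] c[of t] by (metis (no_types))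
      qed
      moreover have "c ` F \<subseteq> {j\<in>{..<m}. visit y l (X (grid 0 T m j) \<omega> - X 0 \<omega>)
          (X (grid 0 T m (Suc j)) \<omega> - X (grid 0 T m j) \<omega>)}"
      proof (intro image_subsetI CollectI conjI)
        fix t assume t: "t \<in> F"
        then show "c t \<in> {..<m}" using c by simp
        have "\<bar>?x (grid 0 T m (c t)) - left_lim ?x t\<bar> < l / 8" "\<bar>?x (grid 0 T m (Suc (c t)))
          - ?x t\<bar> < l / 8"
          using elim(3) t c[OF t] by auto
        then show "visit y l (X (grid 0 T m (c t)) \<omega> - X 0 \<omega>) (X (grid 0 T m (Suc (c t))) \<omega>
          - X (grid 0 T m (c t)) \<omega>)"
          using F(4)[OF t, unfolded jump_def] F(5)[OF t] \<omega>(2) l unfolding visit_def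
          by (intro conjI; linarith)
      qed
      ultimately have "card F \<le> visit_count T m y l \<omega>"
        unfolding visit_count_def by (intro card_inj_on_le[of c]) auto
      then have "\<kappa> \<le> visit_count T m y l \<omega>" using F(3) by simp
      then show ?case using y \<omega>(1) by (auto simp: E_def)
    qed
  qed
  obtain U where "U \<in> events" "crowded T l Y \<kappa> \<subseteq> U" "prob U \<le> real (card Y) * ?c"
    by (rule eventually_event_superset[OF E le inE])
  then show ?thesis by (intro that)
qed

end

section \<open>Jumps of almost every path\<close>

context stable_process
begin

lemma grid_nonneg: "0 \<le> u \<Longrightarrow> u < w \<Longrightarrow> 0 \<le> grid u w m j"
  unfolding grid_def by (intro add_nonneg_nonneg mult_nonneg_nonneg divide_nonneg_nonneg) auto

lemma grid_increment_tail:
  assumes "0 \<le> u" "u < w" "m > 0" "a > 0"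
  shows "prob {\<omega>\<in>space M. X (grid u w m (Suc j)) \<omega> - X (grid u w m j) \<omega> \<ge> a} \<le>
    tail_const * ((w - u) / real m * a powr (-\<beta>))"
proof -
  let ?s = "grid u w m j" let ?h = "(w - u) / real m"
  have s: "?s \<ge> 0" "?h \<ge> 0" using assms grid_nonneg by auto
  have "prob {\<omega>\<in>space M. X (?s + ?h) \<omega> - X ?s \<omega> \<ge> a} \<le>
    prob {\<omega>\<in>space M. \<bar>X (?s + ?h) \<omega> - X ?s \<omega>\<bar> \<ge> a}"
    using s increment_measurable[of ?s "?s + ?h"] by (intro finite_measure_mono) auto
  also have "\<dots> \<le> tail_const * (?h * a powr (-\<beta>))" using s assms by (intro increment_tail) auto
  finally show ?thesis by (simp add: grid_Suc)
qed

lemma grid_increment_event: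
  assumes "0 \<le> u" "u < w" "B \<in> sets borel"
  shows "{\<omega>\<in>space M. X (grid u w m (Suc j)) \<omega> - X (grid u w m j) \<omega> \<in> B} \<in> events"
proof -
  let ?f = "\<lambda>\<omega>. X (grid u w m (Suc j)) \<omega> - X (grid u w m j) \<omega>"
  have "?f -` B \<inter> space M \<in> events"
    by (intro measurable_sets[OF _ assms(3)] increment_measurable grid_nonneg assms)
  moreover have "{\<omega>\<in>space M. ?f \<omega> \<in> B} = ?f -` B \<inter> space M" by auto
  ultimately show ?thesis by simp
qed

text \<open>On a fine grid, the increment of the cell that contains the jump is at least \<open>a / 2\<close>; the
  tail bound is linear in the length of a cell and can be summed.\<close>
lemma jump_event:
  assumes u: "0 \<le> u" "u < w" and a: "a > 0"
  obtains U where "U \<in> events" "prob U \<le> tail_const * ((w - u) * (a / 2) powr (-\<beta>))"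
    "{\<omega>\<in>space M. \<exists>t\<in>{u<..w}. a \<le> jump_at \<omega> t} \<subseteq> U"
proof -
  let ?S = "{\<omega>\<in>space M. \<exists>t\<in>{u<..w}. a \<le> jump_at \<omega> t}"
  define E where "E m = (\<Union>j<m. {\<omega>\<in>space M. X (grid u w m (Suc j)) \<omega>
    - X (grid u w m j) \<omega> \<in> {a/2..}})" for m
  have E: "E m \<in> events" for m unfolding E_def using u
    by (intro sets.finite_UN grid_increment_event) auto
  have le: "eventually (\<lambda>m. prob (E m) \<le> tail_const * ((w - u) * (a / 2) powr (-\<beta>))) sequentially"
    using eventually_gt_at_top[of "0::nat"]
  proof eventually_elim
    case (elim m)
    have "prob (E m) \<le> (\<Sum>j<m. prob {\<omega>\<in>space M. X (grid u w m (Suc j)) \<omega>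
      - X (grid u w m j) \<omega> \<in> {a/2..}})"
      unfolding E_def using u by (intro finite_measure_subadditive_finite image_subsetI
        grid_increment_event) auto
    also have "\<dots> \<le> (\<Sum>j<m. tail_const * ((w - u) / real m * (a / 2) powr (-\<beta>)))"
    proof (intro sum_mono)
      fix j
      have "{\<omega>\<in>space M. X (grid u w m (Suc j)) \<omega> - X (grid u w m j) \<omega> \<in> {a/2..}}
          = {\<omega>\<in>space M. X (grid u w m (Suc j)) \<omega> - X (grid u w m j) \<omega> \<ge> a/2}" by auto
      then show "prob {\<omega>\<in>space M. X (grid u w m (Suc j)) \<omega> - X (grid u w m j) \<omega> \<in> {a/2..}}
          \<le> tail_const * ((w - u) / real m * (a / 2) powr (-\<beta>))"
        using grid_increment_tail[OF u, of m "a/2" j] elim a by simp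
    qed
    also have "\<dots> = tail_const * ((w - u) * (a / 2) powr (-\<beta>))" using elim by (simp add: field_simps)
    finally show ?case .
  qed
  have inE: "eventually (\<lambda>m. \<omega> \<in> E m) sequentially" if "\<omega> \<in> ?S" for \<omega>
  proof -
    from that obtain t where \<omega>: "\<omega> \<in> space M" and t: "u < t" "t \<le> w" "a \<le> jump_at \<omega> t" by auto
    have "eventually (\<lambda>m. m > 0 \<and> (\<forall>j. grid u w m j < t \<and> t \<le> grid u w m (Suc j) \<longrightarrow>
           \<bar>X (grid u w m j) \<omega> - left_lim (\<lambda>u. X u \<omega>) t\<bar> < a / 4 \<and> \<bar>X (grid u w m
             (Suc j)) \<omega> - X t \<omega>\<bar> < a / 4)) sequentially"
      using u t a \<omega> by (intro grid_cell_at_jump X_cadlag) auto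
    then show ?thesis
    proof eventually_elim
      case (elim m)
      obtain j where j: "j < m" "grid u w m j < t" "t \<le> grid u w m (Suc j)"
        using grid_cell[OF t(1,2), of m] elim by auto
      have "\<bar>X (grid u w m j) \<omega> - left_lim (\<lambda>u. X u \<omega>) t\<bar> < a / 4" "\<bar>X (grid u w m (Suc j)) \<omega>
        - X t \<omega>\<bar> < a / 4"
        using elim j by auto
      then have "X (grid u w m (Suc j)) \<omega> - X (grid u w m j) \<omega> \<ge> a / 2"
        using t(3) unfolding jump_def by linarith
      then show ?case using j \<omega> by (auto simp: E_def)
    qed
  qed
  obtain U where "U \<in> events" "?S \<subseteq> U" "prob U \<le> tail_const * ((w - u) * (a / 2) powr (-\<beta>))"
    by (rule eventually_event_superset[OF E le inE])
  then show ?thesis by (intro that)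
qed

text \<open>The jump would lie in \<open>(T - d, T]\<close> for every \<open>d\<close>.\<close>
lemma no_jump_at_fixed_time:
  assumes T: "T > 0"
  shows "AE \<omega> in M. jump_at \<omega> T \<le> 0"
proof -
  have "AE \<omega> in M. \<omega> \<notin> {\<omega>\<in>space M. 1 / real (Suc n) \<le> jump_at \<omega> T}" for n
  proof (rule AE_avoids_if_small)
    fix e :: real assume e: "e > 0"
    define a where "a = 1 / real (Suc n)"
    define C where "C = tail_const * (a / 2) powr (-\<beta>)"
    have C: "C > 0" using tail_const_ge_1 by (auto simp: C_def a_def intro!: mult_pos_pos)
    define d where "d = min (T / 2) (e / C)"
    have d: "d > 0" "d < T" "C * d \<le> e" using T e C by (auto simp: d_def min_def field_simps)
    obtain U where U: "U \<in> events" "prob U \<le> tail_const * ((T - (T - d)) * (a / 2) powr (-\<beta>))"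
      "{\<omega>\<in>space M. \<exists>t\<in>{T-d<..T}. a \<le> jump_at \<omega> t} \<subseteq> U"
      using d by (elim jump_event[of "T - d" T a, rotated 3]) (auto simp: a_def)
    have "prob U \<le> e" using U(2) d(3) by (simp add: C_def mult_ac)
    moreover have "T \<in> {T-d<..T}" using d by simp
    then have "{\<omega>\<in>space M. 1 / real (Suc n) \<le> jump_at \<omega> T} \<subseteq> U" using U(3) unfolding a_def by blast
    ultimately show "\<exists>U\<in>events. {\<omega>\<in>space M. 1 / real (Suc n) \<le> jump_at \<omega> T} \<subseteq> U \<and> prob U \<le> e"
      using U(1) by blast
  qed
  then have "AE \<omega> in M. \<forall>n. \<omega> \<notin> {\<omega>\<in>space M. 1 / real (Suc n) \<le> jump_at \<omega> T}"
    by (simp add: AE_all_countable)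
  then show ?thesis using AE_space
  proof eventually_elim
    case (elim \<omega>)
    show ?case
    proof (rule ccontr)
      assume "\<not> ?thesis"
      then obtain n where "inverse (real (Suc n)) < jump_at \<omega> T" using reals_Archimedean
        by (metis not_le)
      then show False using elim by (auto simp: inverse_eq_divide dest: less_imp_le)
    qed
  qed
qed

lemma lower_tail:
  obtains w1 c where "w1 > 0" "c > 0"
    "\<And>s h a. s \<ge> 0 \<Longrightarrow> h \<ge> 0 \<Longrightarrow> a > 0 \<Longrightarrow> h * a powr (-\<beta>) \<le> w1 \<Longrightarrow>
       c * (h * a powr (-\<beta>)) \<le> prob {\<omega>\<in>space M. X (s + h) \<omega> - X s \<omega> > a}"
proof -
  have b: "1 < \<beta>" "\<beta> < 2" using \<alpha> by auto
  show ?thesis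
  proof (rule laplace_lower_tail[OF b, where 'a = 'a])
    fix w1 c :: real
    assume w: "w1 > 0" "c > 0" and *: "\<And>(M::'a measure) Y h a. prob_space M \<Longrightarrow>
      Y \<in> borel_measurable M \<Longrightarrow>
       (\<And>\<eta>. \<eta> \<ge> 0 \<Longrightarrow> has_bochner_integral M (\<lambda>\<omega>. exp (- \<eta> * Y \<omega>)) (exp (h * \<eta> powr \<beta>))) \<Longrightarrow>
       h \<ge> 0 \<Longrightarrow> a > 0 \<Longrightarrow> h * a powr (-\<beta>) \<le> w1 \<Longrightarrow>
       c * (h * a powr (-\<beta>)) \<le> measure M {\<omega>\<in>space M. Y \<omega> > a}"
    show thesis
      by (rule that[OF w]) (intro * prob_space_axioms increment_measurable increment_laplace; simp)
  qed
qed

text \<open>If there is no jump, then for each \<open>a > 0\<close> all increments on a fine grid are at most \<open>a\<close>.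
  By independence and the lower tail bound this has probability at most
  \<open>exp (- c (w - u) a powr -\<beta>)\<close>, which tends to 0 as \<open>a\<close> does.\<close>
lemma jump_in_every_interval:
  assumes u: "0 \<le> u" "u < w"
  shows "AE \<omega> in M. \<exists>t\<in>{u<..w}. 0 < jump_at \<omega> t"
proof -
  obtain w1 c where wc: "w1 > 0" "c > 0"
    "\<And>s h a. s \<ge> 0 \<Longrightarrow> h \<ge> 0 \<Longrightarrow> a > 0 \<Longrightarrow> h * a powr (-\<beta>) \<le> w1 \<Longrightarrow>
       c * (h * a powr (-\<beta>)) \<le> prob {\<omega>\<in>space M. X (s + h) \<omega> - X s \<omega> > a}" using lower_tail by blast
  let ?S = "{\<omega>\<in>space M. \<not> (\<exists>t\<in>{u<..w}. 0 < jump_at \<omega> t)}"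
  have small: "\<exists>U\<in>events. ?S \<subseteq> U \<and> prob U \<le> exp (- (c * (w - u) * a powr (-\<beta>)))" if a: "a > 0" for a
  proof -
    define E where "E m = (\<Inter>j\<in>{..<m}. (\<lambda>\<omega>. X (grid u w m (Suc j)) \<omega> - X (grid u w m j) \<omega>) -` {..a} \<inter>
      space M) \<inter> space M" for m
    have E: "E m \<in> events" for m
    proof -
      have "{\<omega>\<in>space M. \<forall>j\<in>{..<m}. X (grid u w m (Suc j)) \<omega> - X (grid u w m j) \<omega> \<in> {..a}} \<in> events"
        using u by (intro sets.sets_Collect_finite_All grid_increment_event) auto
      moreover have "E m = {\<omega>\<in>space M. \<forall>j\<in>{..<m}. X (grid u w m (Suc j)) \<omega>
        - X (grid u w m j) \<omega> \<in> {..a}}"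
        by (auto simp: E_def)
      ultimately show ?thesis by simp
    qed
    have "((\<lambda>m. (w - u) / real m * a powr (-\<beta>)) \<longlonglongrightarrow> 0 * a powr (-\<beta>))"
      by (intro tendsto_intros grid_step_tendsto_0)
    then have "eventually (\<lambda>m. (w - u) / real m * a powr (-\<beta>) < w1) sequentially" using wc(1)
      by (intro order_tendstoD) auto
    then have le: "eventually (\<lambda>m. prob (E m) \<le> exp (- (c * (w - u) * a powr (-\<beta>)))) sequentially"
      using eventually_gt_at_top[of "0::nat"]
    proof eventually_elim
      case (elim m)
      let ?h = "(w - u) / real m"
      let ?Y = "\<lambda>j \<omega>. X (grid u w m (Suc j)) \<omega> - X (grid u w m j) \<omega>"
      have h: "?h \<ge> 0" using u by simp
      have iv: "indep_vars (\<lambda>_. borel) ?Y {..<m}"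
        using u elim by (intro increments_indep) (auto simp: grid_mono)
      have "E m = (\<Inter>j\<in>{..<m}. ?Y j -` {..a} \<inter> space M)" using elim by (auto simp: E_def)
      then have "prob (E m) = (\<Prod>j<m. prob (?Y j -` {..a} \<inter> space M))"
        using indep_varsD[OF iv, of "{..<m}" "\<lambda>_. {..a}"] elim by (auto simp: lessThan_empty_iff)
      also have "\<dots> \<le> (\<Prod>j<m. exp (- (c * (?h * a powr (-\<beta>)))))"
      proof (intro prod_mono conjI)
        fix j assume "j \<in> {..<m}"
        have s: "grid u w m j \<ge> 0" using u by (simp add: grid_nonneg)
        have ev: "{\<omega>\<in>space M. ?Y j \<omega> > a} \<in> events"
          using grid_increment_event[OF u, of "{a<..}" m j] by simp
        have "?Y j -` {..a} \<inter> space M = space M - {\<omega>\<in>space M. ?Y j \<omega> > a}" by auto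
        then have "prob (?Y j -` {..a} \<inter> space M) = 1 - prob {\<omega>\<in>space M. ?Y j \<omega> > a}"
          using prob_compl[OF ev] by simp
        also have "\<dots> \<le> 1 - c * (?h * a powr (-\<beta>))"
          using wc(3)[OF s h a] elim by (simp add: grid_Suc)
        also have "\<dots> \<le> exp (- (c * (?h * a powr (-\<beta>))))"
          using exp_ge_add_one_self[of "- (c * (?h * a powr (-\<beta>)))"] by simp
        finally show "prob (?Y j -` {..a} \<inter> space M) \<le> exp (- (c * (?h * a powr (-\<beta>))))" .
      qed simp
      also have "\<dots> = exp (- (c * (w - u) * a powr (-\<beta>)))"
        using elim by (simp add: exp_of_nat_mult[symmetric])
      finally show ?case .
    qed
    have inE: "eventually (\<lambda>m. \<omega> \<in> E m) sequentially" if "\<omega> \<in> ?S" for \<omega>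
    proof -
      from that have \<omega>: "\<omega> \<in> space M" "\<And>t. u < t \<Longrightarrow> t \<le> w \<Longrightarrow> \<not> 0 < jump_at \<omega> t" by auto
      from grid_increment_localises_jump[OF X_cadlag[OF \<omega>(1)] u a] eventually_gt_at_top[of "0::nat"]
      show ?thesis
      proof eventually_elim
        case (elim m)
        have "X (grid u w m (Suc j)) \<omega> - X (grid u w m j) \<omega> \<le> a" if j: "j < m" for j
        proof (rule ccontr)
          assume "\<not> ?thesis"
          then obtain t where t: "grid u w m j < t" "t \<le> grid u w m (Suc j)" "a \<le> jump_at \<omega> t"
            using elim(1) j by force
          have "u \<le> grid u w m j" "grid u w m (Suc j) \<le> w"
            using grid_le[OF u(2) elim(2), of 0 j] grid_le[OF u(2) elim(2), of "Suc j" m] j elim(2)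
            by auto
          then show False using \<omega>(2)[of t] t a by auto
        qed
        then show ?case using \<omega>(1) by (auto simp: E_def)
      qed
    qed
    obtain U where "U \<in> events" "?S \<subseteq> U" "prob U \<le> exp (- (c * (w - u) * a powr (-\<beta>)))"
      by (rule eventually_event_superset[OF E le inE])
    then show ?thesis by blast
  qed
  have "AE \<omega> in M. \<omega> \<notin> ?S"
  proof (rule AE_avoids_if_small)
    fix e :: real assume e: "e > 0"
    \<comment> \<open>The level \<open>a\<close> below satisfies \<open>a powr -\<beta> = r\<close>.\<close>
    define r where "r = max 1 (- ln e / (c * (w - u)))"
    define a where "a = r powr (-1/\<beta>)"
    have r: "r > 0" by (simp add: r_def)
    have a: "a > 0" using r by (simp add: a_def)
    have inv: "(-1/b) * (-b) = 1" if "b \<noteq> 0" for b :: real using that by simp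
    have "a powr (-\<beta>) = r powr ((-1/\<beta>) * (-\<beta>))" unfolding a_def by (rule powr_powr)
    also have "\<dots> = r powr 1" by (subst inv) (use \<alpha> in auto)
    finally have a': "a powr (-\<beta>) = r" using r by simp
    have cw: "c * (w - u) > 0" using wc u by simp
    have "- ln e / (c * (w - u)) \<le> r" by (simp add: r_def)
    then have "- ln e \<le> r * (c * (w - u))" unfolding pos_divide_le_eq[OF cw] .
    then have "- ln e \<le> c * (w - u) * r" by (simp only: mult.commute)
    then have "exp (- (c * (w - u) * a powr (-\<beta>))) \<le> exp (ln e)" unfolding a' by simp
    then have "exp (- (c * (w - u) * a powr (-\<beta>))) \<le> e" using e by simp
    then show "\<exists>U\<in>events. ?S \<subseteq> U \<and> prob U \<le> e" using small[OF a] by (meson order_trans)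
  qed
  then show ?thesis using AE_space by eventually_elim auto
qed

text \<open>Let \<open>V\<close> be the set of the probabilities for all admissible \<open>r\<close>, \<open>J\<close>, \<open>\<delta>\<close>. Given one of
  them, \<open>v\<close>, an additional early time \<open>u\<close> is inserted and the other times are shifted by \<open>u\<close>. At
  time \<open>u\<close> the process exceeds a level of order \<open>u powr (1/\<beta>)\<close> with a probability \<open>p\<close> that does
  not depend on \<open>u\<close>, which by independence multiplies \<open>v\<close> by at most \<open>1 - p\<close>, up to an error
  from large values of \<open>\<bar>X u\<bar>\<close> that vanishes as \<open>u\<close> tends to 0. So \<open>Inf V \<le> (1 - p) v\<close> for all
  \<open>v\<close> in \<open>V\<close>, and \<open>Inf V = 0\<close>.\<close>
lemma stays_below_small:
  assumes \<sigma>: "\<sigma> > 0" and e: "e > 0"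
  obtains r J \<delta> where "J > 0" "r 0 = 0" "\<And>i. i < J \<Longrightarrow> r i < r (Suc i)" "r J < \<sigma>" "\<delta> > 0"
    "prob (stays_below r J \<delta> 0) < e"
proof -
  define V where "V = {prob (stays_below r J \<delta> 0) | r J \<delta>. J > 0 \<and> r 0 = 0 \<and>
    (\<forall>i<J. r i < r (Suc i)) \<and> r J < \<sigma> \<and> \<delta> > 0}"
  have ne: "V \<noteq> {}"
  proof -
    have "prob (stays_below (\<lambda>i. real i * \<sigma> / 2) 1 1 0) \<in> V"
      unfolding V_def using \<sigma> by (intro CollectI exI[of _ "\<lambda>i. real i * \<sigma> / 2"] exI[of _ 1]) auto
    then show ?thesis by blast
  qed
  have bdd: "bdd_below V" by (rule bdd_belowI[of _ 0]) (auto simp: V_def)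
  have nonneg: "Inf V \<ge> 0" by (rule cInf_greatest[OF ne]) (auto simp: V_def)
  obtain w1 c where wc: "w1 > 0" "c > 0"
    "\<And>s h a. s \<ge> 0 \<Longrightarrow> h \<ge> 0 \<Longrightarrow> a > 0 \<Longrightarrow> h * a powr (-\<beta>) \<le> w1 \<Longrightarrow>
       c * (h * a powr (-\<beta>)) \<le> prob {\<omega>\<in>space M. X (s + h) \<omega> - X s \<omega> > a}" using lower_tail by blast
  define p where "p = c * w1"
  have p: "p > 0" using wc by (simp add: p_def)
  have contract: "Inf V \<le> (1 - p) * v" if v: "v \<in> V" for v
  proof -
    from v obtain r J \<delta> where r: "v = prob (stays_below r J \<delta> 0)" "J > 0" "r 0 = 0" "\<And>i. i < J \<Longrightarrow>
      r i < r (Suc i)" "r J < \<sigma>" "\<delta> > 0"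
      by (auto simp: V_def)
    define C where "C = tail_const * (\<delta> / 2) powr (-\<beta>)"
    have C: "C > 0" using r(6) tail_const_ge_1 by (simp add: C_def)
    have step: "Inf V \<le> (1 - p) * v + C * u" if u: "0 < u" "u < \<sigma> - r J" for u
    proof -
      \<comment> \<open>With this level \<open>u * a powr -\<beta> = w1\<close>, so the lower tail bound does not depend on \<open>u\<close>.\<close>
      define a where "a = (u / w1) powr (1 / \<beta>)"
      have a: "a > 0" using u wc by (simp add: a_def)
      have "a powr (-\<beta>) = (u / w1) powr ((1 / \<beta>) * (-\<beta>))" unfolding a_def by (rule powr_powr)
      also have "(1 / \<beta>) * (-\<beta>) = -1" using \<alpha> by (simp add: field_simps)
      finally have a': "u * a powr (-\<beta>) = w1" using u wc by (simp add: powr_minus_divide)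
      define r' where "r' i = (case i of 0 \<Rightarrow> 0 | Suc j \<Rightarrow> u + r j)" for i
      define \<delta>' where "\<delta>' = min a (\<delta> / 2)"
      have inV: "prob (stays_below r' (Suc J) \<delta>' 0) \<in> V"
        unfolding V_def using r u a
        by (intro CollectI exI[of _ r'] exI[of _ "Suc J"] exI[of _ \<delta>'])
          (auto simp: r'_def \<delta>'_def split: nat.split)
      have Bm: "{..a} \<in> sets borel" by simp
      note fac = increment_then_stays_below[OF order_refl u(1) r(3,4,2) Bm, where \<delta> = \<delta>]
      let ?A = "{\<omega>\<in>space M. X u \<omega> - X 0 \<omega> \<in> {..a} \<and> \<omega> \<in> stays_below r J \<delta> u}"
      let ?B = "{\<omega>\<in>space M. \<bar>X (0 + u) \<omega> - X 0 \<omega>\<bar> \<ge> \<delta> / 2}"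
      have [measurable]: "random_variable borel (\<lambda>\<omega>. X (0 + u) \<omega> - X 0 \<omega>)" using u
        by (intro increment_measurable) auto
      have Be: "?B \<in> events" by measurable
      have "stays_below r' (Suc J) \<delta>' 0 \<subseteq> ?A \<union> ?B"
      proof
        fix \<omega> assume "\<omega> \<in> stays_below r' (Suc J) \<delta>' 0"
        then have \<omega>: "\<omega> \<in> space M" "\<And>j. j \<le> J \<Longrightarrow> X (u + r j) \<omega> - X 0 \<omega> \<le> \<delta>'"
          unfolding stays_below_def r'_def by (auto dest: spec[of _ "Suc _"])
        have "X u \<omega> - X 0 \<omega> \<le> a" using \<omega>(2)[of 0] r(3) by (simp add: \<delta>'_def)
        moreover have "X (u + r j) \<omega> - X u \<omega> \<le> \<delta>" if "\<omega> \<notin> ?B" "j \<le> J" for j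
        proof -
          have "\<bar>X u \<omega> - X 0 \<omega>\<bar> < \<delta> / 2" using that(1) \<omega>(1) by auto
          moreover have "X (u + r j) \<omega> - X 0 \<omega> \<le> \<delta> / 2" using \<omega>(2)[OF that(2)] by (simp add: \<delta>'_def)
          ultimately show ?thesis by linarith
        qed
        ultimately show "\<omega> \<in> ?A \<union> ?B" using \<omega>(1) unfolding stays_below_def by blast
      qed
      then have "prob (stays_below r' (Suc J) \<delta>' 0) \<le> prob (?A \<union> ?B)" using fac(1) Be
        by (intro finite_measure_mono) auto
      also have "\<dots> \<le> prob ?A + prob ?B" using fac(1) Be by (rule measure_Un_le)
      finally have le: "prob (stays_below r' (Suc J) \<delta>' 0) \<le> prob ?A + prob ?B" .
      have "prob {\<omega>\<in>space M. X u \<omega> - X 0 \<omega> \<in> {..a}} \<le> 1 - p"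
      proof -
        have ev: "{\<omega>\<in>space M. X (0 + u) \<omega> - X 0 \<omega> > a} \<in> events" by measurable
        have "{\<omega>\<in>space M. X u \<omega> - X 0 \<omega> \<in> {..a}} = space M - {\<omega>\<in>space M. X (0 + u) \<omega> - X 0 \<omega> > a}"
          by auto
        then have "prob {\<omega>\<in>space M. X u \<omega> - X 0 \<omega> \<in> {..a}} =
          1 - prob {\<omega>\<in>space M. X (0 + u) \<omega> - X 0 \<omega> > a}"
          using prob_compl[OF ev] by simp
        moreover have "p \<le> prob {\<omega>\<in>space M. X (0 + u) \<omega> - X 0 \<omega> > a}"
          using wc(3)[of 0 u a] u a a' by (simp add: p_def)
        ultimately show ?thesis by simp
      qed
      then have "prob {\<omega>\<in>space M. X u \<omega> - X 0 \<omega> \<in> {..a}} * prob (stays_below r J \<delta> 0) \<le>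
        (1 - p) * prob (stays_below r J \<delta> 0)"
        by (rule mult_right_mono) simp
      moreover have "prob ?A = prob {\<omega>\<in>space M. X u \<omega> - X 0 \<omega> \<in> {..a}} * prob (stays_below r J \<delta> 0)"
        by (rule increment_then_stays_below(2)[OF order_refl u(1) r(3,4,2) Bm])
      ultimately have "prob ?A \<le> (1 - p) * v" unfolding r(1) by linarith
      moreover have "prob ?B \<le> C * u" using increment_tail[of 0 u "\<delta>/2"] u r(6)
        by (simp add: C_def mult_ac)
      ultimately have "prob (stays_below r' (Suc J) \<delta>' 0) \<le> (1 - p) * v + C * u" using le
        by linarith
      moreover have "Inf V \<le> prob (stays_below r' (Suc J) \<delta>' 0)" by (rule cInf_lower[OF inV bdd])
      ultimately show ?thesis by linarith
    qed
    show ?thesis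
    proof (rule field_le_epsilon)
      fix \<epsilon> :: real assume \<epsilon>: "\<epsilon> > 0"
      define u where "u = min ((\<sigma> - r J) / 2) (\<epsilon> / C)"
      have u: "0 < u" "u < \<sigma> - r J" "u \<le> \<epsilon> / C"
    proof -
      have "u \<le> (\<sigma> - r J) / 2" unfolding u_def by (rule min.cobounded1)
      moreover have "y < z" if "z > 0" "y \<le> z / 2" for y z :: real using that by simp
      ultimately show "u < \<sigma> - r J" using r(5) by simp
      show "0 < u" "u \<le> \<epsilon> / C" using \<epsilon> C r(5) by (auto simp: u_def)
    qed
      then have "C * u \<le> \<epsilon>" using C by (simp add: field_simps)
      then show "Inf V \<le> (1 - p) * v + \<epsilon>" using step[OF u(1,2)] by linarith
    qed
  qed
  have "Inf V \<le> 0"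
  proof (cases "1 - p > 0")
    case True
    have "Inf V / (1 - p) \<le> Inf V"
      by (rule cInf_greatest[OF ne]) (use contract True in \<open>auto simp: field_simps\<close>)
    then have "p * Inf V \<le> 0" using True by (simp add: field_simps)
    then show ?thesis using p by (simp add: mult_le_0_iff)
  next
    case False
    obtain v where "v \<in> V" using ne by blast
    then have "Inf V \<le> (1 - p) * v" "v \<ge> 0" using contract by (auto simp: V_def)
    then show ?thesis using False by (smt (verit) mult_nonpos_nonneg)
  qed
  then have "Inf V < e" using e by linarith
  then obtain v where "v \<in> V" "v < e" using cInf_lessD[OF ne] by blast
  then show ?thesis using that by (auto simp: V_def)
qed

text \<open>If the jump at \<open>t\<close> is not exceeded up to time \<open>w + \<sigma>\<close>, then on a fine grid some increment
  is at least \<open>a / 2\<close> and the process stays below a small level afterwards. The expected number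
  of such increments is bounded as the grid is refined, and the probability of the second
  condition is arbitrarily small.\<close>
lemma jump_is_overtaken_aux:
  assumes T: "w > 0" "\<sigma> > 0" and a: "a > 0"
  shows "AE \<omega> in M. \<omega> \<notin> {\<omega>\<in>space M. \<exists>t\<in>{0<..w}. a \<le> jump_at \<omega> t \<and> (\<forall>s\<in>{t<..<w+\<sigma>}. X s \<omega> \<le> X t \<omega>)}"
    (is "AE \<omega> in M. \<omega> \<notin> ?S")
proof (rule AE_avoids_if_small)
  fix e :: real assume e: "e > 0"
  define C where "C = tail_const * (w * (a / 2) powr (-\<beta>))"
  have C: "C > 0" using T a tail_const_ge_1 by (simp add: C_def)
  obtain r J \<delta> where r: "J > 0" "r 0 = 0" "\<And>i. i < J \<Longrightarrow> r i < r (Suc i)" "r J < \<sigma>" "\<delta> > 0"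
    "prob (stays_below r J \<delta> 0) < e / C"
    by (rule stays_below_small[OF T(2), of "e / C"]) (use e C in auto)
  define A where "A m j = {\<omega>\<in>space M. X (grid 0 w m (Suc j)) \<omega> - X (grid 0 w m j) \<omega> \<in> {a/2..} \<and>
    \<omega> \<in> stays_below r J \<delta> (grid 0 w m (Suc j))}" for m j
  define E where "E m = (if m = 0 then {} else (\<Union>j<m. A m j))" for m
  have Ae: "A m j \<in> events" "prob (A m j) = prob {\<omega>\<in>space M. X (grid 0 w m (Suc j)) \<omega>
    - X (grid 0 w m j) \<omega> \<in> {a/2..}} * prob (stays_below r J \<delta> 0)"
    if m: "m > 0" for m j
  proof -
    have g: "0 \<le> grid 0 w m j" "grid 0 w m j < grid 0 w m (Suc j)" using T(1) m
      by (auto simp: grid_nonneg grid_mono)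
    show "A m j \<in> events" "prob (A m j) = prob {\<omega>\<in>space M. X (grid 0 w m (Suc j)) \<omega>
      - X (grid 0 w m j) \<omega> \<in> {a/2..}} * prob (stays_below r J \<delta> 0)"
      unfolding A_def by (rule increment_then_stays_below[OF g r(2,3,1)]; simp)+
  qed
  have E: "E m \<in> events" for m unfolding E_def using Ae by auto
  have le: "eventually (\<lambda>m. prob (E m) \<le> e) sequentially"
    using eventually_gt_at_top[of "0::nat"]
  proof eventually_elim
    case (elim m)
    have "E m = (\<Union>j<m. A m j)" using elim by (simp add: E_def)
    then have "prob (E m) \<le> (\<Sum>j<m. prob (A m j))"
      by (simp only:) (intro finite_measure_subadditive_finite image_subsetI Ae(1) elim
        finite_lessThan)
    also have "\<dots> \<le> (\<Sum>j<m. (C / real m) * (e / C))"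
    proof (rule sum_mono)
      fix j
      have "{\<omega>\<in>space M. X (grid 0 w m (Suc j)) \<omega> - X (grid 0 w m j) \<omega> \<in> {a/2..}} =
        {\<omega>\<in>space M. X (grid 0 w m (Suc j)) \<omega> - X (grid 0 w m j) \<omega> \<ge> a/2}" by auto
      then have "prob {\<omega>\<in>space M. X (grid 0 w m (Suc j)) \<omega> - X (grid 0 w m j) \<omega> \<in> {a/2..}} \<le>
        C / real m"
        using grid_increment_tail[of 0 w m "a/2" j] T a elim by (simp add: C_def)
      then show "prob (A m j) \<le> (C / real m) * (e / C)"
        unfolding Ae(2)[OF elim] using r(6) C elim by (intro mult_mono) auto
    qed
    also have "\<dots> = e" using elim C by simp
    finally show ?case .
  qed
  have inE: "eventually (\<lambda>m. \<omega> \<in> E m) sequentially" if "\<omega> \<in> ?S" for \<omega>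
  proof -
    from that obtain t where \<omega>: "\<omega> \<in> space M" and t: "0 < t" "t \<le> w" "a \<le> jump_at \<omega> t"
      "\<And>s. t < s \<Longrightarrow> s < w + \<sigma> \<Longrightarrow> X s \<omega> \<le> X t \<omega>" by auto
    define d where "d = min \<delta> (a / 4)"
    have d: "d > 0" "d \<le> \<delta>" "d \<le> a / 4" using r(5) a by (auto simp: d_def)
    have "eventually (\<lambda>m. m > 0 \<and> (\<forall>j. grid 0 w m j < t \<and> t \<le> grid 0 w m (Suc j) \<longrightarrow>
           \<bar>X (grid 0 w m j) \<omega> - left_lim (\<lambda>u. X u \<omega>) t\<bar> < d \<and> \<bar>X (grid 0 w m
             (Suc j)) \<omega> - X t \<omega>\<bar> < d)) sequentially"
      using t d \<omega> by (intro grid_cell_at_jump X_cadlag) auto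
    then show ?thesis
    proof eventually_elim
      case (elim m)
      then have m: "m > 0" by simp
      obtain j where j: "j < m" "grid 0 w m j < t" "t \<le> grid 0 w m (Suc j)"
        using grid_cell[OF t(1,2) m] .
      have near: "\<bar>X (grid 0 w m j) \<omega> - left_lim (\<lambda>u. X u \<omega>) t\<bar> < d" "\<bar>X (grid 0 w m (Suc j)) \<omega>
        - X t \<omega>\<bar> < d"
        using elim j by auto
      have inc: "X (grid 0 w m (Suc j)) \<omega> - X (grid 0 w m j) \<omega> \<ge> a / 2"
        using t(3) near d unfolding jump_def by linarith
      have gw: "grid 0 w m (Suc j) \<le> w" using grid_le[OF T(1) m, of "Suc j" m] j(1) m by simp
      have rpos: "0 < r i" if "0 < i" "i \<le> J" for i
        using that
      proof (induction i)
        case (Suc i)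
        then have "0 \<le> r i" using r(2) by (cases "i = 0") auto
        then show ?case using r(3)[of i] Suc by simp
      qed simp
      have rle: "r i \<le> r J" if "i \<le> J" for i
        using that by (induction rule: inc_induct) (auto intro: order_trans less_imp_le r(3))
      have "X (grid 0 w m (Suc j) + r i) \<omega> - X (grid 0 w m (Suc j)) \<omega> \<le> \<delta>" if i: "i \<le> J" for i
      proof (cases "i = 0")
        case True
        then show ?thesis using r by simp
      next
        case False
        have "t < grid 0 w m (Suc j) + r i" using rpos[of i] False i j by simp
        moreover have "grid 0 w m (Suc j) + r i < w + \<sigma>" using rle[OF i] r(4) gw by simp
        ultimately have "X (grid 0 w m (Suc j) + r i) \<omega> \<le> X t \<omega>" by (rule t(4))
        then show ?thesis using near d by linarith
      qed
      then have "\<omega> \<in> A m j" using inc \<omega> by (simp add: A_def stays_below_def)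
      then show ?case using j(1) m by (auto simp: E_def)
    qed
  qed
  obtain U where "U \<in> events" "?S \<subseteq> U" "prob U \<le> e" by (rule eventually_event_superset[OF E le inE])
  then show "\<exists>U\<in>events. ?S \<subseteq> U \<and> prob U \<le> e" by blast
qed

lemma jump_is_overtaken:
  assumes T: "T > 0"
  shows "AE \<omega> in M. \<forall>t\<in>{0<..<T}. 0 < jump_at \<omega> t \<longrightarrow> (\<exists>s\<in>{t<..<T}. X t \<omega> < X s \<omega>)"
proof -
  define \<sigma> where "\<sigma> n = T / real (Suc (Suc n))" for n
  have \<sigma>: "\<sigma> n > 0" "T - \<sigma> n > 0" for n
  proof -
    show "\<sigma> n > 0" using T by (simp add: \<sigma>_def)
    have "\<sigma> n < T / 1" unfolding \<sigma>_def using T by (intro divide_strict_left_mono) auto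
    then show "T - \<sigma> n > 0" by simp
  qed
  have "AE \<omega> in M. \<forall>n k. \<omega> \<notin> {\<omega>\<in>space M. \<exists>t\<in>{0<..T - \<sigma> n}. 1 / real (Suc k) \<le> jump_at \<omega> t \<and>
    (\<forall>s\<in>{t<..<(T - \<sigma> n)+\<sigma> n}. X s \<omega> \<le> X t \<omega>)}"
    unfolding AE_all_countable using \<sigma> by (intro allI jump_is_overtaken_aux) auto
  then show ?thesis using AE_space
  proof eventually_elim
    case (elim \<omega>)
    show ?case
    proof (intro ballI impI)
      fix t assume t: "t \<in> {0<..<T}" and j: "0 < jump_at \<omega> t"
      obtain k where k: "1 / real (Suc k) \<le> jump_at \<omega> t"
        using reals_Archimedean[OF j] by (auto simp: inverse_eq_divide dest: less_imp_le)
      obtain n where n: "1 / real (Suc n) < (T - t) / T"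
        using reals_Archimedean[of "(T - t) / T"] t T by (auto simp: inverse_eq_divide)
      have "\<sigma> n \<le> T - t"
      proof -
        have "\<sigma> n \<le> T * (1 / real (Suc n))" using T by (simp add: \<sigma>_def field_simps)
        also have "\<dots> \<le> T * ((T - t) / T)" using n T by (intro mult_left_mono) auto
        finally show ?thesis using T by simp
      qed
      then have "t \<in> {0<..T - \<sigma> n}" using t by simp
      then have "\<not> (\<forall>s\<in>{t<..<T}. X s \<omega> \<le> X t \<omega>)" using elim k by fastforce
      then show "\<exists>s\<in>{t<..<T}. X t \<omega> < X s \<omega>" by force
    qed
  qed
qed

end

section \<open>Marks along measurable jump times\<close>

context stable_process
begin

lemma space_sigma_process [simp]: "space (sigma_process M X) = space M"
  by (simp add: sigma_process_def)

lemma X_sigma_process: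
  assumes "t \<ge> 0" shows "X t \<in> borel_measurable (sigma_process M X)"
proof -
  have "(\<lambda>\<omega>. \<lambda>t\<in>{0..}. X t \<omega>) \<in> sigma_process M X \<rightarrow>\<^sub>M (\<Pi>\<^sub>M t\<in>{0..}. borel)"
    unfolding sigma_process_def by (rule measurable_vimage_algebra1) (auto simp: space_PiM)
  from measurable_compose[OF this measurable_component_singleton[of t]] assms show ?thesis by simp
qed

text \<open>The jump is the limit of the increments between the multiples of \<open>1 / Suc k\<close> next to
  \<open>\<tau> \<omega>\<close>, which take countably many values and so preserve measurability.\<close>
lemma jump_at_random_time:
  assumes \<tau>[measurable]: "\<tau> \<in> borel_measurable (sigma_process M X)"
  obtains G where "G \<in> borel_measurable (sigma_process M X)"
    "\<And>\<omega>. \<omega> \<in> space M \<Longrightarrow> \<tau> \<omega> > 0 \<Longrightarrow> G \<omega> = jump_at \<omega> (\<tau> \<omega>)"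
proof -
  define R where "R k \<omega> = (real_of_int (\<lfloor>\<tau> \<omega> * real (Suc k)\<rfloor>) + 1) / real (Suc k)" for k \<omega>
  define L where "L k \<omega> = (real_of_int (\<lceil>\<tau> \<omega> * real (Suc k)\<rceil>) - 1) / real (Suc k)" for k \<omega>
  define G where "G \<omega> = lim (\<lambda>k. X (max 0 (R k \<omega>)) \<omega> - X (max 0 (L k \<omega>)) \<omega>)" for \<omega>
  show ?thesis
  proof (rule that[of G])
    have [measurable]: "(\<lambda>\<omega>. X (max 0 (R k \<omega>)) \<omega>) \<in> borel_measurable (sigma_process M X)" for k
      unfolding R_def
      by (rule measurable_compose_countable[where f =
        "\<lambda>i \<omega>. X (max 0 ((real_of_int i + 1) / real (Suc k))) \<omega>"])
         (auto intro!: X_sigma_process)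
    have [measurable]: "(\<lambda>\<omega>. X (max 0 (L k \<omega>)) \<omega>) \<in> borel_measurable (sigma_process M X)" for k
      unfolding L_def
      by (rule measurable_compose_countable[where f =
        "\<lambda>i \<omega>. X (max 0 ((real_of_int i - 1) / real (Suc k))) \<omega>"])
         (auto intro!: X_sigma_process)
    show "G \<in> borel_measurable (sigma_process M X)" unfolding G_def by measurable
    fix \<omega> assume \<omega>: "\<omega> \<in> space M" "\<tau> \<omega> > 0"
    let ?t = "\<tau> \<omega>" let ?x = "\<lambda>u. X u \<omega>"
    have x: "cadlag ?x" using \<omega> by (simp add: X_cadlag)
    have R: "?t < R k \<omega>" "R k \<omega> \<le> ?t + 1 / real (Suc k)" for k
    proof -
      have "?t * real (Suc k) < real_of_int \<lfloor>?t * real (Suc k)\<rfloor> + 1" by linarith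
      then show "?t < R k \<omega>" unfolding R_def by (simp add: pos_less_divide_eq del: of_nat_Suc)
      have "real_of_int \<lfloor>?t * real (Suc k)\<rfloor> + 1 \<le> ?t * real (Suc k) + 1" by linarith
      then have "R k \<omega> \<le> (?t * real (Suc k) + 1) / real (Suc k)" unfolding R_def
        by (intro divide_right_mono) auto
      then show "R k \<omega> \<le> ?t + 1 / real (Suc k)" by (simp add: add_divide_distrib del: of_nat_Suc)
    qed
    have L: "L k \<omega> < ?t" "?t - 1 / real (Suc k) \<le> L k \<omega>" for k
    proof -
      have "real_of_int \<lceil>?t * real (Suc k)\<rceil> - 1 < ?t * real (Suc k)" by linarith
      then show "L k \<omega> < ?t" unfolding L_def by (simp add: pos_divide_less_eq del: of_nat_Suc)
      have "?t * real (Suc k) - 1 \<le> real_of_int \<lceil>?t * real (Suc k)\<rceil> - 1" by linarith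
      then have "(?t * real (Suc k) - 1) / real (Suc k) \<le> L k \<omega>" unfolding L_def
        by (intro divide_right_mono) auto
      then show "?t - 1 / real (Suc k) \<le> L k \<omega>" by (simp add: diff_divide_distrib del: of_nat_Suc)
    qed
    have inv0: "(\<lambda>k. 1 / real (Suc k)) \<longlonglongrightarrow> 0" using LIMSEQ_inverse_real_of_nat
      by (simp add: inverse_eq_divide)
    have Rt: "(\<lambda>k. R k \<omega>) \<longlonglongrightarrow> ?t"
    proof (rule tendsto_sandwich)
      show "eventually (\<lambda>k. ?t \<le> R k \<omega>) sequentially"
        by (intro always_eventually allI less_imp_le R(1))
      show "eventually (\<lambda>k. R k \<omega> \<le> ?t + 1 / real (Suc k)) sequentially" using R(2) by auto
      show "(\<lambda>k. ?t + 1 / real (Suc k)) \<longlonglongrightarrow> ?t" using tendsto_add[OF tendsto_const[of ?t] inv0]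
        by simp
    qed simp
    have Lt: "(\<lambda>k. L k \<omega>) \<longlonglongrightarrow> ?t"
    proof (rule tendsto_sandwich)
      show "eventually (\<lambda>k. L k \<omega> \<le> ?t) sequentially"
        by (intro always_eventually allI less_imp_le L(1))
      show "eventually (\<lambda>k. ?t - 1 / real (Suc k) \<le> L k \<omega>) sequentially" using L(2) by auto
      show "(\<lambda>k. ?t - 1 / real (Suc k)) \<longlonglongrightarrow> ?t" using tendsto_diff[OF tendsto_const[of ?t] inv0]
        by simp
    qed simp
    have "(\<lambda>k. ?x (R k \<omega>)) \<longlonglongrightarrow> ?x ?t"
    proof (rule filterlim_compose[of ?x])
      show "(?x \<longlongrightarrow> ?x ?t) (at_right ?t)" using x \<omega> by (simp add: cadlag_def)
      show "filterlim (\<lambda>k. R k \<omega>) (at_right ?t) sequentially"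
        unfolding filterlim_at
      proof (intro conjI always_eventually allI)
        fix k
        show "R k \<omega> \<in> {?t<..}" "R k \<omega> \<noteq> ?t" using R(1)[of k] by auto
      qed (rule Rt)
    qed
    then have "(\<lambda>k. ?x (max 0 (R k \<omega>))) \<longlonglongrightarrow> ?x ?t"
      using R(1) \<omega>(2) by (simp add: max_absorb2 less_imp_le less_trans)
    moreover have "(\<lambda>k. ?x (L k \<omega>)) \<longlonglongrightarrow> left_lim ?x ?t"
    proof (rule filterlim_compose[of ?x])
      show "(?x \<longlongrightarrow> left_lim ?x ?t) (at_left ?t)" by (rule cadlag_left_lim[OF x \<omega>(2)])
      show "filterlim (\<lambda>k. L k \<omega>) (at_left ?t) sequentially"
        unfolding filterlim_at
      proof (intro conjI always_eventually allI)
        fix k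
        show "L k \<omega> \<in> {..<?t}" "L k \<omega> \<noteq> ?t" using L(1)[of k] by auto
      qed (rule Lt)
    qed
    then have "(\<lambda>k. ?x (max 0 (L k \<omega>))) \<longlonglongrightarrow> left_lim ?x ?t"
    proof (rule Lim_transform_eventually)
      have "eventually (\<lambda>k. L k \<omega> > 0) sequentially" using Lt \<omega>(2) by (rule order_tendstoD)
      then show "eventually (\<lambda>k. ?x (L k \<omega>) = ?x (max 0 (L k \<omega>))) sequentially"
        by eventually_elim (simp add: max_def)
    qed
    ultimately have "(\<lambda>k. ?x (max 0 (R k \<omega>)) - ?x (max 0 (L k \<omega>))) \<longlonglongrightarrow> jump ?x ?t"
      unfolding jump_def by (rule tendsto_diff)
    then show "G \<omega> = jump ?x ?t" unfolding G_def by (rule limI)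
  qed
qed

text \<open>If \<open>(u, w]\<close> contains exactly one jump larger than \<open>a\<close>, then on a fine grid exactly one
  cell has an increment larger than \<open>a\<close>, and the sum reduces to its right endpoint. As a limit
  of sums, the jump time is measurable with respect to the process by construction.\<close>
definition jump_time :: "real \<Rightarrow> real \<Rightarrow> real \<Rightarrow> 'a \<Rightarrow> real" where
  "jump_time u w a \<omega> = lim (\<lambda>k. \<Sum>j<k. if a < X (grid u w k (Suc j)) \<omega> - X (grid u w k j) \<omega> then grid
    u w k (Suc j) else 0)"

lemma jump_time_measurable:
  assumes "0 \<le> u" "u < w"
  shows "jump_time u w a \<in> borel_measurable (sigma_process M X)"
proof -
  have [measurable]: "X (grid u w k j) \<in> borel_measurable (sigma_process M X)" for k j
    using assms by (intro X_sigma_process grid_nonneg)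
  show ?thesis unfolding jump_time_def by measurable
qed

lemma jump_time_eq:
  assumes u: "0 \<le> u" "u < t" "t \<le> w" and a: "a > 0" and \<omega>: "\<omega> \<in> space M"
    and jump: "a < jump_at \<omega> t" and only: "\<And>s. u < s \<Longrightarrow> s \<le> w \<Longrightarrow> a \<le> jump_at \<omega> s \<Longrightarrow> s = t"
  shows "jump_time u w a \<omega> = t"
  unfolding jump_time_def
proof (rule limI)
  let ?x = "\<lambda>u. X u \<omega>"
  let ?S = "\<lambda>k. \<Sum>j<k. if a < ?x (grid u w k (Suc j)) - ?x (grid u w k j) then grid u w k (Suc j)
    else 0"
  have x: "cadlag ?x" using \<omega> by (rule X_cadlag)
  have uw: "u < w" using u by simp
  define e where "e = (jump ?x t - a) / 2"
  have e: "e > 0" "2 * e = jump ?x t - a" using jump by (auto simp: e_def)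
  have "eventually (\<lambda>k. \<bar>?S k - t\<bar> \<le> (w - u) / real k) sequentially"
    using grid_cell_at_jump[OF x u(1,2,3) e(1)] grid_increment_localises_jump[OF x u(1) uw a]
  proof eventually_elim
    case (elim k)
    then have k: "k > 0" by simp
    obtain j where j: "j < k" "grid u w k j < t" "t \<le> grid u w k (Suc j)"
      using grid_cell[OF u(2,3) k] .
    have big: "a < ?x (grid u w k (Suc j)) - ?x (grid u w k j)"
    proof -
      have "\<bar>?x (grid u w k j) - left_lim ?x t\<bar> < e" "\<bar>?x (grid u w k (Suc j)) - ?x t\<bar> < e"
        using elim(1) j by auto
      then show ?thesis using e(2) unfolding jump_def by linarith
    qed
    have other: "\<not> a < ?x (grid u w k (Suc i)) - ?x (grid u w k i)" if i: "i < k" "i \<noteq> j" for i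
    proof
      assume "a < ?x (grid u w k (Suc i)) - ?x (grid u w k i)"
      then obtain s where s: "grid u w k i < s" "s \<le> grid u w k (Suc i)" "a \<le> jump ?x s"
        using elim(2) i(1) by force
      have "u \<le> grid u w k i" "grid u w k (Suc i) \<le> w"
        using grid_le[OF uw k, of 0 i] grid_le[OF uw k, of "Suc i" k] i(1) k by auto
      then have "s = t" using s by (intro only) auto
      then show False using grid_cell_unique[OF uw k s(1,2), of j] j(2,3) i(2) by simp
    qed
    have "?S k = (\<Sum>i<k. if i = j then grid u w k (Suc j) else 0)"
      using big other by (intro sum.cong) auto
    also have "\<dots> = grid u w k (Suc j)" using j(1) by simp
    finally have "?S k = grid u w k (Suc j)" .
    then show ?case using j(2,3) by (simp add: grid_Suc)
  qed
  then have "(\<lambda>k. ?S k - t) \<longlonglongrightarrow> 0"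
    by (intro Lim_null_comparison[OF _ grid_step_tendsto_0[of w u]]) simp
  then show "?S \<longlonglongrightarrow> t" by (simp add: LIM_zero_iff)
qed

text \<open>The law of the marks is used along a single random time: each cell of a grid provides one
  jump time that is measurable with respect to the process, and the mark there is bad with
  conditional probability at most \<open>\<delta>\<close>. Summing over the cells gives a bound that is uniform in
  the grid, and on a fine grid every jump larger than \<open>a\<close> is alone in its cell, hence is the
  jump that the cell provides.\<close>
lemma bad_mark_event:
  assumes marked: "independently_marked M X mark \<kappa>" and T: "T > 0" and a: "a > 0"
    and B: "B \<in> sets path_space" and \<delta>: "\<delta> \<ge> 0" and le: "\<And>x. a < x \<Longrightarrow> x \<le> b \<Longrightarrow> emeasure (\<kappa> x) B \<le>
      ennreal \<delta>"
  obtains U where "U \<in> events" "prob U \<le> tail_const * (T * (a / 2) powr (-\<beta>)) * \<delta>"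
    "{\<omega>\<in>space M. \<exists>t\<in>{0<..T}. a < jump_at \<omega> t \<and> jump_at \<omega> t \<le> b \<and> mark t \<omega> \<in> B} \<subseteq> U"
proof -
  let ?S = "{\<omega>\<in>space M. \<exists>t\<in>{0<..T}. a < jump_at \<omega> t \<and> jump_at \<omega> t \<le> b \<and> mark t \<omega> \<in> B}"
  define \<tau> where "\<tau> m i = jump_time (grid 0 T m i) (grid 0 T m (Suc i)) a" for m i
  define A where "A m i = {\<omega>\<in>space M. grid 0 T m i < \<tau> m i \<omega> \<and> \<tau> m i \<omega> \<le> grid 0 T m (Suc i) \<and>
     a < jump_at \<omega> (\<tau> m i \<omega>) \<and> jump_at \<omega> (\<tau> m i \<omega>) \<le> b}" for m i
  define E where "E m = (if m = 0 then {} else (\<Union>i<m. {\<omega>\<in>A m i. mark (\<tau> m i \<omega>) \<omega> \<in> B}))" for m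
  have g: "0 \<le> grid 0 T m i" "m > 0 \<Longrightarrow> grid 0 T m i < grid 0 T m (Suc i)" for m i
    using T by (auto simp: grid_nonneg grid_mono)
  have \<tau>m: "\<tau> m i \<in> borel_measurable (sigma_process M X)" if "m > 0" for m i
    unfolding \<tau>_def using g that by (intro jump_time_measurable) auto
  have AF: "A m i \<in> sets (sigma_process M X)" if m: "m > 0" for m i
  proof -
    note [measurable] = \<tau>m[OF m]
    obtain G where G[measurable]: "G \<in> borel_measurable (sigma_process M X)"
      "\<And>\<omega>. \<omega> \<in> space M \<Longrightarrow> \<tau> m i \<omega> > 0 \<Longrightarrow> G \<omega> = jump_at \<omega> (\<tau> m i \<omega>)"
      using jump_at_random_time[OF \<tau>m[OF m]] by blast
    have "A m i = {\<omega>\<in>space (sigma_process M X). grid 0 T m i < \<tau> m i \<omega> \<and> \<tau> m i \<omega> \<le>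
      grid 0 T m (Suc i) \<and> a < G \<omega> \<and> G \<omega> \<le> b}"
      using G(2) g(1)[of m i] unfolding A_def by (auto dest: le_less_trans)
    also have "\<dots> \<in> sets (sigma_process M X)" by measurable
    finally show ?thesis .
  qed
  have mk: "{\<omega>\<in>A'. \<forall>i<n. mark (\<tau>' i \<omega>) \<omega> \<in> B' i} \<in> sets M"
     "emeasure M {\<omega>\<in>A'. \<forall>i<n. mark (\<tau>' i \<omega>) \<omega> \<in> B' i} =
       (\<integral>\<^sup>+\<omega>\<in>A'. (\<Prod>i<n. emeasure (\<kappa> (jump_at \<omega> (\<tau>' i \<omega>))) (B' i)) \<partial>M)"
    if "\<And>i. i < n \<Longrightarrow> \<tau>' i \<in> borel_measurable (sigma_process M X)" "A' \<in> sets (sigma_process M X)"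
      "\<And>\<omega> i. \<omega> \<in> A' \<Longrightarrow> i < n \<Longrightarrow> \<tau>' i \<omega> \<ge> 0 \<and> jump_at \<omega> (\<tau>' i \<omega>) > 0" "\<And>\<omega>. \<omega> \<in> A' \<Longrightarrow>
        inj_on (\<lambda>i. \<tau>' i \<omega>) {..<n}"
      "\<And>i. i < n \<Longrightarrow> B' i \<in> sets path_space" for n :: nat and \<tau>' A' B'
    using marked that unfolding independently_marked_def by blast+
  have AM: "A m i \<in> events" if "m > 0" for m i
    using mk(1)[of 0 _ "A m i"] AF[OF that] by simp
  have Apos: "\<tau> m i \<omega> \<ge> 0 \<and> jump_at \<omega> (\<tau> m i \<omega>) > 0" if "\<omega> \<in> A m i" for m i \<omega>
    using that g(1)[of m i] a unfolding A_def by auto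
  have bad: "{\<omega>\<in>A m i. mark (\<tau> m i \<omega>) \<omega> \<in> B} \<in> events"
     "emeasure M {\<omega>\<in>A m i. mark (\<tau> m i \<omega>) \<omega> \<in> B} \<le> ennreal \<delta> * emeasure M (A m i)" if m: "m > 0"
       for m i
  proof -
    note mk1 = mk[of 1 "\<lambda>_. \<tau> m i" "A m i" "\<lambda>_. B", OF \<tau>m[OF m] AF[OF m] Apos _ B]
    show "{\<omega>\<in>A m i. mark (\<tau> m i \<omega>) \<omega> \<in> B} \<in> events" using mk1(1) by (simp add: inj_on_def)
    have "emeasure M {\<omega>\<in>A m i. mark (\<tau> m i \<omega>) \<omega> \<in> B} =
      (\<integral>\<^sup>+\<omega>\<in>A m i. emeasure (\<kappa> (jump_at \<omega> (\<tau> m i \<omega>))) B \<partial>M)"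
      using mk1(2) by (simp add: inj_on_def)
    also have "\<dots> \<le> (\<integral>\<^sup>+\<omega>\<in>A m i. ennreal \<delta> \<partial>M)"
    proof (intro nn_integral_mono)
      fix \<omega>
      show "emeasure (\<kappa> (jump_at \<omega> (\<tau> m i \<omega>))) B * indicator (A m i) \<omega> \<le>
        ennreal \<delta> * indicator (A m i) \<omega>"
        using le[of "jump_at \<omega> (\<tau> m i \<omega>)"] by (cases "\<omega> \<in> A m i") (auto simp: A_def)
    qed
    also have "\<dots> = ennreal \<delta> * emeasure M (A m i)" using AM[OF m]
      by (simp add: nn_integral_cmult_indicator)
    finally show "emeasure M {\<omega>\<in>A m i. mark (\<tau> m i \<omega>) \<omega> \<in> B} \<le> ennreal \<delta> * emeasure M (A m i)" .
  qed
  have E: "E m \<in> events" for m unfolding E_def using bad(1) by auto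
  have prob: "eventually (\<lambda>m. prob (E m) \<le> tail_const * (T * (a / 2) powr (-\<beta>)) * \<delta>) sequentially"
    using eventually_gt_at_top[of "0::nat"]
  proof eventually_elim
    case (elim m)
    have "E m = (\<Union>i<m. {\<omega>\<in>A m i. mark (\<tau> m i \<omega>) \<omega> \<in> B})" using elim by (simp add: E_def)
    then have "prob (E m) \<le> (\<Sum>i<m. prob {\<omega>\<in>A m i. mark (\<tau> m i \<omega>) \<omega> \<in> B})"
      by (simp only:) (intro finite_measure_subadditive_finite image_subsetI bad(1) elim
        finite_lessThan)
    also have "\<dots> \<le> (\<Sum>i<m. \<delta> * (tail_const * (T / real m * (a / 2) powr (-\<beta>))))"
    proof (rule sum_mono)
      fix i
      obtain U where U: "U \<in> events" "prob U \<le> tail_const * ((grid 0 T m (Suc i) - grid 0 T m i)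
        * (a / 2) powr (-\<beta>))"
        "{\<omega>\<in>space M. \<exists>t\<in>{grid 0 T m i<..grid 0 T m (Suc i)}. a \<le> jump_at \<omega> t} \<subseteq> U"
        using jump_event[OF g(1) g(2)[OF elim] a] by blast
      have "A m i \<subseteq> U"
      proof
        fix \<omega> assume "\<omega> \<in> A m i"
        then have "\<omega> \<in> {\<omega>\<in>space M. \<exists>t\<in>{grid 0 T m i<..grid 0 T m (Suc i)}. a \<le> jump_at \<omega> t}"
          unfolding A_def by (auto intro!: bexI[of _ "\<tau> m i \<omega>"])
        then show "\<omega> \<in> U" using U(3) by blast
      qed
      then have "prob (A m i) \<le> prob U" using U(1) by (intro finite_measure_mono)
      also have "\<dots> \<le> tail_const * (T / real m * (a / 2) powr (-\<beta>))" using U(2)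
        by (simp add: grid_Suc)
      finally have pA: "prob (A m i) \<le> tail_const * (T / real m * (a / 2) powr (-\<beta>))" .
      have "ennreal (prob {\<omega>\<in>A m i. mark (\<tau> m i \<omega>) \<omega> \<in> B}) \<le> ennreal (\<delta> * prob (A m i))"
        using bad(2)[OF elim, of i] \<delta> unfolding emeasure_eq_measure by (simp add: ennreal_mult)
      then have "prob {\<omega>\<in>A m i. mark (\<tau> m i \<omega>) \<omega> \<in> B} \<le> \<delta> * prob (A m i)"
        using \<delta> by (simp add: ennreal_le_iff)
      also have "\<dots> \<le> \<delta> * (tail_const * (T / real m * (a / 2) powr (-\<beta>)))" using pA \<delta>
        by (rule mult_left_mono)
      finally show "prob {\<omega>\<in>A m i. mark (\<tau> m i \<omega>) \<omega> \<in> B} \<le>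
        \<delta> * (tail_const * (T / real m * (a / 2) powr (-\<beta>)))" .
    qed
    also have "\<dots> = tail_const * (T * (a / 2) powr (-\<beta>)) * \<delta>" using elim by simp
    finally show ?case .
  qed
  have inE: "eventually (\<lambda>m. \<omega> \<in> E m) sequentially" if "\<omega> \<in> ?S" for \<omega>
  proof -
    let ?x = "\<lambda>u. X u \<omega>"
    from that obtain t where \<omega>: "\<omega> \<in> space M" and t: "0 < t" "t \<le> T" "a < jump ?x t" "jump ?x t \<le> b"
      "mark t \<omega> \<in> B" by auto
    have fin: "finite {s\<in>{0..T}. a \<le> jump ?x s}" using \<omega> a by (intro cadlag_finite_jumps X_cadlag)
    from grid_injective_on_finite[OF fin, of 0 T] eventually_gt_at_top[of "0::nat"] show ?thesis
    proof eventually_elim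
      case (elim m)
      obtain i where i: "i < m" "grid 0 T m i < t" "t \<le> grid 0 T m (Suc i)"
        using grid_cell[OF t(1,2) elim(2)] .
      have gT: "grid 0 T m (Suc i) \<le> T" using grid_le[OF T elim(2), of "Suc i" m] i(1) elim(2)
        by simp
      have "\<tau> m i \<omega> = t"
        unfolding \<tau>_def
      proof (rule jump_time_eq[OF g(1) i(2,3) a \<omega> t(3)])
        fix s assume s: "grid 0 T m i < s" "s \<le> grid 0 T m (Suc i)" "a \<le> jump ?x s"
        have "s \<in> {s\<in>{0..T}. a \<le> jump ?x s}" "t \<in> {s\<in>{0..T}. a \<le> jump ?x s}"
          using s gT t g(1)[of m i] by auto
        then show "s = t" using elim(1) s i by blast
      qed
      then have "\<omega> \<in> {\<omega>\<in>A m i. mark (\<tau> m i \<omega>) \<omega> \<in> B}" using \<omega> i t by (simp add: A_def)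
      then show ?case using i(1) elim(2) by (auto simp: E_def)
    qed
  qed
  obtain U where "U \<in> events" "?S \<subseteq> U" "prob U \<le> tail_const * (T * (a / 2) powr (-\<beta>)) * \<delta>"
    by (rule eventually_event_superset[OF E prob inE])
  then show ?thesis by (intro that)
qed

end

section \<open>Almost sure bounds on dyadic scales\<close>

lemma crowding_summable:
  assumes \<epsilon>: "\<epsilon> > (0::real)" and c: "c > 0"
  shows "summable (\<lambda>n. 4 ^ n * exp (- (2 powr (real n * \<epsilon>)) / c))"
proof (rule summable_comparison_test_bigo)
  show "summable (\<lambda>n. norm ((1/2::real) ^ n))" by (simp add: summable_geometric)
  show "(\<lambda>n. 4 ^ n * exp (- (2 powr (real n * \<epsilon>)) / c)) \<in> O(\<lambda>n. (1/2::real) ^ n)"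
    using \<epsilon> c by real_asymp
qed

lemma half_power_powr: "((1/2::real) ^ n) powr z = 2 powr (- (real n * z))"
proof -
  have "(1/2::real) ^ n = 2 powr (- real n)"
    by (simp add: powr_minus powr_realpow power_one_over inverse_eq_divide)
  then show ?thesis by (simp only: powr_powr mult_minus_left)
qed

lemma real_dyadic_scale:
  assumes "0 < x" "x \<le> (1/2::real) ^ m"
  shows "\<exists>n\<ge>m. (1/2) ^ Suc n < x \<and> x \<le> (1/2) ^ n"
proof -
  have "(\<lambda>n. (1/2::real) ^ n) \<longlonglongrightarrow> 0" by (rule LIMSEQ_realpow_zero) auto
  then obtain k where k: "(1/2::real) ^ k < x"
    using assms(1) order_tendstoD(2) eventually_sequentially
    by (metis (mono_tags, lifting) order_refl)
  define n where "n = (LEAST k. (1/2::real) ^ k < x)"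
  have n: "(1/2::real) ^ n < x" unfolding n_def using k by (rule LeastI)
  have mn: "m < n"
  proof (rule ccontr)
    assume "\<not> ?thesis"
    then have "(1/2::real) ^ m \<le> (1/2) ^ n" by (intro power_decreasing) auto
    then show False using n assms(2) by linarith
  qed
  then obtain n' where n': "n = Suc n'" by (cases n) auto
  have "\<not> (1/2::real) ^ n' < x" using n' not_less_Least[of n' "\<lambda>k. (1/2::real) ^ k < x"]
    unfolding n_def[symmetric] by simp
  then show ?thesis using n n' mn by (intro exI[of _ n']) auto
qed

context stable_process
begin

text \<open>The spacing is the scale \<open>2 ^ -n\<close>, and the range \<open>[- 2 ^ n, 2 ^ n]\<close> eventually contains
  the values of a given path on a bounded interval; the number of levels is of order \<open>4 ^ n\<close>.\<close>
definition level_grid :: "nat \<Rightarrow> real set" where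
  "level_grid n = (\<lambda>i. real_of_int i * (1/2) ^ n) ` {- (4 ^ n)..4 ^ n}"

definition clique_bound :: "real \<Rightarrow> nat \<Rightarrow> nat" where
  "clique_bound \<epsilon> n = nat \<lceil>2 powr (real n * (\<alpha> + \<epsilon>))\<rceil>"

lemma clique_bound_real: "2 powr (real n * (\<alpha> + \<epsilon>)) \<le> real (clique_bound \<epsilon> n)"
  "real (clique_bound \<epsilon> n) \<le> 2 powr (real n * (\<alpha> + \<epsilon>)) + 1"
  unfolding clique_bound_def by (simp_all add: of_nat_nat real_nat_ceiling_ge)

text \<open>The bound \<open>K\<close> exceeds the expected number of visits by a factor of order \<open>2 ^ (n \<epsilon>)\<close>. A
  given level is then crowded with probability at most \<open>2 exp (- c 2 ^ (n \<epsilon>))\<close>, which is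
  summable even after multiplication by the number of levels.\<close>
lemma eventually_not_crowded:
  assumes T: "T > 0" and \<epsilon>: "\<epsilon> > 0"
  shows "AE \<omega> in M. eventually (\<lambda>n. \<omega> \<notin> crowded T ((1/2) ^ n) (level_grid n) (clique_bound \<epsilon> n))
    sequentially"
proof -
  define A where "A = visit_const T"
  have A: "A > 0" by (simp add: A_def visit_const_pos)
  define c1 where "c1 = 1 + 1 / (2 * A)"
  have c1: "c1 > 0" using A by (simp add: c1_def add_pos_pos)
  define K where "K = clique_bound \<epsilon>"
  define lam where "lam n = ((1/2) ^ n) powr \<alpha> / (2 * A)" for n :: nat
  have fin: "finite (level_grid n)" for n by (simp add: level_grid_def)
  have "\<exists>U\<in>events. prob U \<le> real (card (level_grid n)) * (2 / (1 + lam n) ^ K n) \<and>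
    crowded T ((1/2) ^ n) (level_grid n) (K n) \<subseteq> U" for n
    using crowding_event[OF T _ fin, of "(1/2) ^ n" n "K n"] unfolding lam_def A_def
    by (metis half_gt_zero zero_less_one zero_less_power)
  then obtain U where U: "\<And>n. U n \<in> events" "\<And>n. prob (U n) \<le> real (card (level_grid n))
    * (2 / (1 + lam n) ^ K n)"
    "\<And>n. crowded T ((1/2) ^ n) (level_grid n) (K n) \<subseteq> U n" by metis
  note half = half_power_powr[of _ \<alpha>]
  have Ub: "prob (U n) \<le> 6 * (4 ^ n * exp (- (2 powr (real n * \<epsilon>)) / (2 * A * c1)))" for n
  proof -
    have lam0: "lam n > 0" using A by (simp add: lam_def)
    have "((1/2::real) ^ n) powr \<alpha> \<le> 1 powr \<alpha>" using \<alpha>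
      by (intro powr_mono2) (auto simp: power_le_one)
    then have lam1: "1 + lam n \<le> c1" using A by (simp add: lam_def c1_def divide_right_mono)
    have "lam n / c1 \<le> lam n / (1 + lam n)" using lam0 lam1
      by (intro divide_left_mono mult_pos_pos) auto
    also have "\<dots> \<le> ln (1 + lam n)"
    proof -
      have "ln (1 / (1 + lam n)) \<le> 1 / (1 + lam n) - 1" using lam0 by (intro ln_le_minus_one) auto
      then show ?thesis using lam0 by (simp add: ln_div field_simps)
    qed
    finally have ln: "lam n / c1 \<le> ln (1 + lam n)" .
    have "2 powr (real n * \<epsilon>) / (2 * A * c1) = 2 powr (real n * (\<alpha> + \<epsilon>)) * (lam n / c1)"
      using A c1 unfolding lam_def half by (simp add: distrib_left powr_add powr_minus field_simps)
    also have "\<dots> \<le> real (K n) * ln (1 + lam n)"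
      using clique_bound_real(1)[of n \<epsilon>] ln lam0 c1 unfolding K_def by (intro mult_mono) auto
    finally have "exp (- (real (K n) * ln (1 + lam n))) \<le>
      exp (- (2 powr (real n * \<epsilon>)) / (2 * A * c1))" by simp
    moreover have "exp (- (real (K n) * ln (1 + lam n))) = 1 / (1 + lam n) ^ K n"
      using lam0 by (simp add: exp_minus exp_of_nat_mult inverse_eq_divide)
    ultimately have e: "2 / (1 + lam n) ^ K n \<le> 2 * exp (- (2 powr (real n * \<epsilon>)) / (2 * A * c1))"
      by simp
    have "card (level_grid n) \<le> card {- (4 ^ n)..(4 ^ n :: int)}" unfolding level_grid_def
      by (rule card_image_le) simp
    also have "\<dots> = nat (2 * 4 ^ n + 1)" by simp
    finally have "real (card (level_grid n)) \<le> real (nat (2 * 4 ^ n + 1))" by (rule of_nat_mono)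
    also have "\<dots> \<le> 3 * 4 ^ n" by (simp add: of_nat_nat)
    finally have "real (card (level_grid n)) \<le> 3 * 4 ^ n" .
    then have "real (card (level_grid n)) * (2 / (1 + lam n) ^ K n) \<le>
      (3 * 4 ^ n) * (2 * exp (- (2 powr (real n * \<epsilon>)) / (2 * A * c1)))"
      using e lam0 by (intro mult_mono) auto
    then show ?thesis using U(2)[of n] by simp
  qed
  have "summable (\<lambda>n. 6 * (4 ^ n * exp (- (2 powr (real n * \<epsilon>)) / (2 * A * c1))))"
    using \<epsilon> A c1 by (intro summable_mult crowding_summable) auto
  then have "summable (\<lambda>n. prob (U n))" by (rule summable_comparison_test'[where N = 0])
    (use Ub in auto)
  then have "AE \<omega> in M. eventually (\<lambda>n. \<omega> \<in> space M - U n) sequentially"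
    using U(1) by (intro borel_cantelli_AE1) (auto simp: emeasure_eq_measure)
  then show ?thesis
  proof eventually_elim
    case (elim \<omega>)
    then show ?case unfolding K_def[symmetric] by eventually_elim (use U(3) in blast)
  qed
qed

end

locale marked_stable_process = stable_process M X \<alpha> for M :: "'a measure" and X \<alpha> +
  fixes mark :: "real \<Rightarrow> 'a \<Rightarrow> real \<Rightarrow> real" and N :: "'b measure" and Z :: "'b \<Rightarrow> real \<Rightarrow> real"
    and q \<gamma> :: real
  assumes exc: "random_excursion N Z" and \<gamma>: "0 < \<gamma>" "\<gamma> < q - \<alpha>"
    and holder_finite: "AE \<omega> in N. holder_const \<gamma> 1 (Z \<omega>) < \<infinity>"
    and moments: "moments_of_all_orders N (\<lambda>\<omega>. enn2real (holder_const \<gamma> 1 (Z \<omega>)))"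
    and marked: "independently_marked M X mark (kappa N Z q)"
begin

lemma \<gamma>_less_q: "\<gamma> < q" using \<gamma> \<alpha> by linarith

definition mark_moment :: "real \<Rightarrow> real" where
  "mark_moment p = (\<integral>\<omega>. enn2real (holder_const \<gamma> 1 (Z \<omega>)) powr p \<partial>N)"

lemma mark_moment_nonneg: "mark_moment p \<ge> 0" unfolding mark_moment_def by simp

lemma rough_mark_event:
  assumes T: "T > 0" and a: "0 < a" "a < b" and v: "v > 0" and p: "p > 0"
  obtains U where "U \<in> events"
    "prob U \<le> tail_const * (T * (a / 2) powr (-\<beta>)) * (mark_moment p * (b powr (q - \<gamma>) / v) powr p)"
    "{\<omega>\<in>space M. \<exists>t\<in>{0<..T}. a < jump_at \<omega> t \<and> jump_at \<omega> t \<le> b \<and> mark t \<omega> \<in> holder_violating \<gamma> v} \<subseteq>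
      U"
proof (rule bad_mark_event[OF marked T a(1) holder_violating_sets[of \<gamma> v], of
  "mark_moment p * (b powr (q - \<gamma>) / v) powr p" b])
  show "0 \<le> mark_moment p * (b powr (q - \<gamma>) / v) powr p" using mark_moment_nonneg by simp
  fix x assume "a < x" "x \<le> b"
  then show "emeasure (kappa N Z q x) (holder_violating \<gamma> v) \<le>
    ennreal (mark_moment p * (b powr (q - \<gamma>) / v) powr p)"
    unfolding mark_moment_def using a
    by (intro kappa_holder_violating exc \<gamma>(1) \<gamma>_less_q holder_finite moments v p) auto
qed (rule that)

lemma mark_in_path_space:
  "\<omega> \<in> space M \<Longrightarrow> t \<ge> 0 \<Longrightarrow> 0 < jump_at \<omega> t \<Longrightarrow> mark t \<omega> \<in> space path_space"
  using marked unfolding independently_marked_def by blast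

text \<open>For jump sizes in a compact subinterval of the positive reals, the bound on rough marks
  tends to 0 as \<open>v\<close> tends to infinity.\<close>
lemma marks_finite:
  assumes T: "T > 0"
  shows "AE \<omega> in M. \<forall>t\<in>{0<..T}. 0 < jump_at \<omega> t \<longrightarrow> holder_const \<gamma> (jump_at \<omega> t) (mark t \<omega>) < \<infinity>"
proof -
  define S where "S k = {\<omega>\<in>space M. \<exists>t\<in>{0<..T}. 1 / real (Suc (Suc k)) < jump_at \<omega> t \<and>
     jump_at \<omega> t \<le> real (Suc k) \<and> (\<forall>v>0. mark t \<omega> \<in> holder_violating \<gamma> v)}" for k
  have "AE \<omega> in M. \<omega> \<notin> S k" for k
  proof (rule AE_avoids_if_small)
    fix e :: real assume e: "e > 0"
    define a where "a = 1 / real (Suc (Suc k))"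
    define b where "b = real (Suc k)"
    have "a < 1 / 1" unfolding a_def by (intro divide_strict_left_mono) auto
    moreover have "1 \<le> b" "0 < a" by (auto simp: a_def b_def)
    ultimately have ab: "0 < a" "a < b" by auto
    define C where "C = tail_const * (T * (a / 2) powr (-\<beta>)) * (mark_moment 1 * b powr (q - \<gamma>))"
    have C: "C \<ge> 0" unfolding C_def using tail_const_ge_1 T mark_moment_nonneg by auto
    define v where "v = (C + 1) / e"
    have v: "v > 0" using C e by (simp add: v_def)
    obtain U where U: "U \<in> events"
      "prob U \<le> tail_const * (T * (a / 2) powr (-\<beta>))
        * (mark_moment 1 * (b powr (q - \<gamma>) / v) powr 1)"
      "{\<omega>\<in>space M. \<exists>t\<in>{0<..T}. a < jump_at \<omega> t \<and> jump_at \<omega> t \<le> b \<and> mark t \<omega> \<in> holder_violating \<gamma> v}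
        \<subseteq> U"
      by (rule rough_mark_event[OF T ab v, of 1]) auto
    have "prob U \<le> C / v" using U(2) v by (simp add: C_def)
    also have "\<dots> \<le> e" using C e by (simp add: v_def field_simps)
    finally have "prob U \<le> e" .
    moreover have "S k \<subseteq> U" using U(3) v unfolding S_def a_def b_def by blast
    ultimately show "\<exists>U\<in>events. S k \<subseteq> U \<and> prob U \<le> e" using U(1) by blast
  qed
  then have "AE \<omega> in M. \<forall>k. \<omega> \<notin> S k" by (simp add: AE_all_countable)
  then show ?thesis using AE_space
  proof eventually_elim
    case (elim \<omega>)
    show ?case
    proof (intro ballI impI)
      fix t assume t: "t \<in> {0<..T}" and j: "0 < jump_at \<omega> t"
      obtain k1 where k1: "1 / real (Suc k1) < jump_at \<omega> t" using reals_Archimedean[OF j]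
        by (auto simp: inverse_eq_divide)
      obtain k2 where k2: "jump_at \<omega> t \<le> real k2" using real_arch_simple by blast
      define k where "k = max k1 k2"
      have "1 / real (Suc (Suc k)) \<le> 1 / real (Suc k1)"
        by (intro divide_left_mono) (auto simp: k_def)
      then have "1 / real (Suc (Suc k)) < jump_at \<omega> t" using k1 by linarith
      moreover have "jump_at \<omega> t \<le> real (Suc k)" using k2 by (simp add: k_def)
      ultimately obtain v where v: "mark t \<omega> \<notin> holder_violating \<gamma> v" using elim t
        by (force simp: S_def)
      have "holder_const \<gamma> (jump_at \<omega> t) (mark t \<omega>) \<le> ennreal v"
        using v t j elim by (intro holder_const_le mark_in_path_space) auto
      then show "holder_const \<gamma> (jump_at \<omega> t) (mark t \<omega>) < \<infinity>" by (rule le_less_trans) simp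
    qed
  qed
qed

text \<open>At scale \<open>n\<close> the expected number of jumps is of order \<open>2 ^ (n \<beta>)\<close>, and by the moment of
  order \<open>p\<close> each mark is rough with probability of order \<open>2 ^ (- n \<epsilon> p)\<close>. The choice
  \<open>\<epsilon> p = \<beta> + 1\<close> makes the product \<open>2 ^ -n\<close>.\<close>
lemma eventually_smooth_marks:
  assumes T: "T > 0" and \<epsilon>: "\<epsilon> > 0"
  shows "AE \<omega> in M. eventually (\<lambda>n. \<forall>t\<in>{0<..T}. (1/2) ^ Suc n < jump_at \<omega> t \<and> jump_at \<omega> t \<le>
    (1/2) ^ n \<longrightarrow>
     holder_const \<gamma> (jump_at \<omega> t) (mark t \<omega>) \<le> ennreal (2 powr (- (real n *
       (q - \<gamma> - \<epsilon>))))) sequentially"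
proof -
  define v where "v n = 2 powr (- (real n * (q - \<gamma> - \<epsilon>)))" for n
  define p where "p = (\<beta> + 1) / \<epsilon>"
  have p: "p > 0" using \<alpha> \<epsilon> by (simp add: p_def)
  define S where "S n = {\<omega>\<in>space M. \<exists>t\<in>{0<..T}. (1/2) ^ Suc n < jump_at \<omega> t \<and>
     jump_at \<omega> t \<le> (1/2) ^ n \<and> mark t \<omega> \<in> holder_violating \<gamma> (v n)}" for n
  define C where "C = tail_const * (T * 4 powr \<beta>) * mark_moment p"
  have "\<exists>U\<in>events. prob U \<le> C * (1/2) ^ n \<and> S n \<subseteq> U" for n
  proof -
    have vn: "v n > 0" by (simp add: v_def)
    obtain U where U: "U \<in> events"
      "prob U \<le> tail_const * (T * ((1/2) ^ Suc n / 2) powr (-\<beta>))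
        * (mark_moment p * (((1/2) ^ n) powr (q - \<gamma>) / v n) powr p)"
      "S n \<subseteq> U"
      unfolding S_def by (rule rough_mark_event[OF T _ _ vn p, of "(1/2) ^ Suc n" "(1/2) ^ n"]) auto
    note half = half_power_powr[of n]
    have 1: "((1/2::real) ^ Suc n / 2) powr (-\<beta>) = 4 powr \<beta> * 2 powr (real n * \<beta>)"
    proof -
      have "((1/2::real) ^ Suc n / 2) = (1/2) ^ n * (1 / 4)" by simp
      then have "((1/2::real) ^ Suc n / 2) powr (-\<beta>) = ((1/2) ^ n) powr (-\<beta>) * (1 / 4) powr (-\<beta>)"
        by (simp only: powr_mult)
      also have "(1 / 4 :: real) powr (-\<beta>) = 4 powr \<beta>"
        using powr_minus_divide[of "1/4" \<beta>] powr_divide[of 1 4 \<beta>] by simp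
      finally show ?thesis unfolding half by (simp only: mult_minus_right minus_minus mult.commute)
    qed
    have 2: "(((1/2::real) ^ n) powr (q - \<gamma>) / v n) powr p = 2 powr (- (real n * (\<beta> + 1)))"
    proof -
      have "((1/2::real) ^ n) powr (q - \<gamma>) / v n = 2 powr (- (real n * \<epsilon>))"
        unfolding half v_def powr_diff[symmetric] by (simp add: algebra_simps)
      then have "(((1/2::real) ^ n) powr (q - \<gamma>) / v n) powr p = 2 powr (- (real n * \<epsilon>) * p)"
        by (simp only: powr_powr)
      also have "- (real n * \<epsilon>) * p = - (real n * (\<beta> + 1))" using \<epsilon> by (simp add: p_def)
      finally show ?thesis .
    qed
    have 3: "2 powr (real n * \<beta>) * 2 powr (- (real n * (\<beta> + 1))) = (1/2) ^ n"
      unfolding powr_add[symmetric]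
      by (simp add: algebra_simps powr_minus_divide powr_realpow power_one_over)
    have "prob U \<le> tail_const * (T * 4 powr \<beta>) * mark_moment p * (2 powr (real n * \<beta>)
      * 2 powr (- (real n * (\<beta> + 1))))"
      using U(2) unfolding 1 2 by (simp only: mult_ac)
    then have "prob U \<le> C * (1/2) ^ n" unfolding 3 C_def .
    then show ?thesis using U by blast
  qed
  then obtain U where U: "\<And>n. U n \<in> events" "\<And>n. prob (U n) \<le> C * (1/2) ^ n" "\<And>n. S n \<subseteq> U n"
    by metis
  have "summable (\<lambda>n. C * (1/2) ^ n)" by (intro summable_mult summable_geometric) simp
  then have "summable (\<lambda>n. prob (U n))" by (rule summable_comparison_test'[where N = 0])
    (use U(2) in auto)
  then have "AE \<omega> in M. eventually (\<lambda>n. \<omega> \<in> space M - U n) sequentially"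
    using U(1) by (intro borel_cantelli_AE1) (auto simp: emeasure_eq_measure)
  then show ?thesis
  proof eventually_elim
    case (elim \<omega>)
    then show ?case
    proof eventually_elim
      case (elim n)
      show ?case
      proof (intro ballI impI)
        fix t assume t: "t \<in> {0<..T}" and j: "(1/2) ^ Suc n < jump_at \<omega> t \<and> jump_at \<omega> t \<le> (1/2) ^ n"
        have "0 < jump_at \<omega> t" by (rule less_trans[of _ "(1/2) ^ Suc n"]) (use j in auto)
        moreover have "mark t \<omega> \<notin> holder_violating \<gamma> (v n)"
        proof
          assume "mark t \<omega> \<in> holder_violating \<gamma> (v n)"
          then have "\<omega> \<in> S n" unfolding S_def using elim t j by blast
          then show False using elim U(3) by blast
        qed
        ultimately show "holder_const \<gamma> (jump_at \<omega> t) (mark t \<omega>) \<le>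
          ennreal (2 powr (- (real n * (q - \<gamma> - \<epsilon>))))"
          using t elim unfolding v_def[symmetric] by (intro holder_const_le mark_in_path_space) auto
      qed
    qed
  qed
qed

end

section \<open>Partition of the jump times\<close>

text \<open>When the highest jump of \<open>F\<close> is overtaken, at time \<open>s\<close> say, the path is above all jump
  intervals of \<open>F\<close>. By right continuity the same holds for the jump intervals of all jumps soon
  after \<open>s\<close>, and a shorter interval after \<open>s\<close> misses the finite set \<open>Q\<close>.\<close>
lemma jump_avoiding_finite_family:
  assumes x: "cadlag x" and T: "T > 0"
    and fin: "finite Q" and F: "finite F" "F \<subseteq> {0<..<T}"
    and overtaken: "\<And>t. t \<in> F \<Longrightarrow> \<exists>s\<in>{t<..<T}. x t < x s"
    and dense: "\<And>p q. p \<in> \<rat> \<Longrightarrow> q \<in> \<rat> \<Longrightarrow> 0 \<le> p \<Longrightarrow> p < q \<Longrightarrow> \<exists>t\<in>{p<..q}. 0 < jump x t"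
  shows "\<exists>t\<in>{0<..<T} - Q. 0 < jump x t \<and> (\<forall>i\<in>F. x i < left_lim x t)"
proof -
  obtain s where s: "0 < s" "s < T" "\<And>i. i \<in> F \<Longrightarrow> x i < x s"
  proof (cases "F = {}")
    case True
    then show ?thesis using T by (intro that[of "T / 2"]) auto
  next
    case False
    obtain i where i: "i \<in> F" "\<And>j. j \<in> F \<Longrightarrow> x j \<le> x i"
    proof -
      have "Max (x ` F) \<in> x ` F" using F False by (intro Max_in) auto
      then obtain i where "i \<in> F" "x i = Max (x ` F)" by auto
      then show ?thesis using F by (intro that[of i]) auto
    qed
    then obtain s where "s \<in> {i<..<T}" "x i < x s" using overtaken by blast
    moreover have "0 < i" using i(1) F by auto
    ultimately show ?thesis using i(2) by (intro that[of s]) (auto intro: le_less_trans)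
  qed
  define \<eta> where "\<eta> = Min (insert 1 ((\<lambda>i. x s - x i) ` F)) / 2"
  have fin\<eta>: "finite (insert 1 ((\<lambda>i. x s - x i) ` F))" using F by simp
  have \<eta>: "\<eta> > 0" unfolding \<eta>_def using Min_gr_iff[OF fin\<eta>] s(3) by simp
  have \<eta>F: "x i < x s - \<eta>" if "i \<in> F" for i
  proof -
    have "Min (insert 1 ((\<lambda>i. x s - x i) ` F)) \<le> x s - x i" using that by (intro Min_le fin\<eta>) auto
    then show ?thesis using s(3)[OF that] unfolding \<eta>_def by (simp add: field_simps)
  qed
  obtain d where d: "d > 0" "\<And>z. s \<le> z \<Longrightarrow> z < s + d \<Longrightarrow> \<bar>x z - x s\<bar> < \<eta>"
    by (rule cadlag_local[OF x less_imp_le[OF s(1)] \<eta>]) blast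
  \<comment> \<open>Up to \<open>w\<close> the path stays within \<open>\<eta>\<close> of \<open>X s\<close> and the points of \<open>Q\<close> are avoided.\<close>
  define w where "w = Min (insert (s + d) (insert T (Q \<inter> {s<..})))"
  have finw: "finite (insert (s + d) (insert T (Q \<inter> {s<..})))" using fin by simp
  have w: "s < w" "w \<le> s + d" "w \<le> T" "\<And>z. z \<in> Q \<Longrightarrow> s < z \<Longrightarrow> w \<le> z"
    unfolding w_def using Min_gr_iff[OF finw, of s] d(1) s(2) by (auto intro!: Min_le finw)
  obtain q where q: "q \<in> \<rat>" "s < q" "q < w" using Rats_dense_in_real[OF w(1)] by blast
  obtain p where p: "p \<in> \<rat>" "s < p" "p < q" using Rats_dense_in_real[OF q(2)] by blast
  obtain t where t: "p < t" "t \<le> q" "0 < jump x t" using dense[OF p(1) q(1)] s(1) p by auto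
  have ts: "s < t" "t < w" using t p q by auto
  have "\<bar>left_lim x t - x s\<bar> \<le> \<eta>"
    by (rule left_lim_close[OF x, of t s]) (use ts s w d in auto)
  then have "\<forall>i\<in>F. x i < left_lim x t" using \<eta>F by fastforce
  moreover have "t \<notin> Q" using w(4)[of t] ts by auto
  ultimately show ?thesis using t(3) ts s(1) w(3) by (intro bexI[of _ t]) auto
qed

lemma dyadic_powr_tendsto_0: "c > (0::real) \<Longrightarrow> (\<lambda>n. 2 powr (- (real n * c))) \<longlonglongrightarrow> 0"
  by real_asymp

lemma dyadic_powr_summable:
  assumes "\<epsilon> > (0::real)" "c \<ge> 0"
  shows "(\<Sum>n. ennreal (c * 2 powr (- (real n * \<epsilon>)))) < \<infinity>"
proof -
  have "2 powr (- (real n * \<epsilon>)) = (2 powr (- \<epsilon>)) ^ n" for n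
    by (simp add: powr_realpow[symmetric] powr_powr mult.commute)
  moreover have "norm (2 powr (- \<epsilon>)) < (1::real)" using assms by (simp add: powr_minus_divide)
  ultimately have "summable (\<lambda>n. c * 2 powr (- (real n * \<epsilon>)))"
    by (simp add: summable_geometric summable_mult)
  then have "(\<Sum>n. ennreal (c * 2 powr (- (real n * \<epsilon>)))) =
    ennreal (\<Sum>n. c * 2 powr (- (real n * \<epsilon>)))"
    using assms(2) by (intro suminf_ennreal2) auto
  then show ?thesis by simp
qed

context marked_stable_process
begin

text \<open>If the interval of a jump of size at most \<open>l = 2 ^ -n\<close> contains \<open>a\<close>, then it starts within
  \<open>2 l\<close> of the grid level just below \<open>a\<close>. Many such jumps would crowd this level.\<close>
lemma clique_size:
  assumes \<omega>: "\<omega> \<in> space M" "X 0 \<omega> = 0" and T: "T > 0"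
    and nc: "\<omega> \<notin> crowded T ((1/2) ^ n) (level_grid n) K"
    and R: "\<And>t. 0 \<le> t \<Longrightarrow> t \<le> T \<Longrightarrow> \<bar>X t \<omega>\<bar> \<le> R" "R + 2 \<le> 2 ^ n"
    and F: "finite F" "F \<subseteq> {0<..T}"
    and size: "\<And>t. t \<in> F \<Longrightarrow> (1/2) ^ Suc n < jump_at \<omega> t \<and> jump_at \<omega> t \<le> (1/2) ^ n"
    and a: "\<And>t. t \<in> F \<Longrightarrow> left_lim (\<lambda>u. X u \<omega>) t \<le> a \<and> a \<le> X t \<omega>"
  shows "card F \<le> K"
proof (rule ccontr)
  let ?x = "\<lambda>u. X u \<omega>" let ?l = "(1/2::real) ^ n"
  assume "\<not> ?thesis"
  then have K: "K \<le> card F" "F \<noteq> {}" by auto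
  then obtain t0 where t0: "t0 \<in> F" by blast
  have x: "cadlag ?x" using \<omega>(1) by (rule X_cadlag)
  have l: "?l > 0" "?l * 2 ^ n = 1" by (auto simp: power_one_over)
  have t0T: "0 < t0" "t0 \<le> T" using t0 F(2) by auto
  have "\<bar>left_lim ?x t0 - 0\<bar> \<le> R + 1"
  proof (rule left_lim_close[OF x t0T(1), of 0])
    fix z assume "0 < z" "z < t0"
    then show "\<bar>X z \<omega> - 0\<bar> < R + 1" using R(1)[of z] t0T by auto
  qed (use t0T in simp)
  moreover have "\<bar>X t0 \<omega>\<bar> \<le> R" using R(1) t0T by simp
  ultimately have aR: "\<bar>a\<bar> \<le> R + 1" using a[OF t0] by linarith
  \<comment> \<open>The grid level just below \<open>a\<close> has index \<open>i\<close>.\<close>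
  define i where "i = \<lfloor>a * 2 ^ n\<rfloor>"
  have i: "real_of_int i \<le> a * 2 ^ n" "a * 2 ^ n < real_of_int i + 1" unfolding i_def by linarith+
  have "\<bar>a * 2 ^ n\<bar> \<le> (R + 1) * 2 ^ n" using aR by (simp add: abs_mult mult_right_mono)
  moreover have "(1::real) \<le> 2 ^ n" by simp
  moreover have "(R + 2) * 2 ^ n = (R + 1) * 2 ^ n + 2 ^ n" by (simp add: algebra_simps)
  ultimately have "\<bar>real_of_int i\<bar> \<le> (R + 2) * 2 ^ n" using i by linarith
  also have "\<dots> \<le> 2 ^ n * 2 ^ n" using R(2) by (intro mult_right_mono) auto
  also have "\<dots> = (4::real) ^ n" by (simp add: power_mult_distrib[symmetric])
  finally have "real_of_int \<bar>i\<bar> \<le> real_of_int (4 ^ n)" by simp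
  then have "\<bar>i\<bar> \<le> 4 ^ n" by (simp only: of_int_le_iff)
  then have y: "real_of_int i * ?l \<in> level_grid n" unfolding level_grid_def by (intro imageI) auto
  have "\<bar>a * 2 ^ n - real_of_int i\<bar> * ?l \<le> 1 * ?l" using i l by (intro mult_right_mono) auto
  moreover have "\<bar>a * 2 ^ n - real_of_int i\<bar> * ?l = \<bar>a - real_of_int i * ?l\<bar>"
  proof -
    have "(a * 2 ^ n - real_of_int i) * ?l = a * (?l * 2 ^ n) - real_of_int i * ?l"
      by (simp add: algebra_simps)
    also have "\<dots> = a - real_of_int i * ?l" unfolding l(2) by simp
    finally show ?thesis using l(1) by (metis abs_mult abs_of_pos)
  qed
  ultimately have ay: "\<bar>a - real_of_int i * ?l\<bar> \<le> ?l" by simp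
  have "?l / 2 < jump ?x t \<and> \<bar>left_lim ?x t - real_of_int i * ?l\<bar> \<le> 2 * ?l" if t: "t \<in> F" for t
  proof
    show "?l / 2 < jump ?x t" using size[OF t] by simp
    show "\<bar>left_lim ?x t - real_of_int i * ?l\<bar> \<le> 2 * ?l"
      using size[OF t] a[OF t] ay unfolding jump_def by linarith
  qed
  then have "\<omega> \<in> crowded T ?l (level_grid n) K"
    unfolding crowded_def using \<omega> y F K(1) by blast
  then show False using nc by blast
qed

text \<open>The scale with index 0 collects the finitely many jumps larger than \<open>2 ^ -n0\<close>, each with
  its own colour. The scale with index \<open>Suc n\<close> consists of the jumps with size in
  \<open>(2 ^ -(n+1), 2 ^ -n]\<close>.\<close>
lemma partition_of_path:
  assumes T: "T > 0" and \<omega>: "\<omega> \<in> space M" "X 0 \<omega> = 0" and \<epsilon>: "\<epsilon> > 0" "3 * \<epsilon> \<le> q - \<gamma> - \<alpha>"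
    and crowd: "eventually (\<lambda>n. \<omega> \<notin> crowded T ((1/2) ^ n) (level_grid n) (clique_bound \<epsilon> n))
      sequentially"
    and smooth: "eventually (\<lambda>n. \<forall>t\<in>{0<..T}. (1/2) ^ Suc n < jump_at \<omega> t \<and> jump_at \<omega> t \<le> (1/2) ^ n \<longrightarrow>
       holder_const \<gamma> (jump_at \<omega> t) (mark t \<omega>) \<le> ennreal (2 powr (- (real n *
         (q - \<gamma> - \<epsilon>))))) sequentially"
    and finite_marks: "\<forall>t\<in>{0<..T}. 0 < jump_at \<omega> t \<longrightarrow> holder_const \<gamma> (jump_at \<omega> t) (mark t \<omega>) < \<infinity>"
    and no_jump_T: "jump_at \<omega> T \<le> 0"
    and overtaken: "\<forall>t\<in>{0<..<T}. 0 < jump_at \<omega> t \<longrightarrow> (\<exists>s\<in>{t<..<T}. X t \<omega> < X s \<omega>)"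
    and dense: "\<forall>p\<in>\<rat>. \<forall>q\<in>\<rat>. 0 \<le> p \<and> p < q \<longrightarrow> (\<exists>t\<in>{p<..q}. 0 < jump_at \<omega> t)"
  shows "\<exists>J :: nat \<Rightarrow> nat \<Rightarrow> real.
           bij_betw (\<lambda>(k, j). J k j) UNIV {t\<in>{0..T}. jump_at \<omega> t > 0} \<and>
           (\<forall>k. disjoint_family (\<lambda>j. {left_lim (\<lambda>u. X u \<omega>) (J k j)..X (J k j) \<omega>})) \<and>
           (\<Sum>k. SUP j. holder_const \<gamma> (jump_at \<omega> (J k j)) (mark (J k j) \<omega>)) < \<infinity>"
proof -
  let ?x = "\<lambda>u. X u \<omega>"
  define S where "S = {t\<in>{0..T}. jump ?x t > 0}"
  define I where "I t = {left_lim ?x t..X t \<omega>}" for t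
  define H where "H t = holder_const \<gamma> (jump ?x t) (mark t \<omega>)" for t
  have x: "cadlag ?x" using \<omega>(1) by (rule X_cadlag)
  have S: "0 < t" "t < T" "0 < jump ?x t" if "t \<in> S" for t
  proof -
    show j: "0 < jump ?x t" using that by (simp add: S_def)
    have "t \<noteq> 0" using jump_eq_0[of 0 ?x] j by auto
    moreover have "t \<noteq> T" using no_jump_T j by auto
    ultimately show "0 < t" "t < T" using that by (auto simp: S_def)
  qed
  obtain R where R: "R > 0" "\<And>t. 0 \<le> t \<Longrightarrow> t \<le> T \<Longrightarrow> \<bar>?x t\<bar> \<le> R" using cadlag_bounded[OF x] by blast
  have "eventually (\<lambda>n. R + 2 \<le> 2 ^ n) sequentially"
  proof -
    obtain m where m: "R + 2 < (2::real) ^ m" using real_arch_pow[of 2 "R + 2"] by auto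
    have "R + 2 \<le> 2 ^ n" if "n \<ge> m" for n
    proof -
      have "(2::real) ^ m \<le> 2 ^ n" by (rule power_increasing[OF that]) simp
      then show ?thesis using m by linarith
    qed
    then show ?thesis unfolding eventually_sequentially by blast
  qed
  with crowd smooth have "eventually (\<lambda>n. \<omega> \<notin> crowded T ((1/2) ^ n) (level_grid n)
    (clique_bound \<epsilon> n) \<and>
     (\<forall>t\<in>{0<..T}. (1/2) ^ Suc n < jump ?x t \<and> jump ?x t \<le> (1/2) ^ n \<longrightarrow> H t \<le> ennreal (2 powr (-
       (real n * (q - \<gamma> - \<epsilon>))))) \<and>
     R + 2 \<le> 2 ^ n) sequentially"
    unfolding H_def by eventually_elim blast
  then obtain n0 where n0: "\<And>n. n \<ge> n0 \<Longrightarrow>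
    \<omega> \<notin> crowded T ((1/2) ^ n) (level_grid n) (clique_bound \<epsilon> n)"
    "\<And>n t. n \<ge> n0 \<Longrightarrow> t \<in> {0<..T} \<Longrightarrow> (1/2) ^ Suc n < jump ?x t \<Longrightarrow> jump ?x t \<le> (1/2) ^ n \<Longrightarrow> H t \<le>
      ennreal (2 powr (- (real n * (q - \<gamma> - \<epsilon>))))"
    "\<And>n. n \<ge> n0 \<Longrightarrow> R + 2 \<le> 2 ^ n"
    unfolding eventually_sequentially by blast
  have "\<forall>t\<in>{t\<in>S. jump ?x t \<le> (1/2) ^ n0}. \<exists>n\<ge>n0. (1/2) ^ Suc n < jump ?x t \<and> jump ?x t \<le> (1/2) ^ n"
    using S(3) by (intro ballI real_dyadic_scale) auto
  then obtain sc where sc: "\<And>t. t \<in> S \<Longrightarrow> jump ?x t \<le> (1/2) ^ n0 \<Longrightarrow> n0 \<le> sc t \<and> (1/2) ^ Suc (sc t) <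
    jump ?x t \<and> jump ?x t \<le> (1/2) ^ sc t"
    by (subst (asm) bchoice_iff) blast
  define scale where "scale t = (if jump ?x t \<le> (1/2) ^ n0 then Suc (sc t) else 0)" for t
  define cell where "cell n = {t\<in>S. scale t = n}" for n
  have cell0: "cell 0 \<subseteq> {t\<in>{0..T}. jump ?x t \<ge> (1/2) ^ n0}" by (auto simp: cell_def scale_def S_def)
  have cellS: "t \<in> S" "n0 \<le> n" "(1/2) ^ Suc n < jump ?x t" "jump ?x t \<le> (1/2) ^ n"
    if "t \<in> cell (Suc n)" for t n
    using that sc by (auto simp: cell_def scale_def split: if_splits)
  have cell_fin: "finite (cell n)" for n
  proof (cases n)
    case 0
    then show ?thesis using finite_subset[OF cell0 cadlag_finite_jumps[OF x]] by simp
  next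
    case (Suc m)
    have "cell n \<subseteq> {t\<in>{0..T}. jump ?x t \<ge> (1/2) ^ Suc m}"
      unfolding Suc using cellS[of _ m] by (auto simp: S_def intro: less_imp_le)
    then show ?thesis by (rule finite_subset[OF _ cadlag_finite_jumps[OF x]]) simp
  qed
  define K where "K n = (case n of 0 \<Rightarrow> card (cell 0) | Suc m \<Rightarrow> clique_bound \<epsilon> m)" for n
  define v where "v n = (case n of 0 \<Rightarrow> (\<Sum>t\<in>cell 0. H t) | Suc m \<Rightarrow> ennreal
    (2 powr (- (real m * (q - \<gamma> - \<epsilon>)))))" for n
  have "\<forall>n. \<exists>c. (\<forall>t\<in>cell n. c t < K n) \<and> (\<forall>s\<in>cell n. \<forall>t\<in>cell n. s \<noteq> t \<and> c s = c t \<longrightarrow> I s \<inter> I t = {})"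
  proof
    fix n
    show "\<exists>c. (\<forall>t\<in>cell n. c t < K n) \<and> (\<forall>s\<in>cell n. \<forall>t\<in>cell n. s \<noteq> t \<and> c s = c t \<longrightarrow> I s \<inter> I t = {})"
    proof (cases n)
      case 0
      obtain c where "bij_betw c (cell 0) {0..<card (cell 0)}"
        using ex_bij_betw_finite_nat[OF cell_fin] by blast
      then show ?thesis unfolding 0 K_def
        by (intro exI[of _ c]) (auto simp: bij_betw_def inj_on_def)
    next
      case (Suc m)
      show ?thesis unfolding I_def
      proof (rule interval_colouring[OF cell_fin])
        show "left_lim ?x t \<le> X t \<omega>" if "t \<in> cell n" for t
          using that S(3) by (auto simp: cell_def jump_def intro: less_imp_le)
        show "card {t\<in>cell n. left_lim ?x t \<le> a \<and> a \<le> X t \<omega>} \<le> K n" for a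
        proof (cases "cell n = {}")
          case False
          then have m: "n0 \<le> m" using cellS[of _ m] Suc by blast
          show ?thesis unfolding K_def Suc nat.case
          proof (rule clique_size[OF \<omega> T n0(1)[OF m] R(2) n0(3)[OF m]])
            show "finite {t\<in>cell (Suc m). left_lim ?x t \<le> a \<and> a \<le> X t \<omega>}" using cell_fin by simp
            show "{t\<in>cell (Suc m). left_lim ?x t \<le> a \<and> a \<le> X t \<omega>} \<subseteq> {0<..T}"
              using cellS(1) S(1,2) by (fastforce simp: less_imp_le)
          qed (use cellS in auto)
        qed simp
      qed
    qed
  qed
  then obtain c where c: "\<And>n t. t \<in> cell n \<Longrightarrow> c n t < K n"
    "\<And>n s t. s \<in> cell n \<Longrightarrow> t \<in> cell n \<Longrightarrow> s \<noteq> t \<Longrightarrow> c n s = c n t \<Longrightarrow> I s \<inter> I t = {}" by metis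
  have H_le: "H t \<le> v (scale t)" if t: "t \<in> S" for t
  proof (cases "scale t")
    case 0
    then have "t \<in> cell 0" using t by (simp add: cell_def)
    then show ?thesis unfolding 0 v_def using cell_fin by (auto intro!: member_le_sum)
  next
    case (Suc m)
    then have "t \<in> cell (Suc m)" using t by (simp add: cell_def)
    then have "H t \<le> ennreal (2 powr (- (real m * (q - \<gamma> - \<epsilon>))))"
      using cellS[of t m] S[OF t] by (intro n0(2)) auto
    then show ?thesis unfolding Suc v_def by simp
  qed
  have v0: "of_nat (K 0) * v 0 < \<infinity>"
  proof -
    have "H t < \<infinity>" if "t \<in> cell 0" for t
      using that finite_marks S[of t] by (auto simp: cell_def H_def)
    then have "(\<Sum>t\<in>cell 0. H t) < \<infinity>" using cell_fin by (simp add: less_top)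
    then show ?thesis by (simp add: v_def ennreal_mult_less_top of_nat_less_top)
  qed
  have vn: "of_nat (K (Suc m)) * v (Suc m) \<le> ennreal (2 * 2 powr (- (real m * \<epsilon>)))" for m
  proof -
    have "of_nat (K (Suc m)) * v (Suc m) =
      ennreal (real (clique_bound \<epsilon> m) * 2 powr (- (real m * (q - \<gamma> - \<epsilon>))))"
      by (simp add: K_def v_def ennreal_mult ennreal_of_nat_eq_real_of_nat)
    also have "\<dots> \<le> ennreal (2 * 2 powr (- (real m * \<epsilon>)))"
    proof (rule ennreal_leI)
      have "1 \<le> 2 powr (real m * (\<alpha> + \<epsilon>))" using \<alpha> \<epsilon> by (intro ge_one_powr_ge_zero) auto
      then have "real (clique_bound \<epsilon> m) \<le> 2 * 2 powr (real m * (\<alpha> + \<epsilon>))"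
        using clique_bound_real(2)[of \<epsilon> m] by linarith
      then have "real (clique_bound \<epsilon> m) * 2 powr (- (real m * (q - \<gamma> - \<epsilon>))) \<le>
        2 * 2 powr (real m * (\<alpha> + \<epsilon>)) * 2 powr (- (real m * (q - \<gamma> - \<epsilon>)))"
        by (rule mult_right_mono) simp
      also have "\<dots> = 2 * 2 powr (real m * (2 * \<epsilon> - (q - \<gamma> - \<alpha>)))"
        unfolding mult.assoc powr_add[symmetric] by (simp add: algebra_simps)
      also have "\<dots> \<le> 2 * 2 powr (real m * (- \<epsilon>))"
        using \<epsilon>(2) by (intro mult_left_mono powr_mono) auto
      finally show "real (clique_bound \<epsilon> m) * 2 powr (- (real m * (q - \<gamma> - \<epsilon>))) \<le>
        2 * 2 powr (- (real m * \<epsilon>))"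
        by simp
    qed
    finally show ?thesis .
  qed
  have sum: "(\<Sum>n. of_nat (K n) * v n) < \<infinity>"
  proof -
    have "of_nat (K n) * v n \<le> (if n = 0 then of_nat (K 0) * v 0 else 0) + ennreal ((2 * 2 powr \<epsilon>)
      * 2 powr (- (real n * \<epsilon>)))" for n
    proof (cases n)
      case (Suc m)
      have "2 * 2 powr (- (real m * \<epsilon>)) = (2 * 2 powr \<epsilon>) * 2 powr (- (real n * \<epsilon>))"
        unfolding Suc mult.assoc powr_add[symmetric] by (simp add: algebra_simps)
      then have "of_nat (K n) * v n \<le> ennreal ((2 * 2 powr \<epsilon>) * 2 powr (- (real n * \<epsilon>)))"
        using vn[of m] unfolding Suc by (simp only:)
      then show ?thesis using Suc by simp
    qed (simp add: add_increasing2)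
    then have "(\<Sum>n. of_nat (K n) * v n) \<le>
        (\<Sum>n. (if n = 0 then of_nat (K 0) * v 0 else 0) + ennreal ((2 * 2 powr \<epsilon>) * 2 powr (-
          (real n * \<epsilon>))))"
      by (intro suminf_le summableI) auto
    also have "\<dots> = (\<Sum>n. if n = 0 then of_nat (K 0) * v 0 else 0)
      + (\<Sum>n. ennreal ((2 * 2 powr \<epsilon>) * 2 powr (- (real n * \<epsilon>))))"
      by (rule suminf_add[symmetric]) auto
    also have "\<dots> < \<infinity>"
    proof -
      have add: "y + z < \<infinity>" if "y < \<infinity>" "z < \<infinity>" for y z :: ennreal using that by simp
      have single: "(\<Sum>n::nat. if n = 0 then z else 0) = z" for z :: ennreal
        by (subst suminf_finite[of "{0::nat}"]) auto
      show ?thesis unfolding single by (intro add v0 dyadic_powr_summable \<epsilon>(1)) simp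
    qed
    finally show ?thesis .
  qed
  have ext: "\<exists>t\<in>S - F. H t < ennreal e \<and> (\<forall>i\<in>F. I t \<inter> I i = {})" if F: "finite F" "F \<subseteq> S"
    and e: "e > 0" for F e
  proof -
    have "(\<lambda>n. 2 powr (- (real n * (q - \<gamma> - \<epsilon>)))) \<longlonglongrightarrow> 0"
      using \<epsilon> \<alpha> by (intro dyadic_powr_tendsto_0) linarith
    then have "eventually (\<lambda>n. 2 powr (- (real n * (q - \<gamma> - \<epsilon>))) < e) sequentially" using e
      by (rule order_tendstoD)
    then obtain n1 where n1: "\<And>n. n \<ge> n1 \<Longrightarrow> 2 powr (- (real n * (q - \<gamma> - \<epsilon>))) < e"
      unfolding eventually_sequentially by blast
    define Q where "Q = {t\<in>{0..T}. jump ?x t \<ge> (1/2) ^ max n0 n1}"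
    have "finite Q" unfolding Q_def by (rule cadlag_finite_jumps[OF x]) simp

    obtain t where t: "t \<in> {0<..<T} - Q" "0 < jump ?x t" "\<And>i. i \<in> F \<Longrightarrow> X i \<omega> < left_lim ?x t"
    proof -
      have "F \<subseteq> {0<..<T}" using F(2) S(1,2) by auto
      moreover have "\<exists>s\<in>{t<..<T}. X t \<omega> < X s \<omega>" if "t \<in> F" for t
        using that F(2) S[of t] overtaken by auto
      moreover have "\<exists>t\<in>{p<..q}. 0 < jump ?x t" if "p \<in> \<rat>" "q \<in> \<rat>" "0 \<le> p" "p < q" for p q
        using that dense by blast
      ultimately have "\<exists>t\<in>{0<..<T} - Q. 0 < jump ?x t \<and> (\<forall>i\<in>F. X i \<omega> < left_lim ?x t)"
        by (intro jump_avoiding_finite_family[OF x T \<open>finite Q\<close> F(1)])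
      then show thesis using that by blast
    qed
    have tS: "t \<in> S" using t by (auto simp: S_def)
    have "jump ?x t < (1/2) ^ max n0 n1" using t(1) by (auto simp: Q_def)
    then obtain n where n: "n \<ge> max n0 n1" "(1/2) ^ Suc n < jump ?x t" "jump ?x t \<le> (1/2) ^ n"
      using real_dyadic_scale[OF t(2), of "max n0 n1"] by (auto intro: less_imp_le)
    have "H t \<le> ennreal (2 powr (- (real n * (q - \<gamma> - \<epsilon>))))" using n t(1) by (intro n0(2)) auto
    also have "\<dots> < ennreal e" using n1[of n] n(1) e by (simp add: ennreal_less_iff)
    finally have "H t < ennreal e" .
    moreover have "I t \<inter> I i = {}" if "i \<in> F" for i using t(3)[OF that] by (auto simp: I_def)
    moreover have "t \<notin> F"
    proof
      assume "t \<in> F"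
      from t(3)[OF this] t(2) show False by (simp add: jump_def)
    qed
    ultimately show ?thesis using tS by blast
  qed
  have "\<exists>J :: nat \<Rightarrow> nat \<Rightarrow> real. bij_betw (\<lambda>(k, j). J k j) UNIV S \<and>
     (\<forall>k. disjoint_family (\<lambda>j. I (J k j))) \<and> (\<Sum>k. SUP j. H (J k j)) < \<infinity>"
  proof (rule pad_graded_classes[where scale = scale and colour = "\<lambda>t. c (scale t) t" and K = K
    and v = v])
    show "finite {t\<in>S. scale t = n}" for n using cell_fin[of n] by (simp add: cell_def)
    show "I i \<inter> I j = {}" if "i \<in> S" "j \<in> S" "i \<noteq> j" "scale i = scale j" "c (scale i) i =
      c (scale j) j" for i j
      using that by (intro c(2)[of i "scale i" j]) (auto simp: cell_def)
    show "c (scale i) i < K (scale i)" if "i \<in> S" for i using that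
      by (intro c(1)) (simp add: cell_def)
  qed (use ext H_le sum in auto)
  then show ?thesis unfolding S_def I_def H_def .
qed

lemma almost_sure_partition:
  assumes T: "T > 0"
  shows "AE \<omega> in M. \<exists>J :: nat \<Rightarrow> nat \<Rightarrow> real.
           bij_betw (\<lambda>(k, j). J k j) UNIV {t\<in>{0..T}. jump_at \<omega> t > 0} \<and>
           (\<forall>k. disjoint_family (\<lambda>j. {left_lim (\<lambda>u. X u \<omega>) (J k j)..X (J k j) \<omega>})) \<and>
           (\<Sum>k. SUP j. holder_const \<gamma> (jump_at \<omega> (J k j)) (mark (J k j) \<omega>)) < \<infinity>"
proof -
  \<comment> \<open>The colours cost one \<open>\<epsilon>\<close> and the marks another; the third makes the sum over the scales
    converge.\<close>
  define \<epsilon> where "\<epsilon> = (q - \<gamma> - \<alpha>) / 3"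
  have \<epsilon>: "\<epsilon> > 0" "3 * \<epsilon> \<le> q - \<gamma> - \<alpha>" using \<gamma> by (auto simp: \<epsilon>_def)
  have "AE \<omega> in M. \<forall>p\<in>\<rat>. \<forall>q\<in>\<rat>. 0 \<le> p \<and> p < q \<longrightarrow> (\<exists>t\<in>{p<..q}. 0 < jump_at \<omega> t)"
  proof -
    have "AE \<omega> in M. 0 \<le> p \<and> p < q \<longrightarrow> (\<exists>t\<in>{p<..q}. 0 < jump_at \<omega> t)" for p q
      using jump_in_every_interval[of p q] by (cases "0 \<le> p \<and> p < q") auto
    then show ?thesis by (simp add: AE_ball_countable countable_rat)
  qed
  with X_0 eventually_not_crowded[OF T \<epsilon>(1)] eventually_smooth_marks[OF T \<epsilon>(1)] marks_finite[OF T]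
    no_jump_at_fixed_time[OF T] jump_is_overtaken[OF T] AE_space
  show ?thesis
  proof eventually_elim
    case (elim \<omega>)
    then show ?case by (intro partition_of_path[OF T _ _ \<epsilon>])
  qed
qed

end

theorem proposition6:
  fixes M :: "'a measure" and X :: "real \<Rightarrow> 'a \<Rightarrow> real" and mark :: "real \<Rightarrow> 'a \<Rightarrow> real \<Rightarrow> real"
    and N :: "'b measure" and Z :: "'b \<Rightarrow> real \<Rightarrow> real"
    and \<alpha> q \<gamma> T :: real
  assumes "0 < \<alpha>" "\<alpha> < 1" "\<alpha> < q"
    and "random_excursion N Z"
    and "0 < \<gamma>" "\<gamma> < q"
    and "AE \<omega> in N. holder_const \<gamma> 1 (Z \<omega>) < \<infinity>"
    and "moments_of_all_orders N (\<lambda>\<omega>. enn2real (holder_const \<gamma> 1 (Z \<omega>)))"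
    and "mark_const N Z \<alpha> q > 0"
    and "spectrally_positive_stable M X \<alpha>"
    and "independently_marked M X mark (kappa N Z q)"
    and "0 < T" "\<gamma> < q - \<alpha>"
  shows "AE \<omega> in M. \<exists>J :: nat \<Rightarrow> nat \<Rightarrow> real.
           bij_betw (\<lambda>(k, j). J k j) UNIV {t\<in>{0..T}. jump (\<lambda>u. X u \<omega>) t > 0} \<and>
           (\<forall>k. disjoint_family (\<lambda>j. {left_lim (\<lambda>u. X u \<omega>) (J k j)..X (J k j) \<omega>})) \<and>
           (\<Sum>k. SUP j. holder_const \<gamma> (jump (\<lambda>u. X u \<omega>) (J k j)) (mark (J k j) \<omega>)) < \<infinity>"
proof -
  have "prob_space M"
    using assms(10) by (simp add: spectrally_positive_stable_def levy_process_def)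
  then interpret marked_stable_process M X \<alpha> mark N Z q \<gamma>
    using assms by (intro marked_stable_process.intro stable_process.intro
        stable_process_axioms.intro marked_stable_process_axioms.intro)
  show ?thesis using \<open>0 < T\<close> by (rule almost_sure_partition)
qed

end
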